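(* Let $k\ge4$ and let $\boldsymbol{\mathcal I}\sim\mathcal H_k(m,n)$ be a random $k\mathsf{XOR}$ instance with $m:=n^{\frac{k-2}{2}+\beta}$. There is an efficient algorithm that certifies with high probability that $\boldsymbol{\mathcal I}$ has no $2\rho$-biased assignment which is $(1-\eta)$-satisfying, where $\rho\gg\frac{\log^6 n}{n^{\beta/(k-2)}}$ and \[\eta=\rho^{k-2}\left(\frac{\rho^2}{2}-\tilde O\Big(\frac{1}{\rho^{(k-2)/2}n^{(k-4)/4}n^{\beta/2}}\Big)-\tilde O\Big(\frac{1}{\rho^{(k-2)/4}n^{\beta/2}}\Big)-\frac2n\right).\]
   Context: A signed $k$-uniform hypergraph on $[n]$ is a collection of pairs $(c,U)$ with $c\in\{\pm1\}^k$, $U\in[n]^k$; $\mathcal H_k(m,n)$ includes each of the $2^kn^k$ possible pairs independently with probability $\frac{m}{2^kn^k}$. As a $k\mathsf{XOR}$ instance, $x\in\{\pm1\}^n$ satisfies $(c,U)$ iff $\prod_{i=1}^kx_{U_i}=\prod_{i=1}^kc_i$; $x$ is $(1-\eta)$-satisfying if it satisfies at least a $(1-\eta)$ fraction of clauses. $x$ is $\rho$-biased if $\frac1n|\sum_ix_i|\ge\rho$. $\tilde O$ hides polylogarithmic factors in $n$. "Certifies with high probability" means the algorithm always outputs success or failure, success implies the statement holds for the input, and success occurs with probability $1-o(1)$ on the random input. *)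

theory Defs
  imports "HOL-Probability.Probability" "HOL-Library.Log_Nat" "HOL-Library.Landau_Symbols"
begin

section \<open>Signed hypergraphs and random XOR instances\<close>

text \<open>A pair \<open>(c, U)\<close> with \<open>c\<close> in \<open>{1,-1}^k\<close> and \<open>U\<close> in \<open>[n]^k\<close>, both as lists of length \<open>k\<close>.\<close>

type_synonym clause = "int list \<times> nat list"

definition clauses :: "nat \<Rightarrow> nat \<Rightarrow> clause set" where
  "clauses k n = {(c, U). length c = k \<and> set c \<subseteq> {1, -1} \<and> length U = k \<and> set U \<subseteq> {1..n}}"

text \<open>Each of the \<open>2^k * n^k\<close> clauses is present independently.  Note that \<^const>\<open>bernoulli_pmf\<close>
  clamps its argument to \<open>[0,1]\<close>, so this is the intended distribution only if
  \<open>0 \<le> m \<le> 2^k * n^k\<close>.\<close>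

definition random_instance :: "nat \<Rightarrow> real \<Rightarrow> nat \<Rightarrow> clause set pmf" where
  "random_instance k m n =
     map_pmf (\<lambda>f. {C \<in> clauses k n. f C})
       (Pi_pmf (clauses k n) False (\<lambda>_. bernoulli_pmf (m / (2 ^ k * real n ^ k))))"

definition assignments :: "nat \<Rightarrow> (nat \<Rightarrow> int) set" where
  "assignments n = {1..n} \<rightarrow>\<^sub>E {1, -1}"

definition satisfies :: "(nat \<Rightarrow> int) \<Rightarrow> clause \<Rightarrow> bool" where
  "satisfies x C \<longleftrightarrow> (\<Prod>i<length (snd C). x (snd C ! i)) = (\<Prod>i<length (fst C). fst C ! i)"

definition biased :: "nat \<Rightarrow> real \<Rightarrow> (nat \<Rightarrow> int) \<Rightarrow> bool" where
  "biased n r x \<longleftrightarrow> 1 / real n * \<bar>real_of_int (\<Sum>i=1..n. x i)\<bar> \<ge> r"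

text \<open>At least a \<open>t\<close> fraction of the clauses is satisfied (with \<open>t = 1 - \<eta>\<close> below); every
  assignment does so on the empty instance.\<close>

definition frac_satisfying :: "real \<Rightarrow> clause set \<Rightarrow> (nat \<Rightarrow> int) \<Rightarrow> bool" where
  "frac_satisfying t I x \<longleftrightarrow> real (card {C \<in> I. satisfies x C}) \<ge> t * real (card I)"


section \<open>Polynomial-time algorithms\<close>

text \<open>Structured programs for a random access machine under the logarithmic cost criterion, which
  is polynomially equivalent to multi-tape Turing machines.  A state is a pair \<open>(R, M)\<close> of
  registers, addressed by the constants in the program, and of a memory which is accessed
  indirectly through registers; all cells hold natural numbers.  An instruction costs one plus the
  bit lengths of the numbers (addresses included) that it handles, so multiplication
  does not give unit-cost access to exponentially long numbers.\<close>

datatype arith_op = Plus | Minus | Times | Divide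

fun apply_op :: "arith_op \<Rightarrow> nat \<Rightarrow> nat \<Rightarrow> nat" where
  "apply_op Plus a b = a + b"
| "apply_op Minus a b = a - b"
| "apply_op Times a b = a * b"
| "apply_op Divide a b = a div b"

datatype program =
    Const nat nat              \<comment> \<open>\<open>R[d] := v\<close>\<close>
  | Arith arith_op nat nat nat \<comment> \<open>\<open>R[d] := R[a] op R[b]\<close>\<close>
  | Load nat nat               \<comment> \<open>\<open>R[d] := M[R[a]]\<close>\<close>
  | Store nat nat              \<comment> \<open>\<open>M[R[a]] := R[b]\<close>\<close>
  | Seq program program
  | If nat program program     \<comment> \<open>tests \<open>R[a] > 0\<close>\<close>
  | While nat program          \<comment> \<open>tests \<open>R[a] > 0\<close>\<close>

type_synonym state = "(nat \<Rightarrow> nat) \<times> (nat \<Rightarrow> nat)"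

abbreviation bit_length :: "nat \<Rightarrow> nat" where
  "bit_length v \<equiv> floorlog 2 v"

inductive exec :: "program \<Rightarrow> state \<Rightarrow> nat \<Rightarrow> state \<Rightarrow> bool" where
  Const: "exec (Const d v) (R, M) (1 + bit_length v) (R(d := v), M)"
| Arith: "exec (Arith f d a b) (R, M) (1 + bit_length (R a) + bit_length (R b))
            (R(d := apply_op f (R a) (R b)), M)"
| Load: "exec (Load d a) (R, M) (1 + bit_length (R a) + bit_length (M (R a)))
           (R(d := M (R a)), M)"
| Store: "exec (Store a b) (R, M) (1 + bit_length (R a) + bit_length (R b))
            (R, M(R a := R b))"
| Seq: "exec P s t s' \<Longrightarrow> exec Q s' u s'' \<Longrightarrow> exec (Seq P Q) s (t + u) s''"
| IfTrue: "R a > 0 \<Longrightarrow> exec P (R, M) t s' \<Longrightarrow>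
     exec (If a P Q) (R, M) (1 + bit_length (R a) + t) s'"
| IfFalse: "R a = 0 \<Longrightarrow> exec Q (R, M) t s' \<Longrightarrow> exec (If a P Q) (R, M) (1 + t) s'"
| WhileFalse: "R a = 0 \<Longrightarrow> exec (While a P) (R, M) 1 (R, M)"
| WhileTrue: "R a > 0 \<Longrightarrow> exec P (R, M) t s' \<Longrightarrow> exec (While a P) s' u s'' \<Longrightarrow>
     exec (While a P) (R, M) (1 + bit_length (R a) + t + u) s''"

lemma exec_deterministic:
  "exec P s t s' \<Longrightarrow> exec P s u s'' \<Longrightarrow> t = u \<and> s' = s''"
proof (induction arbitrary: u s'' rule: exec.induct)
  case Const
  from Const.prems show ?case by cases auto
next
  case Arith
  from Arith.prems show ?case by cases auto
next
  case Load
  from Load.prems show ?case by cases auto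
next
  case Store
  from Store.prems show ?case by cases auto
next
  case (Seq P s t s' Q u' r)
  from Seq.prems obtain t2 s2 u2
    where "exec P s t2 s2" "exec Q s2 u2 s''" "u = t2 + u2" by cases
  then show ?case using Seq.IH by metis
next
  case (IfTrue R a P M t s' Q)
  from IfTrue.prems IfTrue.hyps obtain t2
    where "exec P (R, M) t2 s''" "u = 1 + bit_length (R a) + t2" by cases auto
  then show ?case using IfTrue.IH by metis
next
  case (IfFalse R a Q M t s' P)
  from IfFalse.prems IfFalse.hyps obtain t2
    where "exec Q (R, M) t2 s''" "u = 1 + t2" by cases auto
  then show ?case using IfFalse.IH by metis
next
  case (WhileFalse R a P M)
  from WhileFalse.prems WhileFalse.hyps show ?case by cases auto
next
  case (WhileTrue R a P M t s' u' r)
  from WhileTrue.prems WhileTrue.hyps obtain t2 s2 u2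
    where "exec P (R, M) t2 s2" "exec (While a P) s2 u2 s''"
      "u = 1 + bit_length (R a) + t2 + u2" by cases auto
  then show ?case using WhileTrue.IH by metis
qed

definition initial_state :: "nat list \<Rightarrow> state" where
  "initial_state ws =
     ((\<lambda>_. 0)(0 := length ws), (\<lambda>i. if i < length ws then ws ! i else 0))"

text \<open>\<open>computes P ws t v\<close>: on input \<open>ws\<close>, \<open>P\<close> halts after time \<open>t\<close> with result \<open>v\<close>.\<close>

definition computes :: "program \<Rightarrow> nat list \<Rightarrow> nat \<Rightarrow> nat \<Rightarrow> bool" where
  "computes P ws t v \<longleftrightarrow> (\<exists>R M. exec P (initial_state ws) t (R, M) \<and> R 0 = v)"

definition input_size :: "nat list \<Rightarrow> nat" where
  "input_size ws = (\<Sum>w\<leftarrow>ws. 1 + bit_length w)"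

definition polynomial_time :: "program \<Rightarrow> nat list set \<Rightarrow> bool" where
  "polynomial_time P W \<longleftrightarrow>
     (\<exists>d. \<forall>ws\<in>W. \<exists>t v. computes P ws t v \<and> t \<le> d * input_size ws ^ d + d)"


section \<open>Certification\<close>

text \<open>Results 1 and 0 stand for success and failure.  \<open>X n\<close> are the instances of size \<open>n\<close>,
  \<open>enc n\<close> is their encoding as inputs, \<open>D n\<close> is the distribution of the random instance and
  \<open>S n\<close> is the statement to be certified.\<close>

definition certifies_whp ::
  "program \<Rightarrow> (nat \<Rightarrow> 'a set) \<Rightarrow> (nat \<Rightarrow> 'a \<Rightarrow> nat list) \<Rightarrow> (nat \<Rightarrow> 'a pmf) \<Rightarrow>
     (nat \<Rightarrow> 'a \<Rightarrow> bool) \<Rightarrow> bool" where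
  "certifies_whp P X enc D S \<longleftrightarrow>
     (\<forall>n\<ge>1. \<forall>I\<in>X n. \<exists>t v. computes P (enc n I) t v \<and> v \<in> {0, 1} \<and> (v = 1 \<longrightarrow> S n I)) \<and>
     (\<lambda>n. measure_pmf.prob (D n) {I. \<exists>t. computes P (enc n I) t 1}) \<longlonglongrightarrow> 1"

definition clause_list :: "nat \<Rightarrow> nat \<Rightarrow> clause list" where
  "clause_list k n = List.product (List.n_lists k [1, -1]) (List.n_lists k [1..<Suc n])"

lemma set_clause_list: "set (clause_list k n) = clauses k n"
  by (auto simp: clause_list_def clauses_def set_n_lists)

text \<open>The instance is given by its characteristic vector over all \<open>2^k * n^k\<close> clauses; this has
  polynomial length since \<open>k\<close> is constant.  The bias parameter \<open>r\<close> and the satisfaction threshold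
  \<open>t\<close> of the property to be certified are given to \<open>n\<close> binary places after the point.  Rounding
  both down is the conservative direction: it only enlarges the set of assignments to be excluded.
  A negative threshold becomes 0, which is equivalent to it (both are met by every assignment).\<close>

definition encode :: "nat \<Rightarrow> nat \<Rightarrow> real \<Rightarrow> real \<Rightarrow> clause set \<Rightarrow> nat list" where
  "encode k n r t I =
     n # nat \<lfloor>2 ^ n * r\<rfloor> # nat \<lfloor>2 ^ n * t\<rfloor> # map (\<lambda>C. if C \<in> I then 1 else 0) (clause_list k n)"

text \<open>The parameter \<open>L\<close> is the polylogarithmic factor hidden by the soft-O notation.\<close>

definition eta :: "nat \<Rightarrow> real \<Rightarrow> real \<Rightarrow> real \<Rightarrow> nat \<Rightarrow> real" where
  "eta k \<beta> L r n =
     r ^ (k - 2) *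
       (r\<^sup>2 / 2
        - L * (1 / (r powr ((real k - 2) / 2) * real n powr ((real k - 4) / 4) * real n powr (\<beta> / 2)))
        - L * (1 / (r powr ((real k - 2) / 4) * real n powr (\<beta> / 2)))
        - 2 / real n)"

end

theory Submission
  imports Defs "HOL-Real_Asymp.Real_Asymp"
begin

text \<open>Write \<open>k = 2 + 2 h + s\<close> with \<open>s = k mod 2\<close>.  A clause satisfied by \<open>x\<close> says that the product
  of its first two variables equals its sign times the product of the remaining \<open>k - 2\<close> variables.
  Summed over all clauses, the left side is about \<open>(1/n \<Sum> x)\<^sup>2\<close> per clause, hence at least
  \<open>4 \<rho>\<^sup>2\<close> for a biased assignment, provided that the multigraph of the first two variables is close
  to its average; the right side is a random signed form of degree \<open>k - 2\<close>, which is \<open>o(\<rho>\<^sup>2)\<close> since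
  there are \<open>n ^ ((k - 2) / 2 + \<beta>)\<close> clauses.  As \<open>\<eta> \<le> \<rho> ^ k / 2\<close>, both bounds together exclude biased
  assignments that satisfy all but an \<open>\<eta>\<close> fraction.

  Both bounds are certified by \<open>(z\<^sup>T A z) ^ (2 t) \<le> N ^ (2 t) * Tr (A ^ (2 t))\<close> for sign vectors \<open>z\<close>
  and symmetric matrices \<open>A\<close> of size \<open>N\<close>.  For the form of degree \<open>k - 2\<close> (odd if \<open>s = 1\<close>), the
  Cauchy-Schwarz inequality over the last \<open>s\<close> variables gives a quadratic form over pairs of clauses
  that agree there.  Whenever \<open>\<eta> > 0\<close>, the error term \<open>1 / (\<rho> ^ ((k - 2) / 4) n ^ (\<beta> / 2))\<close> forces
  \<open>\<rho> ^ 4 n ^ \<beta> \<ge> n ^ (\<beta> / 5)\<close>.  This polynomial slack has two effects: the exponent \<open>t\<close> can be a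
  constant, so that the traces are polynomial-size sums that a program evaluates naively, and Markov's
  inequality for the expected traces suffices.\<close>

section \<open>Compiling arithmetic expressions\<close>

text \<open>The input does not contain the clause probability p, yet the trace estimate needs
  centred indicators. The coefficients of both matrices sum to zero over all clauses (for
  \<open>matP\<close>, over each of its two clauses separately), so subtracting p from every
  indicator leaves the matrices unchanged. The program evaluates the raw 0/1 form; the analysis
  works with the centred one. Soundness is deterministic and holds for every instance. In the
  probabilistic half, rounding is the obstacle: failing the test for a threshold above 1 does not
  give \<eta> \<ge> 0 but only \<eta> > -1/2^n. The term 2/n inside \<eta>, together with
  \<rho>^(k-2) \<ge> n^(-\<beta>), makes up for this; here the growth condition on \<rho> enters if
  \<beta> > 0. If \<beta> \<le> 0, the same condition makes \<rho> eventually at least 2, and no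
  assignment is biased enough.\<close>

definition runs :: "program \<Rightarrow> (nat \<Rightarrow> nat) \<Rightarrow> (nat \<Rightarrow> nat) \<Rightarrow> nat \<Rightarrow> (nat \<Rightarrow> nat) \<Rightarrow> bool" where
  "runs P R M B R' \<longleftrightarrow> (\<exists>t\<le>B. exec P (R, M) t (R', M))"

lemma runs_mono: "runs P R M B R' \<Longrightarrow> B \<le> B' \<Longrightarrow> runs P R M B' R'"
  unfolding runs_def using order_trans by blast

lemma runs_Seq: "runs P R M B R' \<Longrightarrow> runs Q R' M B' R'' \<Longrightarrow> runs (Seq P Q) R M (B + B') R''"
  unfolding runs_def by (meson add_mono exec.Seq)

lemma bit_length_le: "v < 2 ^ B \<Longrightarrow> bit_length v \<le> B"
  by (simp add: floorlog_leI)

lemma runs_Const: "v < 2 ^ G \<Longrightarrow> runs (Const d v) R M (1 + G) (R(d := v))"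
  unfolding runs_def by (meson add_left_mono bit_length_le exec.Const)

lemma runs_Arith:
  assumes "R a < 2 ^ G" "R b < 2 ^ G"
  shows "runs (Arith f d a b) R M (1 + 2 * G) (R(d := apply_op f (R a) (R b)))"
  unfolding runs_def
  using exec.Arith[of f d a b R M] bit_length_le[OF assms(1)] bit_length_le[OF assms(2)]
  by (intro exI[of _ "1 + bit_length (R a) + bit_length (R b)"]) simp

lemma runs_Load:
  assumes "R a < 2 ^ G" "M (R a) < 2 ^ G"
  shows "runs (Load d a) R M (1 + 2 * G) (R(d := M (R a)))"
  unfolding runs_def
  using exec.Load[of d a R M] bit_length_le[OF assms(1)] bit_length_le[OF assms(2)]
  by (intro exI[of _ "1 + bit_length (R a) + bit_length (M (R a))"]) simp

lemma runs_While_step: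
  assumes "R a > 0" "R a < 2 ^ G" "runs P R M B R'" "runs (While a P) R' M B' R''"
  shows "runs (While a P) R M (1 + G + B + B') R''"
proof -
  obtain t u where "t \<le> B" "exec P (R, M) t (R', M)" "u \<le> B'" "exec (While a P) (R', M) u (R'', M)"
    using assms by (auto simp: runs_def)
  then show ?thesis
    unfolding runs_def using exec.WhileTrue[of R a P M t "(R', M)" u "(R'', M)"] assms(1)
      bit_length_le[OF assms(2)]
    by (intro exI[of _ "1 + bit_length (R a) + t + u"]) auto
qed

lemma runs_While_exit: "R a = 0 \<Longrightarrow> runs (While a P) R M 1 R"
  unfolding runs_def using exec.WhileFalse by blast

text \<open>The only loops run up to a fixed polynomial in \<open>M 0\<close>, where the encoding
  puts n. Termination and polynomial running time therefore follow by induction on the expression,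
  once for all programs.\<close>

datatype nexp =
    NConst nat
  | NVar nat
  | NOp arith_op nexp nexp
  | NLoad nexp
  | NBig bool nat nat nat nexp \<comment> \<open>sum or product over the values of a variable below \<open>a * M[0]^j\<close>\<close>

fun neval :: "(nat \<Rightarrow> nat) \<Rightarrow> (nat \<Rightarrow> nat) \<Rightarrow> nexp \<Rightarrow> nat" where
  "neval M \<sigma> (NConst v) = v"
| "neval M \<sigma> (NVar x) = \<sigma> x"
| "neval M \<sigma> (NOp f a b) = apply_op f (neval M \<sigma> a) (neval M \<sigma> b)"
| "neval M \<sigma> (NLoad a) = M (neval M \<sigma> a)"
| "neval M \<sigma> (NBig p x a j e) =
     (if p then \<Sum>i<a * M 0 ^ j. neval M (\<sigma>(x := i)) e else \<Prod>i<a * M 0 ^ j. neval M (\<sigma>(x := i)) e)"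

text \<open>The machine has no empty statement; clearing the scratch register \<open>d + 2\<close>
  stands in for it in the base case.\<close>

fun repeat_times :: "nat \<Rightarrow> nat \<Rightarrow> program" where
  "repeat_times 0 d = Const (d + 2) 0"
| "repeat_times (Suc j) d = Seq (Arith Times d d (d + 1)) (repeat_times j d)"

text \<open>Register \<open>\<tau> x\<close> holds the variable \<open>x\<close>; the value goes to register \<open>d\<close>, and registers
  below \<open>d\<close> are preserved.  Loops count down, so that their index is the loop counter itself.\<close>

fun compile :: "(nat \<Rightarrow> nat) \<Rightarrow> nat \<Rightarrow> nexp \<Rightarrow> program" where
  "compile \<tau> d (NConst v) = Const d v"
| "compile \<tau> d (NVar x) = Seq (Const d 0) (Arith Plus d d (\<tau> x))"
| "compile \<tau> d (NOp f a b) = Seq (compile \<tau> d a) (Seq (compile \<tau> (d + 1) b) (Arith f d d (d + 1)))"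
| "compile \<tau> d (NLoad a) = Seq (compile \<tau> d a) (Load d d)"
| "compile \<tau> d (NBig p x a j e) =
     Seq (Const d a) (Seq (Const (d + 1) 0) (Seq (Load (d + 1) (d + 1)) (Seq (repeat_times j d)
       (Seq (Const (d + 1) (if p then 0 else 1)) (Seq (Const (d + 2) 1)
         (Seq (While d (Seq (Arith Minus d d (d + 2))
                 (Seq (compile (\<tau>(x := d)) (d + 3) e)
                   (Arith (if p then Plus else Times) (d + 1) (d + 1) (d + 3)))))
           (Arith Plus d d (d + 1))))))))"

lemma apply_op_bound:
  assumes "x < 2 ^ A" "y < 2 ^ A" "A \<ge> 1"
  shows "apply_op f x y < 2 ^ (2 * A)"
proof -
  have sq: "(2::nat) ^ (2 * A) = 2 ^ A * 2 ^ A" by (simp add: power_add mult_2)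
  have two: "(2::nat) \<le> 2 ^ A" using assms(3) by (cases A) auto
  have le: "2 * (2::nat) ^ A \<le> 2 ^ A * 2 ^ A" using two by simp
  have "x * y < 2 ^ A * 2 ^ A" using assms(1,2) by (intro mult_strict_mono) auto
  moreover have "x - y < 2 * (2::nat) ^ A" "x div y < 2 * (2::nat) ^ A" "x + y < 2 * (2::nat) ^ A"
    using assms(1,2) div_le_dividend[of x y] by linarith+
  ultimately have "x + y < 2 ^ A * 2 ^ A" "x - y < 2 ^ A * 2 ^ A" "x * y < 2 ^ A * 2 ^ A"
    "x div y < 2 ^ A * 2 ^ A" using le by (blast intro: order_less_le_trans)+
  then show ?thesis unfolding sq by (cases f) (simp_all only: apply_op.simps)
qed

lemma repeat_times_runs:
  assumes "R d * R (d + 1) ^ j < 2 ^ G" "R (d + 1) < 2 ^ G" "R (d + 1) > 0" "G > 0"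
  shows "\<exists>R'. runs (repeat_times j d) R M ((j + 1) * (1 + 2 * G)) R' \<and>
    R' d = R d * R (d + 1) ^ j \<and> (\<forall>i<d. R' i = R i)"
  using assms
proof (induction j arbitrary: R)
  case 0
  have "runs (Const (d + 2) 0) R M (1 + 2 * G) (R(d + 2 := 0))"
    by (rule runs_mono[OF runs_Const[of 0 G "d + 2" R M]]) auto
  then show ?case by (intro exI[of _ "R(d + 2 := 0)"] conjI) (simp_all del: fun_upd_apply, simp_all)
next
  case (Suc j)
  let ?R = "R(d := R d * R (d + 1))"
  have "R d * 1 \<le> R d * R (d + 1) ^ Suc j" using Suc.prems(3) by (intro mult_le_mono) auto
  then have lt: "R d < 2 ^ G" using Suc.prems(1) by linarith
  have st: "runs (Arith Times d d (d + 1)) R M (1 + 2 * G) ?R"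
    using runs_Arith[of R d G "d + 1" Times d M] lt Suc.prems(2) by simp
  have "?R d * ?R (d + 1) ^ j < 2 ^ G" using Suc.prems(1) by (simp add: mult.assoc)
  then obtain R' where R': "runs (repeat_times j d) ?R M ((j + 1) * (1 + 2 * G)) R'"
    "R' d = ?R d * ?R (d + 1) ^ j" "\<forall>i<d. R' i = ?R i"
  proof -
    have "?R (d + 1) < 2 ^ G" "?R (d + 1) > 0" using Suc.prems by simp_all
    then show ?thesis using Suc.IH[of ?R] Suc.prems(4) that \<open>?R d * ?R (d + 1) ^ j < 2 ^ G\<close> by blast
  qed
  have "runs (repeat_times (Suc j) d) R M ((1 + 2 * G) + (j + 1) * (1 + 2 * G)) R'"
    unfolding repeat_times.simps by (rule runs_Seq[OF st R'(1)])
  then show ?case using R'(2,3) by (intro exI[of _ R']) (auto simp: algebra_simps)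
qed

lemma big_bound:
  fixes f :: "nat \<Rightarrow> nat"
  assumes "\<And>i. i \<in> I \<Longrightarrow> f i < 2 ^ B" "finite I"
  shows "(if p then sum f I else prod f I) \<le> 2 ^ (B * card I)"
  using assms(2,1)
proof (induction I rule: finite_induct)
  case (insert i I)
  let ?s = "if p then sum f I else prod f I"
  have IH: "?s \<le> 2 ^ (B * card I)" and fi: "f i < 2 ^ B" using insert by auto
  have ge: "(1::nat) \<le> 2 ^ (B * card I)" "(1::nat) \<le> 2 ^ B" by auto
  \<comment> \<open>A sum of two positive numbers exceeds their product by at most 1, and the strict
    bound on \<open>f i\<close> pays for that 1. So the bound for products serves sums as
    well.\<close>
  have "x + y \<le> x * y + 1" if "1 \<le> x" "1 \<le> y" for x y :: nat
    using that by (cases x; cases y) auto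
  from this[OF ge] have "f i + ?s \<le> 2 ^ B * 2 ^ (B * card I)" using IH fi by (simp add: mult.commute)
  moreover have "f i * ?s \<le> 2 ^ B * 2 ^ (B * card I)" using IH fi by (intro mult_le_mono) auto
  moreover have "(2::nat) ^ (B * card (insert i I)) = 2 ^ B * 2 ^ (B * card I)"
    using insert.hyps by (simp add: power_add algebra_simps)
  ultimately show ?case using insert.hyps by (auto split: if_splits)
qed auto

text \<open>Loop invariant: register \<open>d\<close> counts the indices still to come, and register
  \<open>d + 1\<close> holds the aggregate \<open>F\<close> over the upper segment already
  processed.\<close>

lemma loop_runs:
  fixes body :: program and d :: nat and h :: "nat \<Rightarrow> nat"
  assumes body: "\<And>R. R d > 0 \<Longrightarrow> R d \<le> c \<Longrightarrow> R (d + 2) = 1 \<Longrightarrow> (\<forall>i<d. R i = R0 i) \<Longrightarrow>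
      R (d + 1) = F {R d..<c} \<Longrightarrow>
      \<exists>R'. runs body R M T R' \<and> R' d = R d - 1 \<and> R' (d + 2) = 1 \<and> (\<forall>i<d. R' i = R0 i) \<and>
        R' (d + 1) = F {R d - 1..<c}"
    and "c < 2 ^ G"
  shows "R d \<le> c \<Longrightarrow> R (d + 2) = 1 \<Longrightarrow> (\<forall>i<d. R i = R0 i) \<Longrightarrow> R (d + 1) = F {R d..<c} \<Longrightarrow>
    \<exists>R'. runs (While d body) R M (R d * (1 + G + T) + 1) R' \<and> R' d = 0 \<and> (\<forall>i<d. R' i = R0 i) \<and>
        R' (d + 1) = F {0..<c}"
proof (induction "R d" arbitrary: R)
  case 0
  then show ?case using runs_While_exit[of R d body M] by (intro exI[of _ R]) auto
next
  case (Suc m)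
  obtain R1 where R1: "runs body R M T R1" "R1 d = R d - 1" "R1 (d + 2) = 1"
      "\<forall>i<d. R1 i = R0 i" "R1 (d + 1) = F {R d - 1..<c}"
    using body[of R] Suc by auto
  then obtain R' where R': "runs (While d body) R1 M (R1 d * (1 + G + T) + 1) R'" "R' d = 0"
      "\<forall>i<d. R' i = R0 i" "R' (d + 1) = F {0..<c}"
  proof -
    have "m = R1 d" using R1(2) Suc.hyps(2) by simp
    moreover have "R1 d \<le> c" using R1(2) Suc.prems(1) by simp
    moreover have "R1 (d + 1) = F {R1 d..<c}" using R1(2,5) by simp
    ultimately show ?thesis using Suc.hyps(1)[of R1] R1(3,4) that by blast
  qed
  have "R d < 2 ^ G" using Suc.prems assms(2) by linarith
  then have "runs (While d body) R M (1 + G + T + (R1 d * (1 + G + T) + 1)) R'"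
    using runs_While_step[OF _ _ R1(1) R'(1)] Suc.hyps(2) by auto
  moreover have "1 + G + T + (R1 d * (1 + G + T) + 1) = R d * (1 + G + T) + 1"
    using R1(2) Suc.hyps(2)[symmetric] by simp
  ultimately show ?case using R' by metis
qed

definition fits :: "nat \<Rightarrow> nat \<Rightarrow> (nat \<Rightarrow> nat) \<Rightarrow> (nat \<Rightarrow> nat) \<Rightarrow> nat \<Rightarrow> (nat \<Rightarrow> nat) \<Rightarrow> bool" where
  "fits K S M \<tau> d R \<longleftrightarrow> S \<ge> 2 \<and> (\<forall>a. M a < 2 ^ S) \<and> 0 < M 0 \<and> M 0 \<le> S \<and>
     (\<forall>x. \<tau> x < d \<and> R (\<tau> x) < 2 ^ S ^ K)"

text \<open>One exponent bounds both the running time and the bit length of the result, since the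
  length of a value is the cost of handling it. The exponent is uniform in S, the memory and the
  register allocation. K is separate because a loop introduces a variable with a length bound of its
  own.\<close>

definition polyrun :: "nat \<Rightarrow> nat \<Rightarrow> nexp \<Rightarrow> bool" where
  "polyrun K c e \<longleftrightarrow> (\<forall>S M \<tau> d R. fits K S M \<tau> d R \<longrightarrow>
     (\<exists>R'. runs (compile \<tau> d e) R M (S ^ c) R' \<and> R' d = neval M (R \<circ> \<tau>) e \<and> R' d < 2 ^ S ^ c \<and>
       (\<forall>i<d. R' i = R i)))"

text \<open>Constant factors are traded for a larger exponent, so that every bound below stays a
  pure power of S.\<close>

lemma power_absorb:
  fixes S :: nat
  assumes "S \<ge> 2"
  shows "2 ^ b * S ^ c \<le> S ^ (c + b)"
proof -
  have "2 ^ b \<le> S ^ b" using assms by (rule power_mono) simp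
  then show ?thesis by (simp add: power_add)
qed

lemma less_two_power_mono: "v < 2 ^ a \<Longrightarrow> a \<le> b \<Longrightarrow> (v::nat) < 2 ^ b"
  by (meson one_le_numeral order_less_le_trans power_increasing)

lemma polyrun_NConst: "polyrun K (v + 2) (NConst v)"
  unfolding polyrun_def
proof (intro allI impI)
  fix S M \<tau> d R assume "fits K S M \<tau> d R"
  then have S: "S \<ge> 2" by (simp add: fits_def)
  have "v < 2 ^ v" by simp
  also have "(2::nat) ^ v \<le> S ^ v" using S by (simp add: power_mono)
  finally have v: "v < S ^ v" .
  also have "S ^ v < 2 ^ S ^ v" by simp
  finally have lt: "v < 2 ^ S ^ v" .
  have "1 + S ^ v \<le> S ^ (v + 2)"
  proof -
    have "1 \<le> S ^ v" using S by simp
    moreover have "4 * S ^ v \<le> S ^ (v + 2)" using power_absorb[OF S, of 2 v] by simp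
    ultimately show ?thesis by linarith
  qed
  then have "runs (Const d v) R M (S ^ (v + 2)) (R(d := v))"
    using runs_mono[OF runs_Const[OF lt]] by blast
  moreover have "v < 2 ^ S ^ (v + 2)"
    by (rule less_two_power_mono[OF lt]) (use S in \<open>auto intro: power_increasing\<close>)
  ultimately show "\<exists>R'. runs (compile \<tau> d (NConst v)) R M (S ^ (v + 2)) R' \<and>
      R' d = neval M (R \<circ> \<tau>) (NConst v) \<and> R' d < 2 ^ S ^ (v + 2) \<and> (\<forall>i<d. R' i = R i)"
    by (intro exI[of _ "R(d := v)"]) auto
qed

lemma polyrun_NVar: "polyrun K (K + 4) (NVar x)"
  unfolding polyrun_def
proof (intro allI impI)
  fix S M \<tau> d R assume f: "fits K S M \<tau> d R"
  then have S: "S \<ge> 2" and x: "\<tau> x < d" "R (\<tau> x) < 2 ^ S ^ K" by (auto simp: fits_def)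
  have one: "1 \<le> S ^ K" using S by simp
  have 1: "runs (Const d 0) R M (1 + S ^ K) (R(d := 0))" by (rule runs_Const) simp
  have 2: "runs (Arith Plus d d (\<tau> x)) (R(d := 0)) M (1 + 2 * S ^ K) (R(d := R (\<tau> x)))"
    using runs_Arith[of "R(d := 0)" d "S ^ K" "\<tau> x" Plus d M] x by simp
  have "16 * S ^ K \<le> S ^ (K + 4)" using power_absorb[OF S, of 4 K] by simp
  then have le: "(1 + S ^ K) + (1 + 2 * S ^ K) \<le> S ^ (K + 4)" using one by linarith
  have "R (\<tau> x) < 2 ^ S ^ (K + 4)"
    by (rule less_two_power_mono[OF x(2)]) (use le in linarith)
  then show "\<exists>R'. runs (compile \<tau> d (NVar x)) R M (S ^ (K + 4)) R' \<and>
      R' d = neval M (R \<circ> \<tau>) (NVar x) \<and> R' d < 2 ^ S ^ (K + 4) \<and> (\<forall>i<d. R' i = R i)"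
    using runs_mono[OF runs_Seq[OF 1 2] le] by (intro exI[of _ "R(d := R (\<tau> x))"]) auto
qed

lemma polyrun_mono: "polyrun K c e \<Longrightarrow> c \<le> c' \<Longrightarrow> polyrun K c' e"
  unfolding polyrun_def
proof (intro allI impI)
  fix S M \<tau> d R
  assume *: "\<forall>S M \<tau> d R. fits K S M \<tau> d R \<longrightarrow>
     (\<exists>R'. runs (compile \<tau> d e) R M (S ^ c) R' \<and> R' d = neval M (R \<circ> \<tau>) e \<and> R' d < 2 ^ S ^ c \<and>
       (\<forall>i<d. R' i = R i))" and c: "c \<le> c'" and f: "fits K S M \<tau> d R"
  then have "S ^ c \<le> S ^ c'" by (auto simp: fits_def intro: power_increasing)
  then show "\<exists>R'. runs (compile \<tau> d e) R M (S ^ c') R' \<and> R' d = neval M (R \<circ> \<tau>) e \<and>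
      R' d < 2 ^ S ^ c' \<and> (\<forall>i<d. R' i = R i)"
    using * f runs_mono less_two_power_mono by meson
qed

lemma polyrun_NLoad:
  assumes "polyrun K c a"
  shows "polyrun K (c + 4) (NLoad a)"
  unfolding polyrun_def
proof (intro allI impI)
  fix S M \<tau> d R assume f: "fits K S M \<tau> d R"
  then have S: "S \<ge> 2" and M: "\<And>a. M a < 2 ^ S" by (auto simp: fits_def)
  obtain R1 where R1: "runs (compile \<tau> d a) R M (S ^ c) R1" "R1 d = neval M (R \<circ> \<tau>) a"
      "R1 d < 2 ^ S ^ c" "\<forall>i<d. R1 i = R i"
    using assms f unfolding polyrun_def by meson
  have S2: "S ^ (c + 1) \<ge> S" "S ^ (c + 1) \<ge> S ^ c" "1 \<le> S ^ c"
    using S power_increasing[of 1 "c + 1" S] power_increasing[of c "c + 1" S] by auto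
  have 2: "runs (Load d d) R1 M (1 + 2 * S ^ (c + 1)) (R1(d := M (R1 d)))"
    by (rule runs_Load) (use R1(3) M S2 less_two_power_mono in blast)+
  have "8 * S ^ (c + 1) \<le> S ^ (c + 4)"
    using power_absorb[OF S, of 3 "c + 1"] by (simp add: numeral_eq_Suc)
  then have le: "S ^ c + (1 + 2 * S ^ (c + 1)) \<le> S ^ (c + 4)" using S2 by linarith
  have "M (R1 d) < 2 ^ S ^ (c + 4)"
    by (rule less_two_power_mono[OF M]) (use le S2 in linarith)
  then show "\<exists>R'. runs (compile \<tau> d (NLoad a)) R M (S ^ (c + 4)) R' \<and>
      R' d = neval M (R \<circ> \<tau>) (NLoad a) \<and> R' d < 2 ^ S ^ (c + 4) \<and> (\<forall>i<d. R' i = R i)"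
    using runs_mono[OF runs_Seq[OF R1(1) 2] le] R1 by (intro exI[of _ "R1(d := M (R1 d))"]) auto
qed

lemma comp_cong_below: "\<forall>x. \<tau> x < d \<Longrightarrow> \<forall>i<d. R1 i = R i \<Longrightarrow> R1 \<circ> \<tau> = R \<circ> \<tau>"
  by auto

lemma polyrun_NOp:
  assumes "polyrun K c a" "polyrun K c b"
  shows "polyrun K (c + 4) (NOp f a b)"
  unfolding polyrun_def
proof (intro allI impI)
  fix S M \<tau> d R assume f: "fits K S M \<tau> d R"
  then have S: "S \<ge> 2" and \<tau>: "\<forall>x. \<tau> x < d" by (auto simp: fits_def)
  obtain R1 where R1: "runs (compile \<tau> d a) R M (S ^ c) R1" "R1 d = neval M (R \<circ> \<tau>) a"
      "R1 d < 2 ^ S ^ c" "\<forall>i<d. R1 i = R i"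
    using assms(1) f unfolding polyrun_def by meson
  have eq: "R1 \<circ> \<tau> = R \<circ> \<tau>" using \<tau> R1(4) by (rule comp_cong_below)
  have "fits K S M \<tau> (d + 1) R1" using f R1(4) unfolding fits_def by (auto simp: less_SucI)
  then obtain R2 where R2: "runs (compile \<tau> (d + 1) b) R1 M (S ^ c) R2"
      "R2 (d + 1) = neval M (R \<circ> \<tau>) b" "R2 (d + 1) < 2 ^ S ^ c" "\<forall>i<d + 1. R2 i = R1 i"
    using assms(2) eq unfolding polyrun_def by metis
  let ?v = "apply_op f (R2 d) (R2 (d + 1))"
  have one: "1 \<le> S ^ c" using S by simp
  have "R2 d < 2 ^ S ^ c" using R1(3) R2(4) by simp
  note bd = this R2(3)
  have 3: "runs (Arith f d d (d + 1)) R2 M (1 + 2 * S ^ c) (R2(d := ?v))"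
    by (rule runs_Arith) (use bd in auto)
  have "16 * S ^ c \<le> S ^ (c + 4)"
    using power_absorb[OF S, of 4 c] by simp
  then have le: "S ^ c + (S ^ c + (1 + 2 * S ^ c)) \<le> S ^ (c + 4)" using one by linarith
  have "?v < 2 ^ S ^ (c + 4)"
    by (rule less_two_power_mono[OF apply_op_bound[OF bd one]]) (use le in linarith)
  then show "\<exists>R'. runs (compile \<tau> d (NOp f a b)) R M (S ^ (c + 4)) R' \<and>
      R' d = neval M (R \<circ> \<tau>) (NOp f a b) \<and> R' d < 2 ^ S ^ (c + 4) \<and> (\<forall>i<d. R' i = R i)"
    using runs_mono[OF runs_Seq[OF R1(1) runs_Seq[OF R2(1) 3]] le] R1 R2
    by (intro exI[of _ "R2(d := ?v)"]) auto
qed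

lemma polyrun_NBig:
  assumes e: "polyrun (max K (a + j)) c e"
  shows "polyrun K (c + 2 * a + 2 * j + 12) (NBig p x a j e)"
  unfolding polyrun_def
proof (intro allI impI)
  fix S M \<tau> d R assume f: "fits K S M \<tau> d R"
  let ?g = "if p then (0::nat) else 1" and ?op = "if p then Plus else Times"
  let ?cnt = "a * M 0 ^ j"
  let ?v = "\<lambda>i. neval M ((R \<circ> \<tau>)(x := i)) e"
  let ?F = "\<lambda>I. if p then sum ?v I else prod ?v I"
  let ?body = "Seq (Arith Minus d d (d + 2)) (Seq (compile (\<tau>(x := d)) (d + 3) e)
                   (Arith ?op (d + 1) (d + 1) (d + 3)))"
  have S: "S \<ge> 2" and \<tau>: "\<forall>x. \<tau> x < d" and M: "\<And>a. M a < 2 ^ S" and M0: "0 < M 0" "M 0 \<le> S"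
    using f by (auto simp: fits_def)
  have Spos: "1 \<le> S ^ q" for q using S by simp
  have aS: "a \<le> S ^ a"
    by (meson S less_exp less_imp_le order_trans power_mono zero_le)
  have cnt: "?cnt \<le> S ^ (a + j)"
    unfolding power_add using aS M0 by (intro mult_le_mono power_mono) auto
  \<comment> \<open>The body yields values of bit length at most S^c and the loop has at most S^(a +
    j) rounds, so S^(c + a + j) bounds the length of every accumulator. The additional S^3 is room
    for a factor 8.\<close>
  define G where "G = S ^ (c + a + j + 3)"
  have G8: "S ^ (c + a + j) * 8 \<le> G"
    unfolding G_def using power_absorb[OF S, of 3 "c + a + j"] by simp
  have pinc: "S ^ q \<le> S ^ (c + a + j)" if "q \<le> c + a + j" for q
    using that S by (intro power_increasing) auto
  have Sp1: "1 \<le> S ^ (c + a + j)" by (rule Spos)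
  have cG: "S ^ c \<le> G" and ajG: "S ^ (a + j) \<le> G" and G1: "1 \<le> G"
    using pinc[of c] pinc[of "a + j"] G8 Sp1 by auto
  have SG: "S \<le> G"
    unfolding G_def using S power_increasing[of 1 "c + a + j + 3" S] by simp
  have lt: "v < 2 ^ G" if "v < 2 ^ S ^ c" for v :: nat using that cG less_two_power_mono by blast
  have cntG: "?cnt < 2 ^ G"
  proof -
    have "?cnt < 2 ^ S ^ (a + j)" using cnt less_exp[of "S ^ (a + j)"] by linarith
    then show ?thesis using ajG less_two_power_mono by blast
  qed
  have vb: "\<exists>R'. runs (compile (\<tau>(x := d)) (d + 3) e) R2 M (S ^ c) R' \<and> R' (d + 3) = ?v (R2 d) \<and>
      ?v (R2 d) < 2 ^ S ^ c \<and> (\<forall>i<d + 3. R' i = R2 i)"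
    if R2: "\<forall>i<d. R2 i = R i" "R2 d < ?cnt" for R2
  proof -
    have "R2 d < 2 ^ S ^ max K (a + j)"
    proof -
      have "R2 d < 2 ^ S ^ (a + j)" using cnt R2(2) less_exp[of "S ^ (a + j)"] by linarith
      moreover have "S ^ (a + j) \<le> S ^ max K (a + j)" using S by (intro power_increasing) auto
      ultimately show ?thesis using less_two_power_mono by blast
    qed
    moreover have "R2 (\<tau> y) < 2 ^ S ^ max K (a + j)" for y
    proof -
      have "R (\<tau> y) < 2 ^ S ^ K" using f by (auto simp: fits_def)
      moreover have "S ^ K \<le> S ^ max K (a + j)" using S by (intro power_increasing) auto
      ultimately show ?thesis using less_two_power_mono R2(1) \<tau> by metis
    qed
    ultimately have "fits (max K (a + j)) S M (\<tau>(x := d)) (d + 3) R2"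
      using S M M0 \<tau> by (auto simp: fits_def trans_less_add1)
    moreover have "R2 \<circ> \<tau>(x := d) = (R \<circ> \<tau>)(x := R2 d)"
      using R2(1) \<tau> by (auto simp: fun_eq_iff)
    ultimately show ?thesis using e unfolding polyrun_def by metis
  qed
  have vlt: "?v i < 2 ^ S ^ c" if "i < ?cnt" for i
    using vb[of "R(d := i)"] that by auto
  have Fle: "?F {q..<?cnt} < 2 ^ G" for q
  proof -
    have "?F {q..<?cnt} \<le> 2 ^ (S ^ c * card {q..<?cnt})" using vlt by (intro big_bound) auto
    also have "\<dots> \<le> 2 ^ (S ^ c * ?cnt)" by (intro power_increasing) auto
    also have "\<dots> \<le> 2 ^ (S ^ c * S ^ (a + j))" using cnt by (intro power_increasing) auto
    also have "\<dots> = 2 ^ S ^ (c + a + j)" by (simp add: power_add mult.assoc)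
    also have "\<dots> < 2 ^ G" using G8 Sp1 by (intro power_strict_increasing) auto
    finally show ?thesis .
  qed
  have body: "\<exists>R'. runs ?body R1 M ((1 + 2 * G) + (S ^ c + (1 + 2 * G))) R' \<and> R' d = R1 d - 1 \<and>
      R' (d + 2) = 1 \<and> (\<forall>i<d. R' i = R i) \<and> R' (d + 1) = ?F {R1 d - 1..<?cnt}"
    if R1: "R1 d > 0" "R1 d \<le> ?cnt" "R1 (d + 2) = 1" "\<forall>i<d. R1 i = R i" "R1 (d + 1) = ?F {R1 d..<?cnt}" for R1
  proof -
    let ?R2 = "R1(d := R1 d - 1)"
    have 1: "runs (Arith Minus d d (d + 2)) R1 M (1 + 2 * G) ?R2"
      using runs_Arith[of R1 d G "d + 2" Minus d M] R1(2,3) cntG one_less_power[of "2::nat" G] G1 by auto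
    obtain R3 where R3: "runs (compile (\<tau>(x := d)) (d + 3) e) ?R2 M (S ^ c) R3"
        "R3 (d + 3) = ?v (R1 d - 1)" "?v (R1 d - 1) < 2 ^ S ^ c" "\<forall>i<d + 3. R3 i = ?R2 i"
    proof -
      have "?R2 d < ?cnt" "?R2 d = R1 d - 1" "\<forall>i<d. ?R2 i = R i" using R1(1,2,4) by auto
      then show ?thesis using vb[of ?R2] that by metis
    qed
    have R3': "R3 (d + 1) = ?F {R1 d..<?cnt}" using R3(4) R1(5) by simp
    let ?R4 = "R3(d + 1 := apply_op ?op (R3 (d + 1)) (R3 (d + 3)))"
    have 3: "runs (Arith ?op (d + 1) (d + 1) (d + 3)) R3 M (1 + 2 * G) ?R4"
      using R3' Fle[of "R1 d"] R3(2,3) lt by (intro runs_Arith) auto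
    have "{R1 d - 1..<?cnt} = insert (R1 d - 1) {R1 d..<?cnt}" using R1(1,2) by auto
    then have "?R4 (d + 1) = ?F {R1 d - 1..<?cnt}"
      using R3' R3(2) R1(1) by auto
    then show ?thesis using runs_Seq[OF 1 runs_Seq[OF R3(1) 3]] R3(4) R1 by (intro exI[of _ ?R4]) auto
  qed
  let ?total = "(1 + G) + ((1 + G) + ((1 + 2 * G) + ((j + 1) * (1 + 2 * G) + ((1 + G) + ((1 + G) +
       ((?cnt * (1 + G + ((1 + 2 * G) + (S ^ c + (1 + 2 * G)))) + 1) + (1 + 2 * G)))))))"
  let ?RA = "R(d := a, d + 1 := 0)" and ?RB = "R(d := a, d + 1 := M 0)"
  have "a < 2 ^ G"
  proof -
    have "a * 1 \<le> a * M 0 ^ j" using M0 by (intro mult_le_mono) auto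
    then show ?thesis using cntG by linarith
  qed
  then have s1: "runs (Const d a) R M (1 + G) (R(d := a))" by (rule runs_Const)
  have s2: "runs (Const (d + 1) 0) (R(d := a)) M (1 + G) ?RA" by (rule runs_Const) simp
  have s3: "runs (Load (d + 1) (d + 1)) ?RA M (1 + 2 * G) ?RB"
    using runs_Load[of ?RA "d + 1" G M "d + 1"] M[of 0] SG less_two_power_mono by auto
  obtain RC where RC: "runs (repeat_times j d) ?RB M ((j + 1) * (1 + 2 * G)) RC"
      "RC d = ?cnt" "\<forall>i<d. RC i = ?RB i"
    using repeat_times_runs[of ?RB d j G M] M0 M[of 0] SG less_two_power_mono cntG G1 by auto
  let ?RD = "RC(d + 1 := ?g)" let ?RE = "?RD(d + 2 := 1)"
  have gG: "?g < 2 ^ G" "1 < (2::nat) ^ G" using G1 one_less_power[of "2::nat" G] by auto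
  have s5: "runs (Const (d + 1) ?g) RC M (1 + G) ?RD" using gG by (intro runs_Const)
  have s6: "runs (Const (d + 2) 1) ?RD M (1 + G) ?RE" using gG by (intro runs_Const)
  have "\<exists>R'. runs (While d ?body) ?RE M (?RE d * (1 + G + ((1 + 2 * G) + (S ^ c + (1 + 2 * G)))) + 1) R' \<and>
      R' d = 0 \<and> (\<forall>i<d. R' i = R i) \<and> R' (d + 1) = ?F {0..<?cnt}"
    by (rule loop_runs[OF body cntG]) (use RC in auto)
  then obtain RF where RF: "runs (While d ?body) ?RE M (?cnt * (1 + G + ((1 + 2 * G) + (S ^ c + (1 + 2 * G)))) + 1) RF"
     "RF d = 0" "\<forall>i<d. RF i = R i" "RF (d + 1) = ?F {0..<?cnt}" using RC(2) by auto
  let ?RG = "RF(d := RF (d + 1))"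
  have s8: "runs (Arith Plus d d (d + 1)) RF M (1 + 2 * G) ?RG"
    using runs_Arith[of RF d G "d + 1" Plus d M] RF Fle[of 0] by simp
  have all: "runs (compile \<tau> d (NBig p x a j e)) R M
     (?total) ?RG"
    unfolding compile.simps
    by (rule runs_Seq[OF s1 runs_Seq[OF s2 runs_Seq[OF s3 runs_Seq[OF RC(1) runs_Seq[OF s5
          runs_Seq[OF s6 runs_Seq[OF RF(1) s8]]]]]]])
  have jS: "j \<le> S ^ j" by (meson S less_exp less_imp_le order_trans power_mono zero_le)
  have j1: "j + 1 \<le> 2 * S ^ (a + j)"
  proof -
    have "S ^ j \<le> S ^ (a + j)" using S by (intro power_increasing) auto
    then show ?thesis using jS Spos[of "a + j"] by linarith
  qed
  have "?total \<le>
     15 * G + (j + 1) * (3 * G) + ?cnt * (9 * G)"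
  proof -
    have "(j + 1) * (1 + 2 * G) \<le> (j + 1) * (3 * G)" using G1 by (intro mult_le_mono) auto
    moreover have "?cnt * (1 + G + ((1 + 2 * G) + (S ^ c + (1 + 2 * G)))) \<le> ?cnt * (9 * G)"
      using G1 cG by (intro mult_le_mono) linarith+
    ultimately show ?thesis using G1 by linarith
  qed
  also have "\<dots> \<le> 15 * (S ^ (a + j) * G) + (2 * S ^ (a + j)) * (3 * G) + S ^ (a + j) * (9 * G)"
    using Spos[of "a + j"] j1 cnt by (intro add_mono mult_le_mono) auto
  also have "\<dots> \<le> (2 ^ 8 * S ^ (a + j)) * G" by simp
  also have "\<dots> \<le> S ^ (a + j + 8) * G"
    using power_absorb[OF S, of 8 "a + j"] by (intro mult_le_mono1)
  finally have tot: "?total \<le> S ^ (a + j + 8) * G" .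
  have exp: "S ^ (a + j + 8) * G = S ^ (c + 2 * a + 2 * j + 11)"
    unfolding G_def power_add[symmetric] by (simp add: algebra_simps mult_2)
  have final: "S ^ (a + j + 8) * G \<le> S ^ (c + 2 * a + 2 * j + 12)"
    unfolding exp using S by (intro power_increasing) auto
  have GF: "G \<le> S ^ (c + 2 * a + 2 * j + 12)"
    unfolding G_def using S by (intro power_increasing) auto
  have val: "?F {0..<?cnt} = neval M (R \<circ> \<tau>) (NBig p x a j e)"
    by (simp add: lessThan_atLeast0)
  have "runs (compile \<tau> d (NBig p x a j e)) R M (S ^ (c + 2 * a + 2 * j + 12)) ?RG"
    by (rule runs_mono[OF all]) (use tot final in linarith)
  moreover have "?RG d = neval M (R \<circ> \<tau>) (NBig p x a j e)" using RF(4) val by simp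
  moreover have "?RG d < 2 ^ S ^ (c + 2 * a + 2 * j + 12)"
    using Fle[of 0] RF(4) GF less_two_power_mono by simp
  moreover have "\<forall>i<d. ?RG i = R i" using RF(3) by simp
  ultimately show "\<exists>R'. runs (compile \<tau> d (NBig p x a j e)) R M (S ^ (c + 2 * a + 2 * j + 12)) R' \<and>
      R' d = neval M (R \<circ> \<tau>) (NBig p x a j e) \<and> R' d < 2 ^ S ^ (c + 2 * a + 2 * j + 12) \<and>
      (\<forall>i<d. R' i = R i)" by blast
qed

text \<open>The induction generalises K because the body of a loop must be handled with the larger
  bound \<open>max K (a + j)\<close>.\<close>

lemma polyrun_exists: "\<exists>c. polyrun K c e"
proof (induction e arbitrary: K)
  case (NOp f a b)
  obtain c1 c2 where "polyrun K c1 a" "polyrun K c2 b" using NOp by meson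
  then have "polyrun K (max c1 c2) a" "polyrun K (max c1 c2) b" using polyrun_mono by (meson max.cobounded1 max.cobounded2)+
  then show ?case using polyrun_NOp by blast
qed (use polyrun_NConst polyrun_NVar polyrun_NLoad polyrun_NBig in blast)+

section \<open>The certificate as an expression\<close>

text \<open>Register 0 holds the input length at the start and must hold the answer at the end. The
  value is computed from register 1 upward and copied down last.\<close>

definition expression_program :: "nexp \<Rightarrow> program" where
  "expression_program e = Seq (compile (\<lambda>_. 0) 1 e) (Seq (Const 2 0) (Arith Plus 0 1 2))"

lemma member_le_input_size: "w \<in> set ws \<Longrightarrow> 1 + bit_length w \<le> input_size ws"
  unfolding input_size_def by (induction ws) auto

lemma length_le_input_size: "length ws \<le> input_size ws"
  unfolding input_size_def by (induction ws) auto

lemma less_two_power_bit_length: "v < 2 ^ bit_length v"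
  using floorlog_le_iff[of 2 v "bit_length v"] by simp

text \<open>The first word is written in binary, so loops up to a power of it could be exponential
  in the input size. The condition \<open>ws ! 0 \<le> length ws\<close> excludes this; encodings of
  instances meet it because of the long characteristic vector.\<close>

lemma expression_program_computes:
  "\<exists>d. \<forall>ws. ws \<noteq> [] \<and> 0 < ws ! 0 \<and> ws ! 0 \<le> length ws \<longrightarrow>
     (\<exists>t. computes (expression_program e) ws t
            (neval (snd (initial_state ws)) (\<lambda>_. length ws) e) \<and> t \<le> d * input_size ws ^ d + d)"
proof -
  obtain c where c: "polyrun 1 c e" using polyrun_exists by blast
  \<comment> \<open>From (s + 2)^(c + 4) \<le> (3 s)^(c + 4) for input size s \<ge> 1; the same
    number also has to serve as an exponent, so it must be at least c + 4.\<close>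
  let ?d = "3 ^ (c + 4) :: nat"
  have "\<exists>t. computes (expression_program e) ws t
            (neval (snd (initial_state ws)) (\<lambda>_. length ws) e) \<and> t \<le> ?d * input_size ws ^ ?d + ?d"
    if ws: "ws \<noteq> []" "0 < ws ! 0" "ws ! 0 \<le> length ws" for ws
  proof -
    let ?s = "input_size ws"
    let ?S = "?s + 2"
    obtain R M where RM: "initial_state ws = (R, M)" by (cases "initial_state ws")
    have R0: "R 0 = length ws" and M: "M = (\<lambda>i. if i < length ws then ws ! i else 0)"
      using RM by (auto simp: initial_state_def)
    have s1: "1 \<le> ?s" using length_le_input_size[of ws] ws(1) by (cases ws) auto
    have Mb: "M a < 2 ^ ?S" for a
    proof (cases "a < length ws")
      case True
      then have "bit_length (ws ! a) \<le> ?S" using member_le_input_size[of "ws ! a" ws] by simp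
      then have "ws ! a < 2 ^ ?S" by (rule less_two_power_mono[OF less_two_power_bit_length])
      then show ?thesis using True by (simp add: M)
    qed (simp add: M)
    have "length ws < 2 ^ ?S"
      using length_le_input_size[of ws] less_exp[of ?S] by linarith
    then have "fits 1 ?S M (\<lambda>_. 0) 1 R"
      using Mb ws length_le_input_size[of ws] unfolding fits_def by (auto simp: R0 M)
    then obtain R1 where R1: "runs (compile (\<lambda>_. 0) 1 e) R M (?S ^ c) R1"
        "R1 1 = neval M (R \<circ> (\<lambda>_. 0)) e" "R1 1 < 2 ^ ?S ^ c"
      using c unfolding polyrun_def by meson
    have env: "R \<circ> (\<lambda>_. 0) = (\<lambda>_. length ws)" by (auto simp: R0)
    have 2: "runs (Const 2 0) R1 M (1 + ?S ^ c) (R1(2 := 0))" by (rule runs_Const) simp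
    have 3: "runs (Arith Plus 0 1 2) (R1(2 := 0)) M (1 + 2 * ?S ^ c) (R1(2 := 0, 0 := R1 1))"
      using runs_Arith[of "R1(2 := 0)" 1 "?S ^ c" 2 Plus 0 M] R1(3) by simp
    have "runs (expression_program e) R M (?S ^ c + ((1 + ?S ^ c) + (1 + 2 * ?S ^ c))) (R1(2 := 0, 0 := R1 1))"
      unfolding expression_program_def by (rule runs_Seq[OF R1(1) runs_Seq[OF 2 3]])
    then obtain t where t: "exec (expression_program e) (R, M) t (R1(2 := 0, 0 := R1 1), M)"
        "t \<le> ?S ^ c + ((1 + ?S ^ c) + (1 + 2 * ?S ^ c))" unfolding runs_def by blast
    have "16 * ?S ^ c \<le> ?S ^ (c + 4)" using power_absorb[of ?S 4 c] by simp
    moreover have "1 \<le> ?S ^ c" by simp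
    ultimately have "t \<le> ?S ^ (c + 4)" using t(2) by linarith
    also have "\<dots> \<le> (3 * ?s) ^ (c + 4)" using s1 by (intro power_mono) auto
    also have "\<dots> = ?d * ?s ^ (c + 4)" by (simp only: power_mult_distrib)
    also have "\<dots> \<le> ?d * ?s ^ ?d + ?d"
    proof -
      have "c + 4 \<le> ?d" 
      proof -
        have "c + 4 < 2 ^ (c + 4)" by (rule less_exp)
        also have "\<dots> \<le> ?d" by (intro power_mono) auto
        finally show ?thesis by simp
      qed
      then have "?s ^ (c + 4) \<le> ?s ^ ?d" using s1 by (intro power_increasing) auto
      then show ?thesis by (intro trans_le_add1 mult_le_mono2)
    qed
    finally have "t \<le> ?d * ?s ^ ?d + ?d" .
    moreover have "computes (expression_program e) ws t (neval (snd (initial_state ws)) (\<lambda>_. length ws) e)"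
    proof -
      have "neval (snd (initial_state ws)) (\<lambda>_. length ws) e = R1 1"
        by (simp only: RM snd_conv env[symmetric] R1(2))
      then show ?thesis
        unfolding computes_def RM using t(1)
        by (rule_tac exI[of _ "R1(2 := 0, 0 := R1 1)"], rule_tac exI[of _ M]) simp
    qed
    ultimately show ?thesis by blast
  qed
  then show ?thesis by blast
qed

section \<open>Integer-valued expressions as formal differences\<close>

type_synonym iexp = "nexp \<times> nexp"

text \<open>Machine subtraction truncates at 0, so an integer is carried as a pair of naturals
  standing for their difference. Values are read as reals to match the analysis.\<close>

definition rval :: "(nat \<Rightarrow> nat) \<Rightarrow> (nat \<Rightarrow> nat) \<Rightarrow> iexp \<Rightarrow> real" where
  "rval M \<sigma> e = real (neval M \<sigma> (fst e)) - real (neval M \<sigma> (snd e))"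

abbreviation nadd :: "nexp \<Rightarrow> nexp \<Rightarrow> nexp" where "nadd \<equiv> NOp Plus"
abbreviation nsub :: "nexp \<Rightarrow> nexp \<Rightarrow> nexp" where "nsub \<equiv> NOp Minus"
abbreviation nmul :: "nexp \<Rightarrow> nexp \<Rightarrow> nexp" where "nmul \<equiv> NOp Times"
abbreviation ndiv :: "nexp \<Rightarrow> nexp \<Rightarrow> nexp" where "ndiv \<equiv> NOp Divide"

definition nmod :: "nexp \<Rightarrow> nexp \<Rightarrow> nexp" where "nmod a b = nsub a (nmul (ndiv a b) b)"
text \<open>Under truncated subtraction \<open>a - b\<close> vanishes exactly if a \<le> b, so
  comparisons become arithmetic with truth values 0 and 1.\<close>

definition nle :: "nexp \<Rightarrow> nexp \<Rightarrow> nexp" where "nle a b = nsub (NConst 1) (nsub a b)"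
definition neq :: "nexp \<Rightarrow> nexp \<Rightarrow> nexp" where "neq a b = nmul (nle a b) (nle b a)"
definition nnot :: "nexp \<Rightarrow> nexp" where "nnot a = nsub (NConst 1) a"
definition nor :: "nexp \<Rightarrow> nexp \<Rightarrow> nexp" where "nor a b = nnot (nmul (nnot a) (nnot b))"
primrec npow :: "nexp \<Rightarrow> nat \<Rightarrow> nexp" where
  "npow a 0 = NConst 1" | "npow a (Suc j) = nmul a (npow a j)"

definition iof :: "nexp \<Rightarrow> iexp" where "iof a = (a, NConst 0)"
definition iadd :: "iexp \<Rightarrow> iexp \<Rightarrow> iexp" where "iadd a b = (nadd (fst a) (fst b), nadd (snd a) (snd b))"
definition isub :: "iexp \<Rightarrow> iexp \<Rightarrow> iexp" where "isub a b = (nadd (fst a) (snd b), nadd (snd a) (fst b))"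
definition imul :: "iexp \<Rightarrow> iexp \<Rightarrow> iexp" where
  "imul a b = (nadd (nmul (fst a) (fst b)) (nmul (snd a) (snd b)),
               nadd (nmul (fst a) (snd b)) (nmul (snd a) (fst b)))"
definition isum :: "nat \<Rightarrow> nat \<Rightarrow> nat \<Rightarrow> iexp \<Rightarrow> iexp" where
  "isum x a j e = (NBig True x a j (fst e), NBig True x a j (snd e))"
definition ile :: "iexp \<Rightarrow> iexp \<Rightarrow> nexp" where "ile a b = nle (nadd (fst a) (snd b)) (nadd (fst b) (snd a))"
primrec iprod :: "(nat \<Rightarrow> iexp) \<Rightarrow> nat \<Rightarrow> iexp" where
  "iprod f 0 = iof (NConst 1)" | "iprod f (Suc j) = imul (iprod f j) (f j)"

lemma neval_nmod [simp]: "neval M \<sigma> (nmod a b) = neval M \<sigma> a mod neval M \<sigma> b"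
  by (simp add: nmod_def minus_div_mult_eq_mod)
lemma neval_nle [simp]: "neval M \<sigma> (nle a b) = of_bool (neval M \<sigma> a \<le> neval M \<sigma> b)"
  by (simp add: nle_def)
lemma neval_neq [simp]: "neval M \<sigma> (neq a b) = of_bool (neval M \<sigma> a = neval M \<sigma> b)"
  by (simp add: neq_def)
lemma neval_nnot [simp]: "neval M \<sigma> (nnot a) = of_bool (neval M \<sigma> a = 0)"
  by (simp add: nnot_def)
lemma neval_nor [simp]: "neval M \<sigma> (nor a b) = of_bool (neval M \<sigma> a \<noteq> 0 \<or> neval M \<sigma> b \<noteq> 0)"
  by (simp add: nor_def)
lemma neval_npow [simp]: "neval M \<sigma> (npow a j) = neval M \<sigma> a ^ j"
  by (induction j) auto

lemma rval_iof [simp]: "rval M \<sigma> (iof a) = real (neval M \<sigma> a)"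
  by (simp add: rval_def iof_def)
lemma rval_iadd [simp]: "rval M \<sigma> (iadd a b) = rval M \<sigma> a + rval M \<sigma> b"
  by (simp add: rval_def iadd_def)
lemma rval_isub [simp]: "rval M \<sigma> (isub a b) = rval M \<sigma> a - rval M \<sigma> b"
  by (simp add: rval_def isub_def)
lemma rval_imul [simp]: "rval M \<sigma> (imul a b) = rval M \<sigma> a * rval M \<sigma> b"
  by (simp add: rval_def imul_def algebra_simps)
lemma rval_isum [simp]: "rval M \<sigma> (isum x a j e) = (\<Sum>i<a * M 0 ^ j. rval M (\<sigma>(x := i)) e)"
  by (simp add: rval_def isum_def sum_subtractf)
lemma rval_iprod [simp]: "rval M \<sigma> (iprod f j) = (\<Prod>i<j. rval M \<sigma> (f i))"
  by (induction j) auto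
lemma neval_ile [simp]: "neval M \<sigma> (ile a b) = of_bool (rval M \<sigma> a \<le> rval M \<sigma> b)"
proof -
  have "(x + w \<le> y + z) \<longleftrightarrow> (real x - real z \<le> real y - real w)" for x y z w :: nat
    by linarith
  then show ?thesis by (simp add: ile_def rval_def)
qed

section \<open>Matrix powers and traces\<close>

primrec mpow :: "(nat \<Rightarrow> nat \<Rightarrow> real) \<Rightarrow> nat \<Rightarrow> nat \<Rightarrow> nat \<Rightarrow> nat \<Rightarrow> real" where
  "mpow A N 0 r s = of_bool (r = s)"
| "mpow A N (Suc L) r s = (\<Sum>q<N. A r q * mpow A N L q s)"

definition mtrace :: "(nat \<Rightarrow> nat \<Rightarrow> real) \<Rightarrow> nat \<Rightarrow> nat \<Rightarrow> real" where
  "mtrace A N L = (\<Sum>r<N. mpow A N L r r)"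

text \<open>The variable \<open>Suc (x + y)\<close> differs from x and y, so binding it captures
  neither. N is an exponent here: the matrix has \<open>M 0 ^ N\<close> rows.\<close>

primrec mpow_exp :: "(nat \<Rightarrow> nat \<Rightarrow> iexp) \<Rightarrow> nat \<Rightarrow> nat \<Rightarrow> nat \<Rightarrow> nat \<Rightarrow> iexp" where
  "mpow_exp A N 0 x y = iof (neq (NVar x) (NVar y))"
| "mpow_exp A N (Suc L) x y =
     (let z = Suc (x + y) in isum z 1 N (imul (A x z) (mpow_exp A N L z y)))"

definition trace_exp :: "(nat \<Rightarrow> nat \<Rightarrow> iexp) \<Rightarrow> nat \<Rightarrow> nat \<Rightarrow> iexp" where
  "trace_exp A N L = isum 0 1 N (mpow_exp A N L 0 0)"

lemma rval_mpow_exp: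
  assumes "\<And>\<sigma> x y. rval M \<sigma> (A x y) = a (\<sigma> x) (\<sigma> y)"
  shows "rval M \<sigma> (mpow_exp A N L x y) = mpow a (M 0 ^ N) L (\<sigma> x) (\<sigma> y)"
proof (induction L arbitrary: x y \<sigma>)
  case 0
  show ?case by simp
next
  case (Suc L)
  show ?case by (simp add: Let_def assms Suc.IH)
qed

lemma rval_trace_exp:
  assumes "\<And>\<sigma> x y. rval M \<sigma> (A x y) = a (\<sigma> x) (\<sigma> y)"
  shows "rval M \<sigma> (trace_exp A N L) = mtrace a (M 0 ^ N) L"
  using rval_mpow_exp[of M A a, OF assms] by (simp add: trace_exp_def mtrace_def)

text \<open>A clause is addressed by its position \<open>C\<close> in \<open>clause_list k n\<close>.  The base-\<open>n\<close> digits of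
  \<open>C\<close> below position \<open>k\<close> are the variables (shifted by one), the binary digits of \<open>C div n ^ k\<close>
  are the signs.\<close>

definition blk :: "nat \<Rightarrow> nat \<Rightarrow> nat \<Rightarrow> nat \<Rightarrow> nat" where
  "blk n i l C = C div n ^ i mod n ^ l"

definition sg :: "nat \<Rightarrow> nat \<Rightarrow> nat \<Rightarrow> real" where
  "sg k n C = (\<Prod>j<k. 1 - 2 * real (C div n ^ k div 2 ^ j mod 2))"

definition weight :: "nat \<Rightarrow> nat \<Rightarrow> (nat \<Rightarrow> real) \<Rightarrow> real" where
  "weight k n \<xi> = (\<Sum>C<2 ^ k * n ^ k. \<xi> C)"

text \<open>Up to scaling, the deviation of the symmetrised adjacency matrix of the first two
  variables from its mean: a clause adds n^2 at its pair in both orders and takes 2 from every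
  entry. The scale n^2 keeps the entries integral.\<close>

definition coefG :: "nat \<Rightarrow> nat \<Rightarrow> nat \<Rightarrow> nat \<Rightarrow> real" where
  "coefG n r C r' = (real n)\<^sup>2 * (of_bool (blk n 0 1 C = r \<and> blk n 1 1 C = r') +
     of_bool (blk n 0 1 C = r' \<and> blk n 1 1 C = r)) - 2"

definition matG :: "nat \<Rightarrow> nat \<Rightarrow> (nat \<Rightarrow> real) \<Rightarrow> nat \<Rightarrow> nat \<Rightarrow> real" where
  "matG k n \<xi> r r' = (\<Sum>C<2 ^ k * n ^ k. coefG n r C r' * \<xi> C)"

definition half :: "nat \<Rightarrow> nat" where "half k = (k - 2) div 2"
definition par :: "nat \<Rightarrow> nat" where "par k = k mod 2"

text \<open>The 2 h variables between the first two and the label are halved. Rows carry the first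
  halves of both clauses, columns the second halves. A row thus constrains both clauses, as the row
  sum bound requires; with one whole clause per side, it would constrain only one of them.\<close>

definition src :: "nat \<Rightarrow> nat \<Rightarrow> nat \<Rightarrow> nat \<Rightarrow> nat" where
  "src k n C C' = blk n 2 (half k) C + n ^ half k * blk n 2 (half k) C'"

definition dst :: "nat \<Rightarrow> nat \<Rightarrow> nat \<Rightarrow> nat \<Rightarrow> nat" where
  "dst k n C C' = blk n (2 + half k) (half k) C + n ^ half k * blk n (2 + half k) (half k) C'"

definition lab :: "nat \<Rightarrow> nat \<Rightarrow> nat \<Rightarrow> nat" where
  "lab k n C = blk n (2 + 2 * half k) (par k) C"

definition coefP :: "nat \<Rightarrow> nat \<Rightarrow> nat \<Rightarrow> nat \<Rightarrow> nat \<Rightarrow> nat \<Rightarrow> real" where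
  "coefP k n r C C' r' = sg k n C * sg k n C' *
     of_bool (C mod n ^ k \<noteq> C' mod n ^ k) * of_bool (lab k n C = lab k n C') *
     (of_bool (src k n C C' = r \<and> dst k n C C' = r') + of_bool (src k n C C' = r' \<and> dst k n C C' = r))"

text \<open>Pairs of clauses on the same tuple of variables are left out of \<open>matP\<close>: their terms have
  positive mean, and they contribute at most \<open>2 ^ k\<close> per clause of the instance.\<close>

definition matP :: "nat \<Rightarrow> nat \<Rightarrow> (nat \<Rightarrow> real) \<Rightarrow> nat \<Rightarrow> nat \<Rightarrow> real" where
  "matP k n \<xi> r r' = (\<Sum>C<2 ^ k * n ^ k. \<Sum>C'<2 ^ k * n ^ k. coefP k n r C C' r' * (\<xi> C * \<xi> C'))"

text \<open>\<open>R\<close> is the bias parameter scaled by \<open>2 ^ n\<close>; the powers of \<open>2 ^ n\<close> clear denominators.\<close>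

definition certificate :: "nat \<Rightarrow> nat \<Rightarrow> nat \<Rightarrow> real \<Rightarrow> (nat \<Rightarrow> real) \<Rightarrow> bool" where
  "certificate k t n R \<xi> \<longleftrightarrow>
     mtrace (matG k n \<xi>) n (2 * t) * (2 ^ n) ^ (4 * t) \<le> (4 * real n * weight k n \<xi> * R\<^sup>2) ^ (2 * t) \<and>
     real n ^ par k * 2 ^ (k + 1) * (2 ^ n) ^ 4 \<le> R ^ 4 * weight k n \<xi> \<and>
     mtrace (matP k n \<xi>) (n ^ (2 * half k)) (2 * t) * real n ^ (2 * t * (k - 2)) * (2 ^ n) ^ (8 * t) \<le>
       (R ^ 4 * (weight k n \<xi>)\<^sup>2) ^ (2 * t)"

text \<open>R > 2^n forces \<rho> > 1, and no assignment is 2\<rho>-biased. T > 2^n forces a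
  threshold above 1, which no assignment meets unless the instance is empty; hence the guard on the
  weight.\<close>

definition accept :: "nat \<Rightarrow> nat \<Rightarrow> nat \<Rightarrow> nat \<Rightarrow> nat \<Rightarrow> (nat \<Rightarrow> real) \<Rightarrow> bool" where
  "accept k t n R T \<xi> \<longleftrightarrow> R > 2 ^ n \<or>
     weight k n \<xi> \<ge> 1 \<and> (T > 2 ^ n \<or> certificate k t n (real R) \<xi>)"

section \<open>The certificate as an expression over the encoded input\<close>

definition n_exp :: nexp where "n_exp = NLoad (NConst 0)"
definition R_exp :: nexp where "R_exp = NLoad (NConst 1)"
definition T_exp :: nexp where "T_exp = NLoad (NConst 2)"
text \<open>The exponent n is not constant, so \<open>npow\<close> cannot express this power; it is
  a product of n factors 2.\<close>

definition two_n_exp :: nexp where "two_n_exp = NBig False 0 1 1 (NConst 2)"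
definition chi_exp :: "nat \<Rightarrow> iexp" where "chi_exp x = iof (NLoad (nadd (NConst 3) (NVar x)))"
definition blk_exp :: "nat \<Rightarrow> nat \<Rightarrow> nat \<Rightarrow> nexp" where
  "blk_exp i l x = nmod (ndiv (NVar x) (npow n_exp i)) (npow n_exp l)"
definition sg_exp :: "nat \<Rightarrow> nat \<Rightarrow> iexp" where
  "sg_exp k x = iprod (\<lambda>j. isub (iof (NConst 1)) (imul (iof (NConst 2))
     (iof (nmod (ndiv (ndiv (NVar x) (npow n_exp k)) (npow (NConst 2) j)) (NConst 2))))) k"
definition weight_exp :: "nat \<Rightarrow> iexp" where "weight_exp k = isum 0 (2 ^ k) k (chi_exp 0)"
definition eq_exp :: "nexp \<Rightarrow> nexp \<Rightarrow> nexp \<Rightarrow> nexp \<Rightarrow> iexp" where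
  "eq_exp a b c d = iof (nmul (neq a b) (neq c d))"
definition matG_exp :: "nat \<Rightarrow> nat \<Rightarrow> nat \<Rightarrow> iexp" where
  "matG_exp k x y = (let z = Suc (x + y); a = blk_exp 0 1 z; b = blk_exp 1 1 z in
     isum z (2 ^ k) k (imul (isub (imul (iof (npow n_exp 2))
       (iadd (eq_exp a (NVar x) b (NVar y)) (eq_exp a (NVar y) b (NVar x)))) (iof (NConst 2))) (chi_exp z)))"
definition src_exp :: "nat \<Rightarrow> nat \<Rightarrow> nat \<Rightarrow> nexp" where
  "src_exp k z w = nadd (blk_exp 2 (half k) z) (nmul (npow n_exp (half k)) (blk_exp 2 (half k) w))"
definition dst_exp :: "nat \<Rightarrow> nat \<Rightarrow> nat \<Rightarrow> nexp" where
  "dst_exp k z w = nadd (blk_exp (2 + half k) (half k) z)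
     (nmul (npow n_exp (half k)) (blk_exp (2 + half k) (half k) w))"
definition lab_exp :: "nat \<Rightarrow> nat \<Rightarrow> nexp" where
  "lab_exp k z = blk_exp (2 + 2 * half k) (par k) z"
definition matP_exp :: "nat \<Rightarrow> nat \<Rightarrow> nat \<Rightarrow> iexp" where
  "matP_exp k x y = (let z = Suc (x + y); w = Suc z in
     isum z (2 ^ k) k (isum w (2 ^ k) k (imul
       (imul (imul (imul (imul (sg_exp k z) (sg_exp k w))
         (isub (iof (NConst 1)) (iof (neq (nmod (NVar z) (npow n_exp k)) (nmod (NVar w) (npow n_exp k))))))
         (iof (neq (lab_exp k z) (lab_exp k w))))
         (iadd (eq_exp (src_exp k z w) (NVar x) (dst_exp k z w) (NVar y))
           (eq_exp (src_exp k z w) (NVar y) (dst_exp k z w) (NVar x))))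
       (imul (chi_exp z) (chi_exp w)))))"

definition ipow :: "iexp \<Rightarrow> nat \<Rightarrow> iexp" where "ipow e j = iprod (\<lambda>_. e) j"

definition accept_exp :: "nat \<Rightarrow> nat \<Rightarrow> nexp" where
  "accept_exp k t = (let w = weight_exp k; n = iof n_exp; R = iof R_exp; p = iof two_n_exp in
     nor (nnot (nle R_exp two_n_exp))
       (nmul (ile (iof (NConst 1)) w) (nor (nnot (nle T_exp two_n_exp))
         (nmul (ile (imul (trace_exp (matG_exp k) 1 (2 * t)) (ipow p (4 * t)))
                    (ipow (imul (imul (imul (iof (NConst 4)) n) w) (ipow R 2)) (2 * t)))
         (nmul (ile (imul (imul (ipow n (par k)) (iof (npow (NConst 2) (k + 1)))) (ipow p 4))
                    (imul (ipow R 4) w))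
               (ile (imul (imul (trace_exp (matP_exp k) (2 * half k) (2 * t)) (ipow n (2 * t * (k - 2))))
                      (ipow p (8 * t)))
                    (ipow (imul (ipow R 4) (ipow w 2)) (2 * t))))))))"

lemma rval_ipow [simp]: "rval M \<sigma> (ipow e j) = rval M \<sigma> e ^ j"
  by (simp add: ipow_def)

lemma rval_chi_exp [simp]: "rval M \<sigma> (chi_exp x) = real (M (3 + \<sigma> x))"
  by (simp add: chi_exp_def)

lemma neval_blk_exp [simp]: "neval M \<sigma> (blk_exp i l x) = blk (M 0) i l (\<sigma> x)"
  by (simp add: blk_exp_def blk_def n_exp_def)

lemma rval_sg_exp [simp]: "rval M \<sigma> (sg_exp k x) = sg k (M 0) (\<sigma> x)"
  by (simp add: sg_exp_def sg_def n_exp_def)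

lemma rval_weight_exp [simp]: "rval M \<sigma> (weight_exp k) = weight k (M 0) (\<lambda>C. real (M (3 + C)))"
  by (simp add: weight_exp_def weight_def)

lemma rval_eq_exp [simp]: "rval M \<sigma> (eq_exp a b c d) =
    of_bool (neval M \<sigma> a = neval M \<sigma> b \<and> neval M \<sigma> c = neval M \<sigma> d)"
  by (simp add: eq_exp_def)

lemma rval_matG_exp: "rval M \<sigma> (matG_exp k x y) = matG k (M 0) (\<lambda>C. real (M (3 + C))) (\<sigma> x) (\<sigma> y)"
  by (simp add: matG_exp_def matG_def coefG_def Let_def n_exp_def)

lemma neval_src_exp [simp]: "neval M \<sigma> (src_exp k x y) = src k (M 0) (\<sigma> x) (\<sigma> y)"
  by (simp add: src_exp_def src_def n_exp_def)

lemma neval_dst_exp [simp]: "neval M \<sigma> (dst_exp k x y) = dst k (M 0) (\<sigma> x) (\<sigma> y)"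
  by (simp add: dst_exp_def dst_def n_exp_def)

lemma neval_lab_exp [simp]: "neval M \<sigma> (lab_exp k x) = lab k (M 0) (\<sigma> x)"
  by (simp add: lab_exp_def lab_def)

lemma rval_matP_exp: "rval M \<sigma> (matP_exp k x y) = matP k (M 0) (\<lambda>C. real (M (3 + C))) (\<sigma> x) (\<sigma> y)"
proof -
  have of: "1 - of_bool P = (of_bool (\<not> P) :: real)" for P by simp
  show ?thesis
    unfolding matP_exp_def Let_def rval_isum rval_imul rval_isub rval_iadd rval_iof rval_eq_exp
      neval_neq neval_src_exp neval_dst_exp neval_lab_exp rval_sg_exp rval_chi_exp neval_nmod
      neval_npow n_exp_def neval.simps of_nat_of_bool of_nat_1 of matP_def coefP_def
    by simp
qed

lemma neval_accept_exp:
  "neval M \<sigma> (accept_exp k t) = of_bool (accept k t (M 0) (M 1) (M 2) (\<lambda>C. real (M (3 + C))))"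
proof -
  have p: "neval M \<sigma> two_n_exp = 2 ^ M 0" by (simp add: two_n_exp_def)
  note tr = rval_trace_exp[of M "matG_exp k", OF rval_matG_exp]
    rval_trace_exp[of M "matP_exp k", OF rval_matP_exp]
  have m: "of_bool P * of_bool Q = (of_bool (P \<and> Q) :: nat)" for P Q by simp
  have z: "(of_bool P \<noteq> (0::nat)) = P" "(of_bool P = (0::nat)) = (\<not> P)" for P by simp_all
  show ?thesis
    unfolding accept_exp_def Let_def neval_nor neval_nnot neval_nle neval_ile neval.simps apply_op.simps m z
      rval_imul rval_ipow rval_iof tr rval_weight_exp p accept_def certificate_def n_exp_def R_exp_def
      T_exp_def neval_npow of_nat_numeral of_nat_1 of_nat_power not_le power_one_right by simp
qed

section \<open>Trace bounds for quadratic forms\<close>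

lemma mpow_add:
  assumes "s < N" "r < N"
  shows "mpow A N (a + b) r s = (\<Sum>q<N. mpow A N a r q * mpow A N b q s)"
  using assms(2)
proof (induction a arbitrary: r)
  case 0
  have "(\<Sum>q<N. of_bool (r = q) * mpow A N b q s) = mpow A N b r s"
    using 0 by (simp add: of_bool_def if_distrib if_distribR sum.delta cong: if_cong)
  then show ?case by simp
next
  case (Suc a)
  have "mpow A N (Suc a + b) r s = (\<Sum>q<N. A r q * (\<Sum>u<N. mpow A N a q u * mpow A N b u s))"
    using Suc by simp
  also have "\<dots> = (\<Sum>q<N. \<Sum>u<N. A r q * mpow A N a q u * mpow A N b u s)"
    by (simp add: sum_distrib_left mult.assoc)
  also have "\<dots> = (\<Sum>u<N. \<Sum>q<N. A r q * mpow A N a q u * mpow A N b u s)"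
    by (rule sum.swap)
  also have "\<dots> = (\<Sum>u<N. mpow A N (Suc a) r u * mpow A N b u s)"
    by (simp add: sum_distrib_right)
  finally show ?case .
qed

lemma mpow_1: "r < N \<Longrightarrow> s < N \<Longrightarrow> mpow A N 1 r s = A r s"
  by (simp add: of_bool_def if_distrib sum.delta' cong: if_cong)

lemma mpow_sym:
  assumes "\<And>r s. r < N \<Longrightarrow> s < N \<Longrightarrow> A r s = A s r"
  shows "r < N \<Longrightarrow> s < N \<Longrightarrow> mpow A N L r s = mpow A N L s r"
proof (induction L arbitrary: r s)
  case (Suc L)
  have "mpow A N (Suc L) r s = (\<Sum>q<N. mpow A N L s q * mpow A N 1 q r)"
    using Suc assms by (simp add: mpow_1 mult.commute del: mpow.simps One_nat_def)
      (simp add: mult.commute)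
  also have "\<dots> = mpow A N (L + 1) s r" using Suc by (simp only: mpow_add)
  finally show ?case by simp
qed auto

lemma mtrace_double:
  assumes "\<And>r s. r < N \<Longrightarrow> s < N \<Longrightarrow> A r s = A s r"
  shows "mtrace A N (2 * t) = (\<Sum>r<N. \<Sum>s<N. (mpow A N t r s)\<^sup>2)"
proof -
  have "mpow A N (2 * t) r r = (\<Sum>s<N. (mpow A N t r s)\<^sup>2)" if "r < N" for r
    using mpow_add[of r N r A t t] that mpow_sym[of N A, OF assms, of _ r t]
    by (simp add: mult_2[symmetric] power2_eq_square)
  then show ?thesis by (simp add: mtrace_def)
qed

lemma mtrace_nonneg:
  assumes "\<And>r s. r < N \<Longrightarrow> s < N \<Longrightarrow> A r s = A s r"
  shows "mtrace A N (2 * t) \<ge> 0"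
  by (simp add: mtrace_double[of N A, OF assms] sum_nonneg)

definition quad :: "(nat \<Rightarrow> nat \<Rightarrow> real) \<Rightarrow> nat \<Rightarrow> (nat \<Rightarrow> real) \<Rightarrow> real" where
  "quad A N z = (\<Sum>r<N. \<Sum>s<N. z r * A r s * z s)"

text \<open>By symmetry, z^T A^(2L) z is the squared length of A^L z. The first bound is
  Cauchy-Schwarz between z, of squared length N, and A^L z. The second applies Cauchy-Schwarz in
  each row; the squared Frobenius norm of A^L is the trace of A^(2L).\<close>

lemma quad_square_le:
  assumes sym: "\<And>r s. r < N \<Longrightarrow> s < N \<Longrightarrow> A r s = A s r" and z: "\<And>r. r < N \<Longrightarrow> (z r)\<^sup>2 = 1"
  shows "(quad (mpow A N L) N z)\<^sup>2 \<le> real N * quad (mpow A N (2 * L)) N z"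
    and "quad (mpow A N (2 * L)) N z \<le> real N * mtrace A N (2 * L)"
proof -
  let ?v = "\<lambda>r. \<Sum>s<N. mpow A N L r s * z s"
  have zz: "(\<Sum>r<N. (z r)\<^sup>2) = real N" using z by simp
  have v2: "(\<Sum>r<N. (?v r)\<^sup>2) = quad (mpow A N (2 * L)) N z"
  proof -
    have "(\<Sum>q<N. (?v q)\<^sup>2) = (\<Sum>q<N. \<Sum>r<N. \<Sum>s<N. mpow A N L q r * z r * (mpow A N L q s * z s))"
      by (simp add: power2_eq_square sum_product)
    also have "\<dots> = (\<Sum>r<N. \<Sum>q<N. \<Sum>s<N. mpow A N L q r * z r * (mpow A N L q s * z s))"
      by (rule sum.swap)
    also have "\<dots> = (\<Sum>r<N. \<Sum>s<N. \<Sum>q<N. mpow A N L q r * z r * (mpow A N L q s * z s))"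
      by (rule sum.cong[OF refl]) (rule sum.swap)
    also have "\<dots> = (\<Sum>r<N. \<Sum>s<N. z r * mpow A N (2 * L) r s * z s)"
    proof (intro sum.cong refl)
      fix r s assume rs: "r \<in> {..<N}" "s \<in> {..<N}"
      have "(\<Sum>q<N. mpow A N L q r * z r * (mpow A N L q s * z s)) =
          (\<Sum>q<N. z r * (mpow A N L r q * mpow A N L q s) * z s)"
        using mpow_sym[of N A, OF sym, of _ r L] rs by (intro sum.cong) auto
      also have "\<dots> = z r * mpow A N (L + L) r s * z s"
        using rs by (subst mpow_add) (auto simp: sum_distrib_left sum_distrib_right)
      finally show "(\<Sum>q<N. mpow A N L q r * z r * (mpow A N L q s * z s)) = z r * mpow A N (2 * L) r s * z s"
        by (simp add: mult_2)
    qed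
    finally show ?thesis by (simp add: quad_def)
  qed
  have "quad (mpow A N L) N z = (\<Sum>r<N. z r * ?v r)"
    by (simp add: quad_def sum_distrib_left mult.assoc)
  then show "(quad (mpow A N L) N z)\<^sup>2 \<le> real N * quad (mpow A N (2 * L)) N z"
    using Cauchy_Schwarz_ineq_sum[of z ?v "{..<N}"] unfolding zz v2 by simp
  have "(?v r)\<^sup>2 \<le> (\<Sum>s<N. (mpow A N L r s)\<^sup>2) * real N" for r
    using Cauchy_Schwarz_ineq_sum[of "mpow A N L r" z "{..<N}"] zz by simp
  then have "(\<Sum>r<N. (?v r)\<^sup>2) \<le> (\<Sum>r<N. (\<Sum>s<N. (mpow A N L r s)\<^sup>2) * real N)"
    by (intro sum_mono)
  then show "quad (mpow A N (2 * L)) N z \<le> real N * mtrace A N (2 * L)"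
  proof -
    have "mtrace A N (2 * L) = (\<Sum>r<N. \<Sum>s<N. (mpow A N L r s)\<^sup>2)"
      by (rule mtrace_double) (rule sym)
    then show ?thesis
      using \<open>(\<Sum>r<N. (?v r)\<^sup>2) \<le> _\<close> unfolding v2 by (simp add: sum_distrib_left mult.commute)
  qed
qed

text \<open>Repeated squaring replaces the spectral theorem, which is why the exponent is a power of
  two. In normalised form, \<open>key\<close> says that the (2^j)-th power of |z^T A z| / N is at
  most |z^T A^(2^j) z| / N.\<close>

lemma quad_power_le_trace:
  assumes sym: "\<And>r s. r < N \<Longrightarrow> s < N \<Longrightarrow> A r s = A s r" and z: "\<And>r. r < N \<Longrightarrow> (z r)\<^sup>2 = 1"
  shows "quad A N z ^ (2 * 2 ^ i) \<le> real N ^ (2 * 2 ^ i) * mtrace A N (2 * 2 ^ i)"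
proof (cases "N = 0")
  case True
  then show ?thesis by (simp add: quad_def mtrace_def zero_power)
next
  case False
  have key: "\<bar>quad A N z\<bar> ^ (2 ^ j) * real N \<le> real N ^ (2 ^ j) * \<bar>quad (mpow A N (2 ^ j)) N z\<bar>" for j
  proof (induction j)
    case 0
    have "quad (mpow A N 1) N z = quad A N z"
      unfolding quad_def by (intro sum.cong refl) (simp only: mpow_1 lessThan_iff)
    then show ?case by (simp del: mpow.simps)
  next
    case (Suc j)
    let ?q = "quad (mpow A N (2 ^ j)) N z" and ?q2 = "quad (mpow A N (2 ^ Suc j)) N z"
    have "(\<bar>quad A N z\<bar> ^ (2 ^ Suc j) * real N) * real N = (\<bar>quad A N z\<bar> ^ (2 ^ j) * real N)\<^sup>2"
      by (simp add: power_mult_distrib power_mult[symmetric] power2_eq_square mult.commute power_add[symmetric] mult_2)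
    also have "\<dots> \<le> (real N ^ (2 ^ j) * \<bar>?q\<bar>)\<^sup>2"
      using Suc.IH by (intro power_mono) auto
    also have "\<dots> = real N ^ (2 ^ Suc j) * ?q\<^sup>2"
      by (simp add: power_mult_distrib power_mult[symmetric] mult.commute)
    also have "\<dots> \<le> real N ^ (2 ^ Suc j) * (real N * ?q2)"
      using quad_square_le(1)[of N A z "2 ^ j", OF sym z] by (intro mult_left_mono) auto
    also have "\<dots> \<le> (real N ^ (2 ^ Suc j) * \<bar>?q2\<bar>) * real N"
    proof -
      have "real N * ?q2 \<le> real N * \<bar>?q2\<bar>" by (intro mult_left_mono) auto
      then have "real N ^ (2 ^ Suc j) * (real N * ?q2) \<le> real N ^ (2 ^ Suc j) * (real N * \<bar>?q2\<bar>)"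
        by (intro mult_left_mono) auto
      then show ?thesis by (simp only: mult_ac)
    qed
    finally show ?case using False by simp
  qed
  let ?q = "quad (mpow A N (2 ^ i)) N z"
  have "quad A N z ^ (2 * 2 ^ i) * (real N)\<^sup>2 = (\<bar>quad A N z\<bar> ^ (2 ^ i) * real N)\<^sup>2"
    by (simp add: power_mult_distrib power_mult[symmetric] mult.commute power_even_abs)
  also have "\<dots> \<le> (real N ^ (2 ^ i) * \<bar>?q\<bar>)\<^sup>2"
    using key[of i] by (intro power_mono) auto
  also have "\<dots> = real N ^ (2 * 2 ^ i) * ?q\<^sup>2"
    by (simp add: power_mult_distrib power_mult[symmetric] mult.commute)
  also have "\<dots> \<le> real N ^ (2 * 2 ^ i) * (real N * (real N * mtrace A N (2 * 2 ^ i)))"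
    using quad_square_le[of N A z "2 ^ i", OF sym z]
    by (intro mult_left_mono order_trans[OF quad_square_le(1)[of N A z "2 ^ i", OF sym z]]) auto
  also have "\<dots> = (real N ^ (2 * 2 ^ i) * mtrace A N (2 * 2 ^ i)) * (real N)\<^sup>2"
    by (simp add: power2_eq_square)
  finally show ?thesis using False by simp
qed

section \<open>Reading a clause off its position in the clause list\<close>

lemma concat_nth_uniform:
  assumes "\<And>l. l \<in> set ls \<Longrightarrow> length l = m" "i < length ls * m"
  shows "concat ls ! i = ls ! (i div m) ! (i mod m)"
  using assms
proof (induction ls arbitrary: i)
  case (Cons l ls)
  have l: "length l = m" using Cons.prems by simp
  show ?case
  proof (cases "i < m")
    case True
    then show ?thesis using l by (simp add: nth_append)
  next
    case False
    then have "m > 0" "(i - m) div m = i div m - 1" "i div m > 0" "(i - m) mod m = i mod m"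
    proof -
      show m: "m > 0" using Cons.prems(2) by (intro gr0I) simp
      obtain q where "i = m + q" using False by (metis le_add_diff_inverse not_less)
      then show "(i - m) div m = i div m - 1" "i div m > 0" "(i - m) mod m = i mod m"
        using m by simp_all
    qed
    moreover have "concat ls ! (i - m) = ls ! ((i - m) div m) ! ((i - m) mod m)"
      using Cons.prems False by (intro Cons.IH) auto
    ultimately show ?thesis using False l by (simp add: nth_append nth_Cons')
  qed
qed auto

text \<open>\<open>List.n_lists\<close> varies the head of the list fastest, so entry j is the digit
  of weight \<open>length xs ^ j\<close>.\<close>

lemma n_lists_nth:
  "i < length xs ^ k \<Longrightarrow> List.n_lists k xs ! i = map (\<lambda>j. xs ! (i div length xs ^ j mod length xs)) [0..<k]"
proof (induction k arbitrary: i)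
  case 0
  then show ?case by simp
next
  case (Suc k)
  let ?m = "length xs"
  have m: "?m > 0" using Suc.prems by (cases ?m) auto
  have lt: "i div ?m < ?m ^ k" using Suc.prems by (simp add: less_mult_imp_div_less mult.commute)
  have "List.n_lists (Suc k) xs ! i =
      map (\<lambda>ys. map (\<lambda>y. y # ys) xs) (List.n_lists k xs) ! (i div ?m) ! (i mod ?m)"
    unfolding List.n_lists.simps
    by (rule concat_nth_uniform) (use Suc.prems in \<open>auto simp: length_n_lists mult.commute\<close>)
  also have "\<dots> = xs ! (i mod ?m) # List.n_lists k xs ! (i div ?m)"
    using lt m by (simp add: length_n_lists)
  also have "\<dots> = map (\<lambda>j. xs ! (i div ?m ^ j mod ?m)) [0..<Suc k]"
    unfolding Suc.IH[OF lt] map_upt_Suc by (simp add: div_mult2_eq)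
  finally show ?case .
qed

lemma length_clause_list: "length (clause_list k n) = 2 ^ k * n ^ k"
  by (simp add: clause_list_def length_n_lists numeral_2_eq_2 del: upt_Suc)

lemma distinct_clause_list: "distinct (clause_list k n)"
  by (simp add: clause_list_def distinct_product distinct_n_lists)

lemma div_mod_digit: "j < l \<Longrightarrow> (a mod n ^ l) div n ^ j mod n = a div n ^ j mod (n::nat)"
proof -
  assume "j < l"
  then have l: "n ^ l = n ^ j * (n * n ^ (l - Suc j))"
    by (metis Suc_leI le_add_diff_inverse power_Suc power_add power_Suc2 mult.assoc)
  show ?thesis
  proof (cases "n = 0")
    case False
    have "a mod n ^ l div n ^ j = a div n ^ j mod (n * n ^ (l - Suc j))"
      unfolding l mod_mult2_eq using False by simp
    then show ?thesis by (simp add: mod_mod_cancel)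
  next
    case True
    then show ?thesis using \<open>j < l\<close> by (cases l) auto
  qed
qed

lemma clause_list_nth:
  assumes "C < 2 ^ k * n ^ k"
  shows "clause_list k n ! C = (map (\<lambda>j. [1, -1] ! (C div n ^ k div 2 ^ j mod 2)) [0..<k],
    map (\<lambda>j. Suc (blk n j 1 C)) [0..<k])"
proof -
  have n: "n ^ k > 0" using assms by (cases "n ^ k") auto
  have c: "C div n ^ k < 2 ^ k" using assms by (simp add: less_mult_imp_div_less)
  have "clause_list k n ! C = (List.n_lists k [1, -1] ! (C div n ^ k), List.n_lists k [1..<Suc n] ! (C mod n ^ k))"
    unfolding clause_list_def using assms by (subst product_nth) (simp_all add: length_n_lists numeral_2_eq_2 del: upt_Suc)
  moreover have "List.n_lists k [1, -1 :: int] ! (C div n ^ k) = map (\<lambda>j. [1, -1] ! (C div n ^ k div 2 ^ j mod 2)) [0..<k]"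
    using n_lists_nth[of "C div n ^ k" "[1, -1 :: int]" k] c by (simp add: numeral_2_eq_2)
  moreover have "List.n_lists k [1..<Suc n] ! (C mod n ^ k) = map (\<lambda>j. Suc (blk n j 1 C)) [0..<k]"
  proof -
    have "List.n_lists k [1..<Suc n] ! (C mod n ^ k) =
        map (\<lambda>j. [1..<Suc n] ! (C mod n ^ k div n ^ j mod n)) [0..<k]"
      using n_lists_nth[of "C mod n ^ k" "[1..<Suc n]" k] n by (simp del: upt_Suc)
    also have "\<dots> = map (\<lambda>j. Suc (blk n j 1 C)) [0..<k]"
    proof (rule map_cong[OF refl])
      fix j assume "j \<in> set [0..<k]"
      then have "j < k" by simp
      moreover have "n > 0" using n \<open>j < k\<close> by (cases n) auto
      then have "1 + C div n ^ j mod n < Suc n" by simp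
      ultimately show "[1..<Suc n] ! (C mod n ^ k div n ^ j mod n) = Suc (blk n j 1 C)"
        by (simp add: div_mod_digit blk_def nth_upt del: upt_Suc)
    qed
    finally show ?thesis .
  qed
  ultimately show ?thesis by simp
qed

section \<open>Soundness of the certificate\<close>

lemma sum_of_bool_eq:
  fixes f :: "'a \<Rightarrow> real"
  shows "finite A \<Longrightarrow> a \<in> A \<Longrightarrow> (\<Sum>r\<in>A. of_bool (a = r) * f r) = f a"
  by (simp add: of_bool_def if_distrib if_distribR sum.delta cong: if_cong)

lemma sum_of_bool_eq2:
  fixes g :: "'a \<Rightarrow> 'b \<Rightarrow> real"
  assumes "finite A" "a \<in> A" "finite B" "b \<in> B"
  shows "(\<Sum>r\<in>A. \<Sum>r'\<in>B. of_bool (a = r) * (of_bool (b = r') * g r r')) = g a b"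
  unfolding sum_distrib_left[symmetric] sum_of_bool_eq[OF assms(1,2)] sum_of_bool_eq[OF assms(3,4)] ..

lemma half_par: "k \<ge> 2 \<Longrightarrow> k = 2 + 2 * half k + par k"
  by (simp add: half_def par_def) presburger

lemma blk_less: "n > 0 \<Longrightarrow> blk n i l C < n ^ l"
  by (simp add: blk_def)

lemma src_less: "n > 0 \<Longrightarrow> src k n C C' < n ^ (2 * half k)"
proof -
  assume n: "n > 0"
  let ?m = "n ^ half k" let ?a = "blk n 2 (half k) C" let ?b = "blk n 2 (half k) C'"
  have "?a + ?m * ?b < ?m + ?m * ?b" using blk_less[OF n, of 2 "half k" C] by simp
  also have "\<dots> = ?m * Suc ?b" by simp
  also have "\<dots> \<le> ?m * ?m" using blk_less[OF n, of 2 "half k" C'] by (intro mult_le_mono) auto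
  finally show ?thesis by (simp add: src_def mult_2 power_add)
qed

lemma dst_less: "n > 0 \<Longrightarrow> dst k n C C' < n ^ (2 * half k)"
proof -
  assume n: "n > 0"
  let ?m = "n ^ half k" let ?a = "blk n (2 + half k) (half k) C" let ?b = "blk n (2 + half k) (half k) C'"
  have "?a + ?m * ?b < ?m + ?m * ?b" using blk_less[OF n, of "2 + half k" "half k" C] by simp
  also have "\<dots> = ?m * Suc ?b" by simp
  also have "\<dots> \<le> ?m * ?m" using blk_less[OF n, of "2 + half k" "half k" C'] by (intro mult_le_mono) auto
  finally show ?thesis by (simp add: dst_def mult_2 power_add)
qed

lemma matG_sym: "matG k n \<xi> r s = matG k n \<xi> s r"
  by (simp add: matG_def coefG_def add.commute)

lemma matP_sym: "matP k n \<xi> r s = matP k n \<xi> s r"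
  by (simp add: matP_def coefP_def add.commute)

lemma sg_cases: "sg k n C = 1 \<or> sg k n C = -1"
proof -
  have "(\<Prod>j<m. 1 - 2 * real (f j mod 2)) = 1 \<or> (\<Prod>j<m. 1 - 2 * real (f j mod 2)) = -1"
    for m and f :: "nat \<Rightarrow> nat"
  proof (induction m)
    case (Suc m)
    have "f m mod 2 = 0 \<or> f m mod 2 = 1" by auto
    then show ?case using Suc by auto
  qed simp
  then show ?thesis by (simp add: sg_def)
qed

text \<open>A position is determined by its tuple of variables and its sign pattern, and there are
  2^k sign patterns.\<close>

lemma card_same_tuple_le: "card {C'. C' < 2 ^ k * n ^ k \<and> C' mod n ^ k = v} \<le> 2 ^ k" for n :: nat
proof -
  have "card {C'. C' < 2 ^ k * n ^ k \<and> C' mod n ^ k = v} \<le> card {..<2 ^ k :: nat}"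
  proof (rule card_inj_on_le[where f = "\<lambda>C. C div n ^ k"])
    show "inj_on (\<lambda>C. C div n ^ k) {C'. C' < 2 ^ k * n ^ k \<and> C' mod n ^ k = v}"
      by (rule inj_onI) (metis (mono_tags, lifting) div_mult_mod_eq mem_Collect_eq)
  qed (auto simp: less_mult_imp_div_less)
  then show ?thesis by simp
qed

text \<open>An assignment and an instance in the coordinates of the program: variables are numbered
  from 0, clauses by position. X is a sign at every index, also past n, so that products need no
  side conditions.\<close>

locale signed_instance =
  fixes k n :: nat and X :: "nat \<Rightarrow> real" and \<xi> :: "nat \<Rightarrow> real"
  assumes k: "k \<ge> 4" and n: "n \<ge> 1"
    and X: "X v = 1 \<or> X v = -1"
    and xi: "\<xi> C = 0 \<or> \<xi> C = 1"
begin

abbreviation D :: nat where "D \<equiv> 2 ^ k * n ^ k"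
abbreviation h :: nat where "h \<equiv> half k"
abbreviation s :: nat where "s \<equiv> par k"
abbreviation w :: real where "w \<equiv> weight k n \<xi>"

definition monom :: "nat \<Rightarrow> nat \<Rightarrow> real" where
  "monom l V = (\<Prod>j<l. X (V div n ^ j mod n))"

definition value_at :: "nat \<Rightarrow> real" where
  "value_at C = (\<Prod>j<k. X (blk n j 1 C))"

definition rest :: "nat \<Rightarrow> real" where
  "rest C = monom h (blk n 2 h C) * monom h (blk n (2 + h) h C)"

text \<open>The signed form of degree k - 2 from the overview. \<open>pair_sum\<close> is the sum
  over the products of the first two variables that it is compared with.\<close>

definition Phi :: real where
  "Phi = (\<Sum>C<D. \<xi> C * sg k n C * (rest C * monom s (lab k n C)))"

definition pair_sum :: real where
  "pair_sum = (\<Sum>C<D. \<xi> C * (X (blk n 0 1 C) * X (blk n 1 1 C)))"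

lemma n0: "n > 0" using n by simp

lemma prod_sign: "(\<Prod>j\<in>A. X (f j)) = 1 \<or> (\<Prod>j\<in>A. X (f j)) = -1"
proof (induction A rule: infinite_finite_induct)
  case (insert a A)
  then show ?case using X[of "f a"] by auto
qed auto

lemma monom_cases: "monom l V = 1 \<or> monom l V = -1"
  unfolding monom_def by (rule prod_sign)

lemma monom_sq: "monom l V * monom l V = 1"
  using monom_cases[of l V] by auto

lemma rest_cases: "rest C = 1 \<or> rest C = -1"
  using monom_cases[of h "blk n 2 h C"] monom_cases[of h "blk n (2 + h) h C"] by (auto simp: rest_def)

lemma monom_blk: "monom l (blk n i l C) = (\<Prod>j<l. X (blk n (i + j) 1 C))"
  unfolding monom_def
proof (rule prod.cong[OF refl])
  fix j assume "j \<in> {..<l}"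
  then have "blk n i l C div n ^ j mod n = C div n ^ i div n ^ j mod n"
    by (simp add: blk_def div_mod_digit)
  also have "\<dots> = blk n (i + j) 1 C" by (simp add: blk_def power_add div_mult2_eq)
  finally show "X (blk n i l C div n ^ j mod n) = X (blk n (i + j) 1 C)" by simp
qed

lemma prod_split: "(\<Prod>j<a + b. f j) = (\<Prod>j<a. f j) * (\<Prod>j<b. f (a + j))" for f :: "nat \<Rightarrow> real"
  by (induction b) (auto simp: mult.assoc)

lemma value_at_split:
  "value_at C = X (blk n 0 1 C) * X (blk n 1 1 C) * (rest C * monom s (lab k n C))"
proof -
  have "value_at C = (\<Prod>j<2 + h + h + s. X (blk n j 1 C))"
    unfolding value_at_def using half_par[of k] k by (simp add: mult_2 add.assoc)
  also have "\<dots> = (\<Prod>j<2. X (blk n j 1 C)) * (\<Prod>j<h. X (blk n (2 + j) 1 C)) *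
      (\<Prod>j<h. X (blk n (2 + h + j) 1 C)) * (\<Prod>j<s. X (blk n (2 + h + h + j) 1 C))"
    by (simp only: prod_split)
  also have "(\<Prod>j<2. X (blk n j 1 C)) = X (blk n 0 1 C) * X (blk n 1 1 C)"
    by (simp add: numeral_2_eq_2)
  finally show ?thesis
    unfolding rest_def lab_def monom_blk mult_2 by (simp add: mult.assoc add.assoc)
qed

text \<open>If the left side is small, \<open>pair_sum\<close> is close to w times the squared mean
  of X, which is large for a biased assignment.\<close>

lemma quad_matG:
  "quad (matG k n \<xi>) n X = 2 * (real n)\<^sup>2 * pair_sum - 2 * w * (\<Sum>v<n. X v)\<^sup>2"
proof -
  let ?g = "\<lambda>r r' C. \<xi> C * (X r * coefG n r C r' * X r')"
  let ?a = "\<lambda>C. blk n 0 1 C" and ?b = "\<lambda>C. blk n 1 1 C"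
  have ab: "?a C < n" "?b C < n" for C using blk_less[OF n0, of _ 1] by auto
  have one: "(\<Sum>r<n. \<Sum>r'<n. X r * coefG n r C r' * X r') =
      2 * (real n)\<^sup>2 * (X (?a C) * X (?b C)) - 2 * (\<Sum>v<n. X v)\<^sup>2" for C
  proof -
    have e1: "(\<Sum>r<n. \<Sum>r'<n. of_bool (?a C = r) * (of_bool (?b C = r') * ((real n)\<^sup>2 * (X r * X r')))) = (real n)\<^sup>2 * (X (?a C) * X (?b C))"
      by (rule sum_of_bool_eq2) (use ab in auto)
    have e2: "(\<Sum>r<n. \<Sum>r'<n. of_bool (?b C = r) * (of_bool (?a C = r') * ((real n)\<^sup>2 * (X r * X r')))) = (real n)\<^sup>2 * (X (?a C) * X (?b C))"
      by (subst sum_of_bool_eq2) (use ab in auto)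
    have e3: "2 * (\<Sum>v<n. X v)\<^sup>2 = (\<Sum>r<n. \<Sum>r'<n. 2 * (X r * X r'))"
    proof -
      have "(\<Sum>v<n. X v)\<^sup>2 = (\<Sum>r<n. \<Sum>r'<n. X r * X r')" by (simp add: power2_eq_square sum_product)
      then show ?thesis by (simp only: sum_distrib_left)
    qed
    have "(\<Sum>r<n. \<Sum>r'<n. X r * coefG n r C r' * X r') = (\<Sum>r<n. \<Sum>r'<n.
        of_bool (?a C = r) * (of_bool (?b C = r') * ((real n)\<^sup>2 * (X r * X r'))) +
        of_bool (?b C = r) * (of_bool (?a C = r') * ((real n)\<^sup>2 * (X r * X r'))) - 2 * (X r * X r'))"
      by (intro sum.cong refl) (simp add: coefG_def of_bool_conj algebra_simps)
    also have "\<dots> = (real n)\<^sup>2 * (X (?a C) * X (?b C)) + (real n)\<^sup>2 * (X (?a C) * X (?b C)) - 2 * (\<Sum>v<n. X v)\<^sup>2"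
      unfolding sum.distrib sum_subtractf e1 e2 e3 ..
    finally show ?thesis by simp
  qed
  have "quad (matG k n \<xi>) n X = (\<Sum>r<n. \<Sum>r'<n. \<Sum>C<D. ?g r r' C)"
    unfolding quad_def matG_def
    by (intro sum.cong refl) (simp add: sum_distrib_left sum_distrib_right mult_ac)
  also have "\<dots> = (\<Sum>r<n. \<Sum>C<D. \<Sum>r'<n. ?g r r' C)"
    by (rule sum.cong[OF refl]) (rule sum.swap)
  also have "\<dots> = (\<Sum>C<D. \<Sum>r<n. \<Sum>r'<n. ?g r r' C)"
    by (rule sum.swap)
  also have "\<dots> = (\<Sum>C<D. \<xi> C * (2 * (real n)\<^sup>2 * (X (?a C) * X (?b C)) - 2 * (\<Sum>v<n. X v)\<^sup>2))"
    unfolding sum_distrib_left[symmetric] one ..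
  also have "\<dots> = 2 * (real n)\<^sup>2 * pair_sum - 2 * w * (\<Sum>v<n. X v)\<^sup>2"
    by (simp add: pair_sum_def weight_def right_diff_distrib sum_subtractf sum_distrib_left
        sum_distrib_right mult_ac)
  finally show ?thesis .
qed

text \<open>The Kronecker square of the vector of all monomials of degree h, in the indexing of
  \<open>src\<close> and \<open>dst\<close>.\<close>

definition zvec :: "nat \<Rightarrow> real" where
  "zvec r = monom h (r mod n ^ h) * monom h (r div n ^ h)"

definition pairs_sum :: real where
  "pairs_sum = (\<Sum>C<D. \<Sum>C'<D. of_bool (C mod n ^ k \<noteq> C' mod n ^ k) * of_bool (lab k n C = lab k n C') *
     ((\<xi> C * sg k n C * rest C) * (\<xi> C' * sg k n C' * rest C')))"

lemma zvec_src_dst: "zvec (src k n C C') * zvec (dst k n C C') = rest C * rest C'"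
proof -
  have z: "zvec (a + n ^ h * b) = monom h a * monom h b" if "a < n ^ h" for a b
    using that n0 by (simp add: zvec_def)
  show ?thesis
    unfolding src_def dst_def z[OF blk_less[OF n0]] rest_def by (simp add: mult_ac)
qed

lemma quad_matP: "quad (matP k n \<xi>) (n ^ (2 * h)) zvec = 2 * pairs_sum"
proof -
  let ?N = "n ^ (2 * h)"
  let ?g = "\<lambda>r r' C C'. (\<xi> C * \<xi> C') * (zvec r * coefP k n r C C' r' * zvec r')"
  let ?p = "\<lambda>C C'. sg k n C * sg k n C' * of_bool (C mod n ^ k \<noteq> C' mod n ^ k) * of_bool (lab k n C = lab k n C')"
  have one: "(\<Sum>r<?N. \<Sum>r'<?N. zvec r * coefP k n r C C' r' * zvec r') = 2 * (?p C C' * (rest C * rest C'))" for C C'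
  proof -
    let ?a = "src k n C C'" and ?b = "dst k n C C'"
    have e1: "(\<Sum>r<?N. \<Sum>r'<?N. of_bool (?a = r) * (of_bool (?b = r') * (?p C C' * (zvec r * zvec r')))) = ?p C C' * (zvec ?a * zvec ?b)"
      by (rule sum_of_bool_eq2) (auto simp: src_less dst_less n0)
    have e2: "(\<Sum>r<?N. \<Sum>r'<?N. of_bool (?b = r) * (of_bool (?a = r') * (?p C C' * (zvec r * zvec r')))) = ?p C C' * (zvec ?a * zvec ?b)"
      by (subst sum_of_bool_eq2) (auto simp: src_less dst_less n0)
    have "(\<Sum>r<?N. \<Sum>r'<?N. zvec r * coefP k n r C C' r' * zvec r') = (\<Sum>r<?N. \<Sum>r'<?N.
        of_bool (?a = r) * (of_bool (?b = r') * (?p C C' * (zvec r * zvec r'))) +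
        of_bool (?b = r) * (of_bool (?a = r') * (?p C C' * (zvec r * zvec r'))))"
      by (intro sum.cong refl) (simp only: coefP_def of_bool_conj algebra_simps)
    also have "\<dots> = ?p C C' * (zvec ?a * zvec ?b) + ?p C C' * (zvec ?a * zvec ?b)"
      unfolding sum.distrib e1 e2 ..
    finally show ?thesis by (simp add: zvec_src_dst)
  qed
  have "quad (matP k n \<xi>) ?N zvec = (\<Sum>r<?N. \<Sum>r'<?N. \<Sum>C<D. \<Sum>C'<D. ?g r r' C C')"
    unfolding quad_def matP_def
    by (intro sum.cong refl) (simp add: sum_distrib_left sum_distrib_right mult_ac)
  also have "\<dots> = (\<Sum>r<?N. \<Sum>C<D. \<Sum>r'<?N. \<Sum>C'<D. ?g r r' C C')"
    by (rule sum.cong[OF refl]) (rule sum.swap)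
  also have "\<dots> = (\<Sum>r<?N. \<Sum>C<D. \<Sum>C'<D. \<Sum>r'<?N. ?g r r' C C')"
    by (rule sum.cong[OF refl], rule sum.cong[OF refl], rule sum.swap)
  also have "\<dots> = (\<Sum>C<D. \<Sum>r<?N. \<Sum>C'<D. \<Sum>r'<?N. ?g r r' C C')"
    by (rule sum.swap)
  also have "\<dots> = (\<Sum>C<D. \<Sum>C'<D. \<Sum>r<?N. \<Sum>r'<?N. ?g r r' C C')"
    by (rule sum.cong[OF refl], rule sum.swap)
  also have "\<dots> = (\<Sum>C<D. \<Sum>C'<D. (\<xi> C * \<xi> C') * (2 * (?p C C' * (rest C * rest C'))))"
    unfolding sum_distrib_left[symmetric] one ..
  also have "\<dots> = 2 * pairs_sum"
    by (simp add: pairs_sum_def sum_distrib_left mult_ac)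
  finally show ?thesis .
qed

lemma weight_nonneg: "w \<ge> 0"
  unfolding weight_def using xi by (intro sum_nonneg) (metis order_refl zero_le_one)

text \<open>Group the clauses by label and apply Cauchy-Schwarz over the n^s labels: the squares
  expand into pairs of clauses with a common label. Pairs on the same tuple, including C = C', are
  bounded by their number; the others form \<open>pairs_sum\<close>.\<close>

lemma Phi_square_le: "Phi\<^sup>2 \<le> real n ^ s * (2 ^ k * w + pairs_sum)"
proof -
  let ?a = "\<lambda>C. \<xi> C * sg k n C * rest C"
  let ?Q = "\<lambda>g. \<Sum>C<D. of_bool (lab k n C = g) * ?a C"
  let ?f = "\<lambda>g C C'. of_bool (lab k n C' = g) * (of_bool (lab k n C = g) * (?a C * ?a C'))"
  let ?e = "\<lambda>C C'. of_bool (C mod n ^ k = C' mod n ^ k) * of_bool (lab k n C = lab k n C') * (?a C * ?a C')"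
  have lab: "lab k n C < n ^ s" for C unfolding lab_def by (rule blk_less[OF n0])
  have "Phi = (\<Sum>C<D. \<Sum>g<n ^ s. of_bool (lab k n C = g) * (?a C * monom s g))"
  proof -
    have "(\<Sum>g<n ^ s. of_bool (lab k n C = g) * (?a C * monom s g)) = ?a C * monom s (lab k n C)" for C
      using lab by (intro sum_of_bool_eq) auto
    then show ?thesis by (simp add: Phi_def mult.assoc)
  qed
  also have "\<dots> = (\<Sum>g<n ^ s. \<Sum>C<D. of_bool (lab k n C = g) * (?a C * monom s g))" by (rule sum.swap)
  also have "\<dots> = (\<Sum>g<n ^ s. monom s g * ?Q g)" by (simp add: sum_distrib_left mult_ac)
  finally have "Phi\<^sup>2 \<le> (\<Sum>g<n ^ s. (monom s g)\<^sup>2) * (\<Sum>g<n ^ s. (?Q g)\<^sup>2)"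
    using Cauchy_Schwarz_ineq_sum[of "monom s" ?Q "{..<n ^ s}"] by simp
  also have "(\<Sum>g<n ^ s. (monom s g)\<^sup>2) = real n ^ s" by (simp add: power2_eq_square monom_sq)
  also have "(\<Sum>g<n ^ s. (?Q g)\<^sup>2) = (\<Sum>C<D. \<Sum>C'<D. of_bool (lab k n C = lab k n C') * (?a C * ?a C'))"
  proof -
    have "(\<Sum>g<n ^ s. (?Q g)\<^sup>2) = (\<Sum>g<n ^ s. \<Sum>C<D. \<Sum>C'<D.?f g C C')"
      by (simp add: power2_eq_square sum_product mult_ac)
    also have "\<dots> = (\<Sum>C<D. \<Sum>g<n ^ s. \<Sum>C'<D.?f g C C')" by (rule sum.swap)
    also have "\<dots> = (\<Sum>C<D. \<Sum>C'<D. \<Sum>g<n ^ s.?f g C C')"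
      by (rule sum.cong[OF refl], rule sum.swap)
    also have "\<dots> = (\<Sum>C<D. \<Sum>C'<D. of_bool (lab k n C = lab k n C') * (?a C * ?a C'))"
      by (intro sum.cong refl sum_of_bool_eq) (use lab in auto)
    finally show ?thesis .
  qed
  also have "\<dots> = (\<Sum>C<D. \<Sum>C'<D. ?e C C') + pairs_sum"
    unfolding pairs_sum_def sum.distrib[symmetric]
    by (intro sum.cong refl) (simp add: algebra_simps)
  also have "(\<Sum>C<D. \<Sum>C'<D. ?e C C')
      \<le> (\<Sum>C<D. \<Sum>C'<D. of_bool (C' mod n ^ k = C mod n ^ k) * \<xi> C)"
  proof (intro sum_mono)
    fix C C'
    have "?a C * ?a C' \<le> \<xi> C"
      using sg_cases[of k n C] sg_cases[of k n C'] rest_cases[of C] rest_cases[of C'] xi[of C] xi[of C'] by auto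
    moreover have "0 \<le> \<xi> C" using xi[of C] by auto
    ultimately show "?e C C'
        \<le> of_bool (C' mod n ^ k = C mod n ^ k) * \<xi> C" by auto
  qed
  also have "(\<Sum>C<D. \<Sum>C'<D. of_bool (C' mod n ^ k = C mod n ^ k) * \<xi> C) \<le> (\<Sum>C<D. 2 ^ k * \<xi> C)"
  proof (intro sum_mono)
    fix C
    have "(\<Sum>C'<D. of_bool (C' mod n ^ k = C mod n ^ k) * \<xi> C) =
        real (card {C'. C' < D \<and> C' mod n ^ k = C mod n ^ k}) * \<xi> C"
    proof -
      have "{C'. C' < D \<and> C' mod n ^ k = C mod n ^ k} = {..<D} \<inter> {C'. C' mod n ^ k = C mod n ^ k}" by auto
      then have "(\<Sum>C'<D. of_bool (C' mod n ^ k = C mod n ^ k)) = real (card {C'. C' < D \<and> C' mod n ^ k = C mod n ^ k})"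
        by simp
      then show ?thesis by (simp only: sum_distrib_right[symmetric])
    qed
    also have "\<dots> \<le> 2 ^ k * \<xi> C"
    proof (rule mult_right_mono)
      have "real (card {C'. C' < D \<and> C' mod n ^ k = C mod n ^ k}) \<le> real (2 ^ k)"
        by (simp only: of_nat_le_iff card_same_tuple_le)
      then show "real (card {C'. C' < D \<and> C' mod n ^ k = C mod n ^ k}) \<le> 2 ^ k" by simp
      show "0 \<le> \<xi> C" using xi[of C] by auto
    qed
    finally show "(\<Sum>C'<D. of_bool (C' mod n ^ k = C mod n ^ k) * \<xi> C) \<le> 2 ^ k * \<xi> C" .
  qed
  also have "(\<Sum>C<D. 2 ^ k * \<xi> C) = 2 ^ k * w" by (simp add: weight_def sum_distrib_left)
  finally show ?thesis by (simp add: mult_left_mono)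
qed

text \<open>If a b = c then a = c b, because b^2 = 1. Otherwise a and c b are opposite signs, which
  differ by 2.\<close>

lemma sign_product_le:
  fixes a b c :: real
  assumes "a = 1 \<or> a = -1" "b = 1 \<or> b = -1" "c = 1 \<or> c = -1"
  shows "a \<le> c * b + 2 * of_bool (a * b \<noteq> c)"
  using assms by auto

lemma pair_sum_le: "pair_sum \<le> Phi + 2 * (\<Sum>C<D. \<xi> C * of_bool (value_at C \<noteq> sg k n C))"
proof -
  have "\<xi> C * (X (blk n 0 1 C) * X (blk n 1 1 C)) \<le>
      \<xi> C * sg k n C * (rest C * monom s (lab k n C)) + 2 * (\<xi> C * of_bool (value_at C \<noteq> sg k n C))" for C
  proof -
    let ?m = "rest C * monom s (lab k n C)" and ?x = "X (blk n 0 1 C) * X (blk n 1 1 C)"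
    have m: "?m = 1 \<or> ?m = -1" using rest_cases[of C] monom_cases[of s "lab k n C"] by auto
    have x: "?x = 1 \<or> ?x = -1" using X[of "blk n 0 1 C"] X[of "blk n 1 1 C"] by auto
    have v: "value_at C = ?x * ?m" using value_at_split[of C] by simp
    have "?x \<le> sg k n C * ?m + 2 * of_bool (value_at C \<noteq> sg k n C)"
      unfolding v by (rule sign_product_le[OF x m sg_cases])
    then show ?thesis using xi[of C] by (elim disjE) simp_all
  qed
  then show ?thesis
    unfolding pair_sum_def Phi_def sum_distrib_left sum.distrib[symmetric] by (intro sum_mono)
qed

lemma power_le_imp_abs_le:
  fixes a b :: real
  assumes "a ^ (2 * t) \<le> b ^ (2 * t)" "b \<ge> 0" "t > 0"
  shows "\<bar>a\<bar> \<le> b"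
proof (rule ccontr)
  assume "\<not> \<bar>a\<bar> \<le> b"
  then have "b ^ (2 * t) < \<bar>a\<bar> ^ (2 * t)" using assms by (intro power_strict_mono) auto
  then show False using assms(1) by (simp add: power_even_abs)
qed

text \<open>The first inequality of the certificate and the bias give \<open>pair_sum\<close> \<ge>
  2 \<rho>^2 w: of the 4 \<rho>^2 w due to the bias, the deviation costs at most half. The other two
  each bound one half of 2 \<open>Phi\<close>^2 by (\<rho>^2 w)^2, so \<open>Phi\<close> \<le>
  \<rho>^2 w. The gap of \<rho>^2 w has to come from violated clauses, which contribute at most 2
  each. R stands on the larger side of each inequality, so rounding it down is safe.\<close>

lemma certificate_sound:
  assumes cert: "certificate k (2 ^ i) n R \<xi>" and R: "0 \<le> R" "R \<le> 2 ^ n * \<rho>" and \<rho>: "\<rho> > 0"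
    and bias: "\<bar>\<Sum>v<n. X v\<bar> \<ge> 2 * \<rho> * n"
  shows "\<rho>\<^sup>2 * w \<le> 2 * (\<Sum>C<D. \<xi> C * of_bool (value_at C \<noteq> sg k n C))"
proof -
  let ?t = "2 ^ i :: nat"
  let ?e = "(2::real) ^ n"
  have e: "?e > 0" by simp
  have w: "w \<ge> 0" by (rule weight_nonneg)
  have R2: "R\<^sup>2 \<le> ?e\<^sup>2 * \<rho>\<^sup>2" "R ^ 4 \<le> ?e ^ 4 * \<rho> ^ 4"
    using power_mono[OF R(2,1), of 2] power_mono[OF R(2,1), of 4] by (simp_all only: power_mult_distrib)
  have G: "\<bar>quad (matG k n \<xi>) n X\<bar> \<le> 4 * (real n)\<^sup>2 * w * \<rho>\<^sup>2"
  proof -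
    let ?q = "quad (matG k n \<xi>) n X"
    have "?q ^ (2 * ?t) \<le> real n ^ (2 * ?t) * mtrace (matG k n \<xi>) n (2 * ?t)"
      using X by (intro quad_power_le_trace matG_sym) (metis one_power2 power2_minus)
    then have "?q ^ (2 * ?t) * ?e ^ (4 * ?t) \<le> real n ^ (2 * ?t) * mtrace (matG k n \<xi>) n (2 * ?t) * ?e ^ (4 * ?t)"
      by (intro mult_right_mono) auto
    also have "\<dots> \<le> real n ^ (2 * ?t) * (4 * real n * w * R\<^sup>2) ^ (2 * ?t)"
      using cert unfolding certificate_def mult.assoc by (intro mult_left_mono) auto
    finally have "(?q * ?e\<^sup>2) ^ (2 * ?t) \<le> (real n * (4 * real n * w * R\<^sup>2)) ^ (2 * ?t)"
      by (simp add: power_mult_distrib power_mult[symmetric] mult.assoc)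
    then have "\<bar>?q * ?e\<^sup>2\<bar> \<le> real n * (4 * real n * w * R\<^sup>2)"
      using w by (intro power_le_imp_abs_le) auto
    also have "\<dots> \<le> real n * (4 * real n * w * (?e\<^sup>2 * \<rho>\<^sup>2))"
      using R2 w by (intro mult_left_mono) auto
    finally have "\<bar>?q\<bar> * ?e\<^sup>2 \<le> (4 * (real n)\<^sup>2 * w * \<rho>\<^sup>2) * ?e\<^sup>2"
      by (simp add: abs_mult power2_eq_square mult_ac)
    then show ?thesis using e by simp
  qed
  have P: "real n ^ s * quad (matP k n \<xi>) (n ^ (2 * h)) zvec \<le> \<rho> ^ 4 * w\<^sup>2"
  proof -
    let ?N = "n ^ (2 * h)"
    let ?q = "quad (matP k n \<xi>) ?N zvec"
    have kk: "k - 2 = 2 * h + s" using half_par[of k] k by simp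
    have "?q ^ (2 * ?t) \<le> real ?N ^ (2 * ?t) * mtrace (matP k n \<xi>) ?N (2 * ?t)"
    proof (intro quad_power_le_trace matP_sym)
      fix r show "(zvec r)\<^sup>2 = 1"
        unfolding zvec_def power2_eq_square using monom_sq by (simp add: mult_ac)
    qed
    then have "?q ^ (2 * ?t) * (real n ^ (s * (2 * ?t)) * ?e ^ (8 * ?t)) \<le>
        real ?N ^ (2 * ?t) * mtrace (matP k n \<xi>) ?N (2 * ?t) * (real n ^ (s * (2 * ?t)) * ?e ^ (8 * ?t))"
      by (intro mult_right_mono) auto
    also have "\<dots> = mtrace (matP k n \<xi>) ?N (2 * ?t) * real n ^ (2 * ?t * (k - 2)) * ?e ^ (8 * ?t)"
      unfolding kk by (simp add: power_add algebra_simps power_mult[symmetric])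
    also have "\<dots> \<le> (R ^ 4 * w\<^sup>2) ^ (2 * ?t)" using cert by (simp add: certificate_def)
    finally have "(real n ^ s * ?q * ?e ^ 4) ^ (2 * ?t) \<le> (R ^ 4 * w\<^sup>2) ^ (2 * ?t)"
      by (simp add: power_mult_distrib power_mult[symmetric] mult_ac)
    then have "\<bar>real n ^ s * ?q * ?e ^ 4\<bar> \<le> R ^ 4 * w\<^sup>2"
      by (intro power_le_imp_abs_le) auto
    also have "\<dots> \<le> (?e ^ 4 * \<rho> ^ 4) * w\<^sup>2" using R2 by (intro mult_right_mono) auto
    also have "\<dots> = (\<rho> ^ 4 * w\<^sup>2) * ?e ^ 4" by (simp only: mult_ac)
    finally have "(real n ^ s * ?q) * ?e ^ 4 \<le> (\<rho> ^ 4 * w\<^sup>2) * ?e ^ 4"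
      by (rule order_trans[OF abs_ge_self])
    then show ?thesis by (rule mult_right_le_imp_le) simp
  qed
  have "real n ^ s * 2 ^ (k + 1) * ?e ^ 4 \<le> R ^ 4 * w" using cert by (simp add: certificate_def)
  also have "\<dots> \<le> (?e ^ 4 * \<rho> ^ 4) * w" using R2 w by (intro mult_right_mono) auto
  finally have "(real n ^ s * 2 ^ (k + 1)) * ?e ^ 4 \<le> (\<rho> ^ 4 * w) * ?e ^ 4" by (simp add: mult_ac)
  then have C2: "real n ^ s * 2 ^ (k + 1) \<le> \<rho> ^ 4 * w" using e by simp
  have "2 * Phi\<^sup>2 \<le> 2 * (real n ^ s * (2 ^ k * w + pairs_sum))" using Phi_square_le by simp
  also have "\<dots> = (real n ^ s * 2 ^ (k + 1)) * w + real n ^ s * (2 * pairs_sum)" by (simp add: algebra_simps)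
  also have "\<dots> \<le> (\<rho> ^ 4 * w) * w + \<rho> ^ 4 * w\<^sup>2"
    using C2 P w unfolding quad_matP by (intro add_mono mult_right_mono) auto
  also have "\<dots> = 2 * (\<rho>\<^sup>2 * w)\<^sup>2"
  proof -
    have "(\<rho>\<^sup>2 * w)\<^sup>2 = \<rho> ^ (2 * 2) * w\<^sup>2" by (simp only: power_mult_distrib power_mult)
    moreover have "(\<rho> ^ 4 * w) * w = \<rho> ^ 4 * w\<^sup>2" by (simp only: power2_eq_square mult.assoc)
    ultimately show ?thesis by simp
  qed
  finally have "Phi\<^sup>2 \<le> (\<rho>\<^sup>2 * w)\<^sup>2" by linarith
  then have Phi: "Phi \<le> \<rho>\<^sup>2 * w"
    by (rule power2_le_imp_le) (intro mult_nonneg_nonneg zero_le_power2 w)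
  have "(2 * \<rho> * n)\<^sup>2 \<le> (\<Sum>v<n. X v)\<^sup>2"
  proof -
    have "(2 * \<rho> * n)\<^sup>2 \<le> \<bar>\<Sum>v<n. X v\<bar>\<^sup>2" using bias \<rho> by (intro power_mono) auto
    then show ?thesis by simp
  qed
  then have "2 * w * (2 * \<rho> * n)\<^sup>2 \<le> 2 * w * (\<Sum>v<n. X v)\<^sup>2" using w by (intro mult_left_mono) auto
  then have "(real n)\<^sup>2 * (2 * (w * \<rho>\<^sup>2)) \<le> (real n)\<^sup>2 * pair_sum"
    using quad_matG G by (simp add: power_mult_distrib algebra_simps)
  then have "2 * (w * \<rho>\<^sup>2) \<le> pair_sum" using n by simp
  then show ?thesis using pair_sum_le Phi by (simp add: mult.commute)
qed

end

section \<open>Expected traces of sparse random matrices\<close>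

definition all_repeated :: "nat list \<Rightarrow> bool" where
  "all_repeated us \<longleftrightarrow> (\<forall>u\<in>set us. count_list us u \<ge> 2)"

lemma card_set_le_half_length:
  assumes "all_repeated us"
  shows "2 * card (set us) \<le> length us"
proof -
  have "2 * card (set us) = (\<Sum>u\<in>set us. 2)" by simp
  also have "\<dots> \<le> (\<Sum>u\<in>set us. count_list us u)"
    using assms by (intro sum_mono) (auto simp: all_repeated_def)
  also have "\<dots> = length us" by (rule sum_count_set) auto
  finally show ?thesis .
qed

lemma power_div_le:
  fixes p \<theta> :: real
  assumes "0 \<le> p" "1 \<le> \<theta>" "c \<le> d"
  shows "p ^ c \<le> \<theta> ^ d * (p / \<theta>) ^ c"
proof -
  have "p ^ c = \<theta> ^ c * (p / \<theta>) ^ c" using assms(2) by (simp add: power_divide)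
  also have "\<dots> \<le> \<theta> ^ d * (p / \<theta>) ^ c" using assms by (intro mult_right_mono power_increasing) auto
  finally show ?thesis .
qed

text \<open>One estimate for both matrices: monomials in single clauses for \<open>matG\<close>
  (\<open>width\<close> 1), in pairs of clauses for \<open>matP\<close> (\<open>width\<close> 2).
  The factor \<theta> measures by how much p exceeds a density at which the weighted row sums are
  bounded. The set S in \<open>row\<close> stands for the variables already met along a
  walk.\<close>

locale random_matrix =
  fixes Q :: "'w pmf" and Y :: "nat \<Rightarrow> 'w \<Rightarrow> real" and V :: "nat set" and p \<theta> K :: real
    and E :: "'e set" and vars :: "'e \<Rightarrow> nat list" and c :: "nat \<Rightarrow> 'e \<Rightarrow> nat \<Rightarrow> real"
    and N width d :: nat
  assumes fin: "finite (set_pmf Q)" "finite E"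
    and moment: "set us \<subseteq> V \<Longrightarrow>
      \<bar>measure_pmf.expectation Q (\<lambda>\<omega>. \<Prod>u\<leftarrow>us. Y u \<omega>)\<bar> \<le> (if all_repeated us then p ^ card (set us) else 0)"
    and vars: "e \<in> E \<Longrightarrow> length (vars e) = width \<and> set (vars e) \<subseteq> V"
    and row: "r < N \<Longrightarrow> finite S \<Longrightarrow> card S \<le> 2 * d \<Longrightarrow>
      (\<Sum>r'<N. \<Sum>e\<in>E. \<bar>c r e r'\<bar> * (p / \<theta>) ^ card (set (vars e) - S)) \<le> K"
    and p: "0 \<le> p" and \<theta>: "1 \<le> \<theta>"
begin

definition mat :: "'w \<Rightarrow> nat \<Rightarrow> nat \<Rightarrow> real" where
  "mat \<omega> r r' = (\<Sum>e\<in>E. c r e r' * (\<Prod>u\<leftarrow>vars e. Y u \<omega>))"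

text \<open>Powers of the matrix are peeled off one factor at a time, collecting the variables seen so far
  in \<open>us\<close>.  A product with an unrepeated variable has mean zero, so a surviving product of \<open>2 d\<close>
  factors has at most \<open>d\<close> distinct variables; weighting each new variable by \<open>p / \<theta>\<close> and paying
  \<open>\<theta> ^ d\<close> once at the end makes the row sums bounded by a constant.\<close>

definition joint :: "nat \<Rightarrow> nat list \<Rightarrow> nat \<Rightarrow> nat \<Rightarrow> real" where
  "joint L us r r' = measure_pmf.expectation Q (\<lambda>\<omega>. (\<Prod>u\<leftarrow>us. Y u \<omega>) * mpow (mat \<omega>) N L r r')"

lemma integrable: "integrable (measure_pmf Q) (f :: 'w \<Rightarrow> real)"
  using fin(1) by (rule integrable_measure_pmf_finite)

lemma joint_Suc: "joint (Suc L) us r r' = (\<Sum>q<N. \<Sum>e\<in>E. c r e q * joint L (us @ vars e) q r')"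
proof -
  have "(\<Prod>u\<leftarrow>us. Y u \<omega>) * mpow (mat \<omega>) N (Suc L) r r' =
    (\<Sum>q<N. \<Sum>e\<in>E. c r e q * ((\<Prod>u\<leftarrow>us @ vars e. Y u \<omega>) * mpow (mat \<omega>) N L q r'))" for \<omega>
    by (simp add: mat_def sum_distrib_left sum_distrib_right mult_ac)
  then show ?thesis unfolding joint_def by (simp add: Bochner_Integration.integral_sum integrable)
qed

lemma joint_bound:
  "length us + width * L = 2 * d \<Longrightarrow> set us \<subseteq> V \<Longrightarrow> r < N \<Longrightarrow>
    (\<Sum>r'<N. \<bar>joint L us r r'\<bar>) \<le> \<theta> ^ d * (p / \<theta>) ^ card (set us) * K ^ L"
proof (induction L arbitrary: us r)
  case 0
  let ?E = "\<lambda>us. measure_pmf.expectation Q (\<lambda>\<omega>. \<Prod>u\<leftarrow>us. Y u \<omega>)"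
  have "joint 0 us r r' = of_bool (r = r') * ?E us" for r'
    by (simp add: joint_def mult.commute)
  then have "(\<Sum>r'<N. \<bar>joint 0 us r r'\<bar>) =
      (\<Sum>r'<N. of_bool (r = r') * \<bar>?E us\<bar>)"
    by (intro sum.cong refl) (simp add: abs_mult)
  also have "\<dots> = \<bar>?E us\<bar>"
    using 0 by (intro sum_of_bool_eq) auto
  also have "\<dots> \<le> (if all_repeated us then p ^ card (set us) else 0)" by (rule moment[OF 0(2)])
  also have "\<dots> \<le> \<theta> ^ d * (p / \<theta>) ^ card (set us)"
  proof (cases "all_repeated us")
    case True
    then have "card (set us) \<le> d" using card_set_le_half_length[OF True] 0(1) by simp
    then show ?thesis using True power_div_le[OF p \<theta>] by simp
  qed (use p \<theta> in simp)
  finally show ?case by simp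
next
  case (Suc L)
  let ?b = "\<theta> ^ d * (p / \<theta>) ^ card (set us) * K ^ L"
  have card: "card (set us) \<le> 2 * d" using card_length[of us] Suc.prems(1) by linarith
  have row0: "0 \<le> (\<Sum>r'<N. \<Sum>e\<in>E. \<bar>c r e r'\<bar> * (p / \<theta>) ^ card (set (vars e) - set us))"
    using p \<theta> by (intro sum_nonneg) auto
  have K0: "0 \<le> K" using row0 row[OF Suc.prems(3) _ card] by simp
  have b0: "0 \<le> ?b" using K0 p \<theta> by simp
  have "(\<Sum>r'<N. \<bar>joint (Suc L) us r r'\<bar>) \<le>
      (\<Sum>r'<N. \<Sum>q<N. \<Sum>e\<in>E. \<bar>c r e q\<bar> * \<bar>joint L (us @ vars e) q r'\<bar>)"
    unfolding joint_Suc by (intro sum_mono order_trans[OF sum_abs] sum_abs[THEN order_trans])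
      (simp add: abs_mult)
  also have "\<dots> = (\<Sum>q<N. \<Sum>r'<N. \<Sum>e\<in>E. \<bar>c r e q\<bar> * \<bar>joint L (us @ vars e) q r'\<bar>)" by (rule sum.swap)
  also have "\<dots> = (\<Sum>q<N. \<Sum>e\<in>E. \<bar>c r e q\<bar> * (\<Sum>r'<N. \<bar>joint L (us @ vars e) q r'\<bar>))"
    unfolding sum_distrib_left by (rule sum.cong[OF refl], rule sum.swap)
  also have "\<dots> \<le> (\<Sum>q<N. \<Sum>e\<in>E. \<bar>c r e q\<bar> * (?b * (p / \<theta>) ^ card (set (vars e) - set us)))"
  proof (intro sum_mono mult_left_mono)
    fix q e assume q: "q \<in> {..<N}" and e: "e \<in> E"
    have "(\<Sum>r'<N. \<bar>joint L (us @ vars e) q r'\<bar>) \<le> \<theta> ^ d * (p / \<theta>) ^ card (set (us @ vars e)) * K ^ L"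
      using Suc.prems vars[OF e] q by (intro Suc.IH) auto
    \<comment> \<open>Only variables of e not met before are charged; their weight is the one that
      \<open>row\<close> sums over.\<close>
    also have "card (set (us @ vars e)) = card (set us) + card (set (vars e) - set us)"
      using card_Un_disjoint[of "set us" "set (vars e) - set us"] by (simp add: Un_Diff_cancel)
    finally show "(\<Sum>r'<N. \<bar>joint L (us @ vars e) q r'\<bar>) \<le> ?b * (p / \<theta>) ^ card (set (vars e) - set us)"
      by (simp add: power_add mult_ac)
  qed auto
  also have "\<dots> = ?b * (\<Sum>q<N. \<Sum>e\<in>E. \<bar>c r e q\<bar> * (p / \<theta>) ^ card (set (vars e) - set us))"
    by (simp only: sum_distrib_left mult.left_commute)
  also have "\<dots> \<le> ?b * K" using row[OF Suc.prems(3) _ card] b0 by (intro mult_left_mono) auto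
  finally show ?case by (simp add: mult_ac)
qed

lemma expectation_trace_le:
  assumes "width * L = 2 * d"
  shows "measure_pmf.expectation Q (\<lambda>\<omega>. mtrace (mat \<omega>) N L) \<le> real N * (\<theta> ^ d * K ^ L)"
proof -
  have "measure_pmf.expectation Q (\<lambda>\<omega>. mtrace (mat \<omega>) N L) = (\<Sum>r<N. joint L [] r r)"
    unfolding mtrace_def joint_def by (simp add: Bochner_Integration.integral_sum integrable)
  also have "\<dots> \<le> (\<Sum>r<N. \<theta> ^ d * K ^ L)"
  proof (rule sum_mono)
    fix r assume r: "r \<in> {..<N}"
    have "joint L [] r r \<le> \<bar>joint L [] r r\<bar>" by simp
    also have "\<dots> \<le> (\<Sum>r'<N. \<bar>joint L [] r r'\<bar>)"
      using r by (intro member_le_sum[of r "{..<N}" "\<lambda>r'. \<bar>joint L [] r r'\<bar>"]) auto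
    also have "\<dots> \<le> \<theta> ^ d * K ^ L" using joint_bound[of "[]" L r] assms r by simp
    finally show "joint L [] r r \<le> \<theta> ^ d * K ^ L" .
  qed
  finally show ?thesis by simp
qed

end

section \<open>Moments of independent centred bits\<close>

definition bits :: "nat \<Rightarrow> real \<Rightarrow> (nat \<Rightarrow> bool) pmf" where
  "bits D p = Pi_pmf {..<D} False (\<lambda>_. bernoulli_pmf p)"

lemma finite_set_bits: "finite (set_pmf (bits D p))"
  unfolding bits_def by (subst set_Pi_pmf) (auto intro: finite_PiE_dflt)

lemma prod_list_count:
  fixes g :: "nat \<Rightarrow> real"
  shows "set us \<subseteq> A \<Longrightarrow> finite A \<Longrightarrow> (\<Prod>u\<leftarrow>us. g u) = (\<Prod>i\<in>A. g i ^ count_list us i)"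
proof (induction us)
  case (Cons u us)
  have "(\<Prod>i\<in>A. g i ^ count_list (u # us) i) = (\<Prod>i\<in>A. (if i = u then g i else 1) * g i ^ count_list us i)"
    by (intro prod.cong refl) auto
  also have "\<dots> = g u * (\<Prod>i\<in>A. g i ^ count_list us i)"
    using Cons.prems by (simp add: prod.distrib prod.delta)
  finally show ?case using Cons by simp
qed auto

lemma bernoulli_centered_moment:
  assumes "0 \<le> p" "p \<le> 1"
  shows "measure_pmf.expectation (bernoulli_pmf p) (\<lambda>b. (of_bool b - p) ^ 1) = 0"
    and "j \<ge> 2 \<Longrightarrow> \<bar>measure_pmf.expectation (bernoulli_pmf p) (\<lambda>b. (of_bool b - p) ^ j)\<bar> \<le> p"
proof -
  have E: "measure_pmf.expectation (bernoulli_pmf p) (\<lambda>b. (of_bool b - p) ^ j) =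
      p * (1 - p) ^ j + (1 - p) * (- p) ^ j" for j
    using assms by (simp add: integral_bernoulli_pmf)
  show "measure_pmf.expectation (bernoulli_pmf p) (\<lambda>b. (of_bool b - p) ^ 1) = 0"
    unfolding E by (simp add: algebra_simps)
  assume j: "j \<ge> 2"
  have le: "x ^ j \<le> x ^ 1" if "0 \<le> x" "x \<le> 1" for x :: real
    using that j by (intro power_decreasing) auto
  have le2: "x ^ j \<le> x ^ 2" if "0 \<le> x" "x \<le> 1" for x :: real
    using that j by (intro power_decreasing) auto
  have "\<bar>p * (1 - p) ^ j + (1 - p) * (- p) ^ j\<bar> \<le> p * (1 - p) ^ j + (1 - p) * p ^ j"
    using assms by (intro order_trans[OF abs_triangle_ineq]) (simp add: abs_mult power_abs)
  also have "\<dots> \<le> p * (1 - p) ^ 1 + (1 - p) * p ^ 2"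
    using assms le[of "1 - p"] le2[of p] by (intro add_mono mult_left_mono) auto
  also have "\<dots> = p - p ^ 3" by (simp add: algebra_simps power2_eq_square power3_eq_cube)
  also have "\<dots> \<le> p" using assms by simp
  finally show "\<bar>measure_pmf.expectation (bernoulli_pmf p) (\<lambda>b. (of_bool b - p) ^ j)\<bar> \<le> p" unfolding E .
qed

lemma expectation_prod_bits:
  fixes f :: "nat \<Rightarrow> bool \<Rightarrow> real"
  shows "measure_pmf.expectation (bits D p) (\<lambda>\<omega>. \<Prod>i<D. f i (\<omega> i)) =
    (\<Prod>i<D. measure_pmf.expectation (bernoulli_pmf p) (f i))"
proof -
  have ind: "prob_space.indep_vars (measure_pmf (bits D p)) (\<lambda>_. borel) (\<lambda>i \<omega>. f i (\<omega> i)) {..<D}"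
  proof (rule prob_space.indep_vars_compose2[OF measure_pmf.prob_space_axioms, where X = "\<lambda>i \<omega>. \<omega> i" and M' = "\<lambda>_. count_space UNIV"])
    show "prob_space.indep_vars (measure_pmf (bits D p)) (\<lambda>_. count_space UNIV) (\<lambda>i \<omega>. \<omega> i) {..<D}"
      unfolding bits_def by (rule indep_vars_Pi_pmf) simp
  qed auto
  have "measure_pmf.expectation (bits D p) (\<lambda>\<omega>. f i (\<omega> i)) = measure_pmf.expectation (bernoulli_pmf p) (f i)"
    if "i < D" for i
  proof -
    have "map_pmf (\<lambda>\<omega>. \<omega> i) (bits D p) = bernoulli_pmf p"
      unfolding bits_def using that by (subst Pi_pmf_component) auto
    then show ?thesis by (metis integral_map_pmf)
  qed
  then show ?thesis
    by (subst prob_space.indep_vars_lebesgue_integral[OF measure_pmf.prob_space_axioms _ ind])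
      (auto intro: integrable_measure_pmf_finite finite_set_bits)
qed

lemma bits_moment:
  assumes "0 \<le> p" "p \<le> 1" "set us \<subseteq> {..<D}"
  shows "\<bar>measure_pmf.expectation (bits D p) (\<lambda>\<omega>. \<Prod>u\<leftarrow>us. of_bool (\<omega> u) - p)\<bar> \<le>
    (if all_repeated us then p ^ card (set us) else 0)"
proof -
  let ?m = "\<lambda>i. measure_pmf.expectation (bernoulli_pmf p) (\<lambda>b. (of_bool b - p) ^ count_list us i)"
  have E: "measure_pmf.expectation (bits D p) (\<lambda>\<omega>. \<Prod>u\<leftarrow>us. of_bool (\<omega> u) - p) = (\<Prod>i<D. ?m i)"
    using assms(3) by (simp add: prod_list_count[of us "{..<D}"] expectation_prod_bits[symmetric])
  show ?thesis
  proof (cases "all_repeated us")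
    case False
    then obtain u where u: "u \<in> set us" "count_list us u < 2" by (auto simp: all_repeated_def)
    then have "count_list us u = 1" by (metis One_nat_def count_list_0_iff less_2_cases)
    then have "?m u = 0" using bernoulli_centered_moment(1)[OF assms(1,2)] by simp
    then have "(\<Prod>i<D. ?m i) = 0" using u assms(3) by (intro prod_zero) auto
    then show ?thesis unfolding E using False by simp
  next
    case True
    have "\<bar>\<Prod>i<D. ?m i\<bar> = (\<Prod>i<D. \<bar>?m i\<bar>)" by (simp add: abs_prod)
    also have "\<dots> \<le> (\<Prod>i<D. if i \<in> set us then p else 1)"
    proof (intro prod_mono conjI)
      fix i
      show "\<bar>?m i\<bar> \<le> (if i \<in> set us then p else 1)"
        using bernoulli_centered_moment(2)[OF assms(1,2)] True
        by (auto simp: all_repeated_def count_list_0_iff)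
    qed auto
    also have "\<dots> = p ^ card (set us)"
      using assms(3) by (simp add: prod.If_cases Int_absorb1 Int_absorb2)
    finally show ?thesis unfolding E using True by simp
  qed
qed

section \<open>Row sums of the certificate matrices\<close>

text \<open>Fixing two disjoint blocks of digits leaves free the digits below, between and above
  them; the signs belong to the top part. The bound is multiplied out to avoid quotients.\<close>

lemma card_two_blocks:
  assumes "i + l \<le> i'" "i' + l' \<le> k" "n > 0"
  shows "card {C. C < 2 ^ k * n ^ k \<and> blk n i l C = a \<and> blk n i' l' C = b} * n ^ (l + l') \<le> 2 ^ k * n ^ k"
proof -
  let ?A = "{C. C < 2 ^ k * n ^ k \<and> blk n i l C = a \<and> blk n i' l' C = b}"
  let ?m = "i' - i - l"
  let ?f = "\<lambda>C. (C mod n ^ i, C div n ^ (i + l) mod n ^ ?m, C div n ^ (i' + l'))"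
  let ?B = "{..<n ^ i} \<times> {..<n ^ ?m} \<times> {..<2 ^ k * n ^ (k - (i' + l'))}"
  have i': "i' = i + l + ?m" using assms by simp
  have "inj_on ?f ?A"
  proof (rule inj_onI)
    fix x y assume x: "x \<in> ?A" and y: "y \<in> ?A" and e: "?f x = ?f y"
    have step: "x div n ^ a = y div n ^ a"
      if "x div n ^ (a + c) = y div n ^ (a + c)" "x div n ^ a mod n ^ c = y div n ^ a mod n ^ c" for a c
      using that unfolding power_add div_mult2_eq by (metis div_mult_mod_eq)
    have "x div n ^ i' = y div n ^ i'" by (rule step[of i' l']) (use x y e in \<open>auto simp: blk_def\<close>)
    then have "x div n ^ (i + l) = y div n ^ (i + l)"
      by (intro step[of "i + l" ?m]) (use e i' in auto)
    then have "x div n ^ i = y div n ^ i" by (intro step[of i l]) (use x y in \<open>auto simp: blk_def\<close>)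
    then show "x = y" using step[of 0 i] e by simp
  qed
  moreover have "?f ` ?A \<subseteq> ?B"
  proof -
    have "C div n ^ (i' + l') < 2 ^ k * n ^ (k - (i' + l'))" if "C < 2 ^ k * n ^ k" for C
    proof -
      have "2 ^ k * n ^ k = 2 ^ k * n ^ (k - (i' + l')) * n ^ (i' + l')"
        using assms(2) by (simp add: mult.assoc power_add[symmetric])
      then show ?thesis using that by (simp add: less_mult_imp_div_less)
    qed
    then show ?thesis using assms(3) by auto
  qed
  ultimately have "card ?A \<le> card ?B" by (intro card_inj_on_le) auto
  also have "\<dots> = 2 ^ k * n ^ (i + ?m + (k - (i' + l')))"
    by (simp add: card_cartesian_product power_add)
  finally have "card ?A * n ^ (l + l') \<le> 2 ^ k * n ^ (i + ?m + (k - (i' + l'))) * n ^ (l + l')"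
    by (rule mult_le_mono1)
  also have "\<dots> = 2 ^ k * n ^ (i + ?m + (k - (i' + l')) + (l + l'))" by (simp add: power_add)
  also have "i + ?m + (k - (i' + l')) + (l + l') = k" using assms by simp
  finally show ?thesis .
qed

lemma card_one_block:
  assumes "i + l \<le> k" "n > 0"
  shows "card {C. C < 2 ^ k * n ^ k \<and> blk n i l C = a} * n ^ l \<le> 2 ^ k * n ^ k"
  using card_two_blocks[of i l "i + l" 0 k n a 0] assms by (simp add: blk_def)

text \<open>An upper bound would not do here: the zero sum in \<open>sum_coefG\<close>, and with it
  the invariance under centring, rests on the exact count.\<close>

lemma card_first_two_digits:
  assumes "r < n" "r' < n" "k \<ge> 2"
  shows "card {C. C < 2 ^ k * n ^ k \<and> blk n 0 1 C = r \<and> blk n 1 1 C = r'} = 2 ^ k * n ^ (k - 2)"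
proof -
  let ?v = "r + n * r'" let ?Z = "2 ^ k * n ^ (k - 2)"
  have n: "n > 0" using assms(1) by simp
  have kk: "n ^ k = n\<^sup>2 * n ^ (k - 2)" using assms(3) by (metis le_add_diff_inverse power_add)
  have "?v < n + n * r'" using assms(1) by simp
  also have "\<dots> = n * Suc r'" by simp
  also have "\<dots> \<le> n * n" using assms(2) by (intro mult_le_mono) auto
  finally have v: "?v < n\<^sup>2" by (simp add: power2_eq_square)
  have "{C. C < 2 ^ k * n ^ k \<and> blk n 0 1 C = r \<and> blk n 1 1 C = r'} = (\<lambda>z. ?v + n\<^sup>2 * z) ` {..<?Z}"
  proof (intro equalityI subsetI)
    fix C assume "C \<in> {C. C < 2 ^ k * n ^ k \<and> blk n 0 1 C = r \<and> blk n 1 1 C = r'}"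
    then have C: "C < ?Z * n\<^sup>2" "C mod n = r" "C div n mod n = r'" by (auto simp: kk blk_def mult_ac)
    have "C mod n\<^sup>2 = ?v" unfolding power2_eq_square mod_mult2_eq using C by simp
    then have "C = ?v + n\<^sup>2 * (C div n\<^sup>2)" by (metis add.commute mult_div_mod_eq)
    moreover have "C div n\<^sup>2 < ?Z" using C(1) by (rule less_mult_imp_div_less)
    ultimately show "C \<in> (\<lambda>z. ?v + n\<^sup>2 * z) ` {..<?Z}" by blast
  next
    fix C assume "C \<in> (\<lambda>z. ?v + n\<^sup>2 * z) ` {..<?Z}"
    then obtain z where z: "z < ?Z" "C = ?v + n\<^sup>2 * z" by auto
    have "C < n\<^sup>2 + n\<^sup>2 * z" using v z by simp
    also have "\<dots> = n\<^sup>2 * Suc z" by simp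
    also have "\<dots> \<le> n\<^sup>2 * ?Z" using z by (intro mult_le_mono) auto
    finally have "C < 2 ^ k * n ^ k" by (simp add: kk mult_ac)
    moreover have e: "C = r + n * (r' + n * z)" by (simp add: z power2_eq_square algebra_simps)
    have "C mod n = r" "C div n mod n = r'" using assms n unfolding e by simp_all
    ultimately show "C \<in> {C. C < 2 ^ k * n ^ k \<and> blk n 0 1 C = r \<and> blk n 1 1 C = r'}"
      by (simp add: blk_def)
  qed
  moreover have "inj_on (\<lambda>z. ?v + n\<^sup>2 * z) {..<?Z}" using n by (auto simp: inj_on_def)
  ultimately show ?thesis by (simp add: card_image)
qed

lemma sum_of_bool_card:
  "finite A \<Longrightarrow> (\<Sum>x\<in>A. of_bool (P x)) = real (card {x \<in> A. P x})"
  by (simp add: Int_def)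

lemma sum_coefG:
  assumes "r < n" "r' < n" "k \<ge> 2"
  shows "(\<Sum>C<2 ^ k * n ^ k. coefG n r C r') = 0"
proof -
  let ?D = "2 ^ k * n ^ k"
  have *: "(\<Sum>C<?D. of_bool (blk n 0 1 C = a \<and> blk n 1 1 C = b)) = 2 ^ k * real n ^ (k - 2)"
    if "a < n" "b < n" for a b
    using card_first_two_digits[OF that assms(3)] by (simp only: sum_of_bool_card finite_lessThan lessThan_iff) simp
  have kk: "real n ^ k = (real n)\<^sup>2 * real n ^ (k - 2)" using assms(3) by (metis le_add_diff_inverse power_add)
  have "(\<Sum>C<?D. coefG n r C r') = (real n)\<^sup>2 * ((\<Sum>C<?D. of_bool (blk n 0 1 C = r \<and> blk n 1 1 C = r')) +
      (\<Sum>C<?D. of_bool (blk n 0 1 C = r' \<and> blk n 1 1 C = r))) - 2 * real ?D"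
    unfolding coefG_def sum_subtractf sum_distrib_left sum.distrib[symmetric] distrib_left by simp
  also have "\<dots> = 0" unfolding *[OF assms(1,2)] *[OF assms(2,1)] by (simp add: kk)
  finally show ?thesis .
qed

lemma matG_shift:
  assumes "r < n" "r' < n" "k \<ge> 2"
  shows "matG k n (\<lambda>C. \<xi> C - q) r r' = matG k n \<xi> r r'"
  using sum_coefG[OF assms]
  by (simp add: matG_def right_diff_distrib sum_subtractf sum_distrib_right[symmetric])

text \<open>Flipping the lowest sign bit negates the product, so the terms for 2 m and 2 m + 1
  cancel.\<close>

lemma sum_sign_zero:
  assumes "k \<ge> 1"
  shows "(\<Sum>c<2 ^ k. \<Prod>j<k. 1 - 2 * real (c div 2 ^ j mod 2)) = 0"
proof -
  obtain k' where k: "k = Suc k'" using assms by (cases k) auto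
  let ?f = "\<lambda>c. \<Prod>j<k. 1 - 2 * real (c div 2 ^ j mod 2)"
  have "?f (m * 2) + ?f (Suc (m * 2)) = 0" for m
  proof -
    have "Suc (m * 2) mod 2 = 1" by presburger
    then show ?thesis unfolding k prod.lessThan_Suc_shift by (simp add: div_mult2_eq)
  qed
  moreover have "sum ?f {m * 2..<m * 2 + 2} = ?f (m * 2) + ?f (Suc (m * 2))" for m
    by (simp add: numeral_2_eq_2)
  ultimately have "sum ?f {m * 2..<m * 2 + 2} = 0" for m by simp
  then have "(\<Sum>m<2 ^ k'. sum ?f {m * 2..<m * 2 + 2}) = 0" by simp
  then have "sum ?f {..<2 ^ k' * 2} = 0" by (simp only: sum.nat_group)
  then show ?thesis by (simp add: k mult.commute)
qed

lemma sum_sg_zero: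
  assumes "k \<ge> 1" "n > 0"
  shows "(\<Sum>C<2 ^ k * n ^ k. sg k n C * f (C mod n ^ k)) = 0"
proof -
  let ?M = "n ^ k"
  let ?s = "\<lambda>c. \<Prod>j<k. 1 - 2 * real (c div 2 ^ j mod 2)"
  have "(\<Sum>C<2 ^ k * ?M. sg k n C * f (C mod ?M)) =
      (\<Sum>c<2 ^ k. sum (\<lambda>C. sg k n C * f (C mod ?M)) {c * ?M..<c * ?M + ?M})"
    by (rule sum.nat_group[symmetric])
  also have "\<dots> = (\<Sum>c<2 ^ k. \<Sum>u<?M. ?s c * f u)"
  proof (rule sum.cong[OF refl])
    fix c
    have "sum (\<lambda>C. sg k n C * f (C mod ?M)) {c * ?M..<c * ?M + ?M} =
        sum (\<lambda>u. sg k n (u + c * ?M) * f ((u + c * ?M) mod ?M)) {0..<?M}"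
      using sum.shift_bounds_nat_ivl[of "\<lambda>C. sg k n C * f (C mod ?M)" 0 "c * ?M" ?M] by (simp add: add.commute)
    also have "\<dots> = (\<Sum>u<?M. ?s c * f u)"
      using assms(2) by (intro sum.cong) (auto simp: sg_def)
    finally show "sum (\<lambda>C. sg k n C * f (C mod ?M)) {c * ?M..<c * ?M + ?M} = (\<Sum>u<?M. ?s c * f u)" .
  qed
  also have "\<dots> = (\<Sum>c<2 ^ k. ?s c) * (\<Sum>u<?M. f u)" by (simp add: sum_product)
  finally show ?thesis using sum_sign_zero[OF assms(1)] by simp
qed

lemma blk_mod: "i + l \<le> k \<Longrightarrow> blk n i l (C mod n ^ k) = blk n i l C"
proof -
  assume le: "i + l \<le> k"
  then have kk: "n ^ k = n ^ i * (n ^ l * n ^ (k - i - l))" by (simp add: power_add[symmetric])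
  show ?thesis
  proof (cases "n = 0")
    case True
    then show ?thesis using le by (cases k) (auto simp: blk_def)
  next
    case False
    then have "C mod n ^ k div n ^ i = C div n ^ i mod (n ^ l * n ^ (k - i - l))"
      unfolding kk mod_mult2_eq by simp
    then show ?thesis by (simp add: blk_def mod_mod_cancel)
  qed
qed

text \<open>Apart from the two signs, \<open>coefP\<close> depends on the clauses only through their
  tuples, so summing over the signs of either clause gives zero. This is why equality of tuples is
  excluded rather than equality of clauses: the exclusion C \<noteq> C' would break the
  cancellation.\<close>

lemma sum_coefP:
  assumes "k \<ge> 2" "n > 0"
  shows "(\<Sum>C'<2 ^ k * n ^ k. coefP k n r C C' r') = 0" "(\<Sum>C<2 ^ k * n ^ k. coefP k n r C C' r') = 0"
proof -
  let ?h = "half k"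
  have k: "k = 2 + 2 * ?h + par k" using half_par[OF assms(1)] .
  have m: "blk n 2 ?h (C mod n ^ k) = blk n 2 ?h C" "blk n (2 + ?h) ?h (C mod n ^ k) = blk n (2 + ?h) ?h C"
    "lab k n (C mod n ^ k) = lab k n C" for C
    unfolding lab_def by (rule blk_mod; use k in linarith)+
  have mm: "src k n (C mod n ^ k) C' = src k n C C'" "src k n C (C' mod n ^ k) = src k n C C'"
    "dst k n (C mod n ^ k) C' = dst k n C C'" "dst k n C (C' mod n ^ k) = dst k n C C'" for C C'
    by (simp_all only: src_def dst_def m)
  let ?f = "\<lambda>C C'. of_bool (C mod n ^ k \<noteq> C' mod n ^ k) * of_bool (lab k n C = lab k n C') *
     (of_bool (src k n C C' = r \<and> dst k n C C' = r') + of_bool (src k n C C' = r' \<and> dst k n C C' = r)) :: real"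
  have f: "?f (C mod n ^ k) C' = ?f C C'" "?f C (C' mod n ^ k) = ?f C C'" for C C'
    by (simp_all only: m mm mod_mod_trivial)
  have c: "coefP k n r C C' r' = sg k n C' * (sg k n C * ?f C (C' mod n ^ k))"
     "coefP k n r C C' r' = sg k n C * (sg k n C' * ?f (C mod n ^ k) C')" for C C'
    unfolding f by (simp_all add: coefP_def mult_ac)
  have k1: "k \<ge> 1" using assms by simp
  show "(\<Sum>C'<2 ^ k * n ^ k. coefP k n r C C' r') = 0" unfolding c(1) by (rule sum_sg_zero[OF k1 assms(2)])
  show "(\<Sum>C<2 ^ k * n ^ k. coefP k n r C C' r') = 0" unfolding c(2) by (rule sum_sg_zero[OF k1 assms(2)])
qed

text \<open>Every correction term of the expanded product is free of \<xi> at one of its two clauses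
  and vanishes when summed over that clause.\<close>

lemma matP_shift:
  assumes "k \<ge> 2" "n > 0"
  shows "matP k n (\<lambda>C. \<xi> C - q) r r' = matP k n \<xi> r r'"
proof -
  let ?c = "\<lambda>C C'. coefP k n r C C' r'" let ?D = "2 ^ k * n ^ k"
  have "matP k n (\<lambda>C. \<xi> C - q) r r' = (\<Sum>C<?D. \<Sum>C'<?D. ?c C C' * (\<xi> C * \<xi> C') - q * \<xi> C * ?c C C' -
      (q * \<xi> C' * ?c C C' - q\<^sup>2 * ?c C C'))"
    unfolding matP_def by (intro sum.cong refl) (simp add: algebra_simps power2_eq_square)
  also have "\<dots> = matP k n \<xi> r r' - (\<Sum>C<?D. q * \<xi> C * (\<Sum>C'<?D. ?c C C')) -
      ((\<Sum>C<?D. \<Sum>C'<?D. q * \<xi> C' * ?c C C') - (\<Sum>C<?D. q\<^sup>2 * (\<Sum>C'<?D. ?c C C')))"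
    by (simp only: matP_def sum_subtractf sum_distrib_left)
  also have "(\<Sum>C<?D. \<Sum>C'<?D. q * \<xi> C' * ?c C C') = (\<Sum>C'<?D. q * \<xi> C' * (\<Sum>C<?D. ?c C C'))"
    unfolding sum_distrib_left by (rule sum.swap)
  finally show ?thesis by (simp add: sum_coefP[OF assms])
qed

lemma mtrace_cong:
  assumes "\<And>r s. r < N \<Longrightarrow> s < N \<Longrightarrow> A r s = B r s"
  shows "mtrace A N L = mtrace B N L"
proof -
  have "r < N \<Longrightarrow> s < N \<Longrightarrow> mpow A N L r s = mpow B N L r s" for r s
    by (induction L arbitrary: r) (auto simp: assms intro!: sum.cong)
  then show ?thesis by (simp add: mtrace_def)
qed

lemma real_count_le:
  fixes n :: nat
  assumes "a * n ^ l \<le> 2 ^ k * n ^ k"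
  shows "real a * real n ^ l \<le> 2 ^ k * real n ^ k"
proof -
  have "real (a * n ^ l) \<le> real (2 ^ k * n ^ k)" using assms by (simp only: of_nat_le_iff)
  then show ?thesis by simp
qed

lemma sum_mult_add_const:
  fixes q :: real
  shows "(\<Sum>x\<in>A. f x * (g x + q)) = (\<Sum>x\<in>A. f x * g x) + q * (\<Sum>x\<in>A. f x)"
  by (simp add: distrib_left sum.distrib sum_distrib_left mult.commute)

text \<open>The weight is 1 for a variable already met and q for a new one. Bounding it by the sum
  separates the two contributions to a row sum.\<close>

lemma weight_split:
  fixes q :: real
  assumes "0 \<le> q"
  shows "q ^ card ({C} - S) \<le> of_bool (C \<in> S) + q"
  using assms by (auto simp: insert_Diff_if)

text \<open>Clauses already met number at most b, and each adds at most 4 n^2 to a row. For new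
  clauses, a fraction of at most 1/n has a given variable in a given position, so the first terms
  add at most 2 n and the constant -2 adds another 2 n per clause on average; the total weight of
  all clauses is at most n.\<close>

lemma row_bound_G:
  fixes q :: real
  assumes n: "n > 0" and k: "k \<ge> 2" and r: "r < n" and S: "finite S" "card S \<le> b"
    and q: "0 \<le> q" "q * (2 ^ k * real n ^ k) \<le> real n"
  shows "(\<Sum>r'<n. \<Sum>C<2 ^ k * n ^ k. \<bar>coefG n r C r'\<bar> * q ^ card (set [C] - S)) \<le> 4 * (real n)\<^sup>2 * (1 + real b)"
proof -
  let ?D = "2 ^ k * n ^ k"
  let ?i = "\<lambda>C. of_bool (blk n 0 1 C = r) + of_bool (blk n 1 1 C = r) :: real"
  have row: "(\<Sum>r'<n. \<bar>coefG n r C r'\<bar>) \<le> (real n)\<^sup>2 * ?i C + 2 * n" for C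
  proof -
    have "(\<Sum>r'<n. \<bar>coefG n r C r'\<bar>) \<le> (\<Sum>r'<n. of_bool (blk n 1 1 C = r') * ((real n)\<^sup>2 * of_bool (blk n 0 1 C = r)) +
        of_bool (blk n 0 1 C = r') * ((real n)\<^sup>2 * of_bool (blk n 1 1 C = r)) + 2)"
    proof (rule sum_mono)
      fix r'
      let ?x = "of_bool (blk n 1 1 C = r') * ((real n)\<^sup>2 * of_bool (blk n 0 1 C = r))"
      let ?y = "of_bool (blk n 0 1 C = r') * ((real n)\<^sup>2 * of_bool (blk n 1 1 C = r))"
      have "coefG n r C r' = ?x + ?y - 2" by (simp only: coefG_def of_bool_conj distrib_left mult_ac)
      moreover have "0 \<le> ?x" "0 \<le> ?y" by simp_all
      ultimately show "\<bar>coefG n r C r'\<bar> \<le> ?x + ?y + 2" by linarith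
    qed
    also have "\<dots> = (real n)\<^sup>2 * of_bool (blk n 0 1 C = r) + (real n)\<^sup>2 * of_bool (blk n 1 1 C = r) + 2 * n"
      using blk_less[OF n, of 0 1 C] blk_less[OF n, of 1 1 C]
      unfolding sum.distrib by (subst (1 2) sum_of_bool_eq) auto
    finally show ?thesis by (simp add: distrib_left)
  qed
  have i2: "(real n)\<^sup>2 * ?i C + 2 * n \<le> 4 * (real n)\<^sup>2" for C
  proof -
    have "(real n)\<^sup>2 * ?i C \<le> (real n)\<^sup>2 * 2" by (intro mult_left_mono) auto
    moreover have "real n * 1 \<le> real n * real n" using n by (intro mult_left_mono) auto
    ultimately show ?thesis by (simp add: power2_eq_square)
  qed
  have cnt: "(\<Sum>C<?D. of_bool (blk n i 1 C = r)) * real n \<le> 2 ^ k * real n ^ k" if "i + 1 \<le> k" for i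
    using real_count_le[OF card_one_block[OF that n, of r]]
    unfolding sum_of_bool_card[OF finite_lessThan] lessThan_iff power_one_right .
  have "(\<Sum>r'<n. \<Sum>C<?D. \<bar>coefG n r C r'\<bar> * q ^ card (set [C] - S)) \<le>
      (\<Sum>r'<n. \<Sum>C<?D. \<bar>coefG n r C r'\<bar> * (of_bool (C \<in> S) + q))"
    unfolding list.set by (intro sum_mono mult_left_mono weight_split[OF q(1)] abs_ge_zero)
  also have "\<dots> = (\<Sum>C<?D. (\<Sum>r'<n. \<bar>coefG n r C r'\<bar>) * (of_bool (C \<in> S) + q))"
    unfolding sum_distrib_right by (rule sum.swap)
  also have "\<dots> \<le> (\<Sum>C<?D. ((real n)\<^sup>2 * ?i C + 2 * n) * (of_bool (C \<in> S) + q))"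
    using row q by (intro sum_mono mult_right_mono) auto
  also have "\<dots> = (\<Sum>C<?D. ((real n)\<^sup>2 * ?i C + 2 * n) * of_bool (C \<in> S)) + q * (\<Sum>C<?D. (real n)\<^sup>2 * ?i C + 2 * n)"
    by (rule sum_mult_add_const)
  also have "\<dots> \<le> (\<Sum>C<?D. 4 * (real n)\<^sup>2 * of_bool (C \<in> S)) + 4 * (real n)\<^sup>2"
  proof (rule add_mono)
    show "(\<Sum>C<?D. ((real n)\<^sup>2 * ?i C + 2 * n) * of_bool (C \<in> S)) \<le> (\<Sum>C<?D. 4 * (real n)\<^sup>2 * of_bool (C \<in> S))"
      using i2 by (intro sum_mono mult_right_mono) auto
    let ?a = "\<Sum>C<?D. of_bool (blk n 0 1 C = r) :: real" and ?b = "\<Sum>C<?D. of_bool (blk n 1 1 C = r) :: real"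
    let ?m = "2 ^ k * real n ^ k"
    have e: "(\<Sum>C<?D. (real n)\<^sup>2 * ?i C + 2 * n) = (real n)\<^sup>2 * ?a + (real n)\<^sup>2 * ?b + real ?D * (2 * real n)"
      by (simp only: sum.distrib distrib_left sum_distrib_left sum_constant card_lessThan of_nat_mult of_nat_numeral)
    have "(real n)\<^sup>2 * ?a = real n * (?a * real n)" "(real n)\<^sup>2 * ?b = real n * (?b * real n)"
      by (simp_all only: power2_eq_square mult_ac)
    moreover have "real n * (?a * real n) \<le> real n * ?m" "real n * (?b * real n) \<le> real n * ?m"
      using cnt[of 0] cnt[of 1] k by (intro mult_left_mono; simp)+
    moreover have "real ?D * (2 * real n) = 2 * (real n * ?m)" by simp
    ultimately have "(\<Sum>C<?D. (real n)\<^sup>2 * ?i C + 2 * n) \<le> 4 * real n * ?m" unfolding e by linarith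
    then have "q * (\<Sum>C<?D. (real n)\<^sup>2 * ?i C + 2 * n) \<le> q * (4 * real n * ?m)"
      using q(1) by (intro mult_left_mono)
    also have "\<dots> = 4 * real n * (q * (2 ^ k * real n ^ k))" by (simp only: mult_ac)
    also have "\<dots> \<le> 4 * real n * real n" using q(2) by (intro mult_left_mono) auto
    finally show "q * (\<Sum>C<?D. (real n)\<^sup>2 * ?i C + 2 * n) \<le> 4 * (real n)\<^sup>2" by (simp add: power2_eq_square)
  qed
  also have "(\<Sum>C<?D. 4 * (real n)\<^sup>2 * of_bool (C \<in> S)) \<le> 4 * (real n)\<^sup>2 * b"
  proof -
    have "card {C \<in> {..<?D}. C \<in> S} \<le> card S" using S(1) by (intro card_mono) auto
    then have "real (card {C \<in> {..<?D}. C \<in> S}) \<le> real b" using S(2) by linarith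
    then show ?thesis
      unfolding sum_distrib_left[symmetric] sum_of_bool_card[OF finite_lessThan] by (intro mult_left_mono) auto
  qed
  finally show ?thesis by (simp add: algebra_simps)
qed

text \<open>Expand (I + q)(I' + q), where I and I' indicate membership in S. Two clauses already
  met: at most b^2 pairs. One already met: it fixes the label of the other, whose h-block is fixed
  as well, so the weight of the choices is at most 1. Two new ones: the first has its h-block fixed,
  the second also its label, and (q D)^2 \<le> n^(k-2) with D = 2^k n^k leaves weight at most
  1.\<close>

lemma labelled_pairs_bound:
  fixes q :: real
  assumes n: "n > 0" and k: "k \<ge> 2" and i: "i = 2 \<or> i = 2 + half k"
    and S: "finite S" "card S \<le> b"
    and q: "0 \<le> q" "(q * (2 ^ k * real n ^ k))\<^sup>2 \<le> real n ^ (k - 2)"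
  shows "(\<Sum>C<2 ^ k * n ^ k. \<Sum>C'<2 ^ k * n ^ k.
      of_bool (lab k n C = lab k n C' \<and> blk n i (half k) C = x \<and> blk n i (half k) C' = y) *
      ((of_bool (C \<in> S) + q) * (of_bool (C' \<in> S) + q))) \<le> (1 + real b)\<^sup>2"
proof -
  let ?D = "2 ^ k * n ^ k" let ?h = "half k" let ?s = "par k"
  let ?m = "2 ^ k * real n ^ k"
  let ?B = "blk n i ?h"
  let ?I = "\<lambda>C. of_bool (C \<in> S) :: real"
  have kk: "k = 2 + 2 * ?h + ?s" using half_par[OF k] .
  have n1: "real n > 0" using n by simp
  \<comment> \<open>The bound on q gives the exponent (k - 2)/2 = h + s/2, rounded up here to h +
    s.\<close>
  have qm: "q * ?m \<le> real n ^ (?h + ?s)"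
  proof (rule power2_le_imp_le)
    have "k - 2 = 2 * ?h + ?s" using kk by simp
    then have "k - 2 \<le> (?h + ?s) * 2" by simp
    then have "real n ^ (k - 2) \<le> real n ^ ((?h + ?s) * 2)" using n by (intro power_increasing) auto
    then show "(q * ?m)\<^sup>2 \<le> (real n ^ (?h + ?s))\<^sup>2" using q(2) by (simp only: power_mult)
  qed simp
  have S': "(\<Sum>C<?D. ?I C) \<le> b"
  proof -
    have "card {C \<in> {..<?D}. C \<in> S} \<le> card S" using S(1) by (intro card_mono) auto
    then show ?thesis unfolding sum_of_bool_card[OF finite_lessThan] using S(2) by linarith
  qed
  have S0: "0 \<le> (\<Sum>C<?D. ?I C)" by (intro sum_nonneg) auto
  have cnt2: "q * (\<Sum>C<?D. of_bool (?B C = z \<and> lab k n C = g)) \<le> 1"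
     and cnt2': "(\<Sum>C<?D. of_bool (?B C = z \<and> lab k n C = g)) * real n ^ (?h + ?s) \<le> ?m" for z g
  proof -
    have "card {C. C < 2 ^ k * n ^ k \<and> blk n i ?h C = z \<and> blk n (2 + 2 * ?h) ?s C = g} * n ^ (?h + ?s) \<le> 2 ^ k * n ^ k"
      by (rule card_two_blocks) (use i kk n in auto)
    then show c: "(\<Sum>C<?D. of_bool (?B C = z \<and> lab k n C = g)) * real n ^ (?h + ?s) \<le> ?m"
      unfolding sum_of_bool_card[OF finite_lessThan] lab_def lessThan_iff by (rule real_count_le)
    have "(q * (\<Sum>C<?D. of_bool (?B C = z \<and> lab k n C = g))) * real n ^ (?h + ?s) \<le> q * ?m"
      using mult_left_mono[OF c q(1)] by (simp only: mult.assoc)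
    also have "\<dots> \<le> 1 * real n ^ (?h + ?s)" using qm by simp
    finally show "q * (\<Sum>C<?D. of_bool (?B C = z \<and> lab k n C = g)) \<le> 1"
      using n1 by (simp only: mult_le_cancel_right_pos zero_less_power)
  qed
  have cnt1: "(\<Sum>C<?D. of_bool (?B C = z)) * real n ^ ?h \<le> ?m" for z
  proof -
    have "card {C. C < 2 ^ k * n ^ k \<and> blk n i ?h C = z} * n ^ ?h \<le> 2 ^ k * n ^ k"
      by (rule card_one_block) (use i kk n in auto)
    then show ?thesis
      unfolding sum_of_bool_card[OF finite_lessThan] lessThan_iff by (rule real_count_le)
  qed
  let ?P = "\<lambda>C C'. of_bool (lab k n C = lab k n C' \<and> ?B C = x \<and> ?B C' = y) :: real"
  have T11: "(\<Sum>C<?D. \<Sum>C'<?D. ?P C C' * (?I C * ?I C')) \<le> real b * real b"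
  proof -
    have "(\<Sum>C<?D. \<Sum>C'<?D. ?P C C' * (?I C * ?I C')) \<le> (\<Sum>C<?D. \<Sum>C'<?D. ?I C * ?I C')"
      by (intro sum_mono) auto
    also have "\<dots> = (\<Sum>C<?D. ?I C) * (\<Sum>C<?D. ?I C)" by (simp only: sum_product)
    also have "\<dots> \<le> real b * real b" using S' S0 by (intro mult_mono) auto
    finally show ?thesis .
  qed
  have T10: "(\<Sum>C<?D. \<Sum>C'<?D. ?P C C' * (?I C * q)) \<le> real b"
  proof -
    have "(\<Sum>C<?D. \<Sum>C'<?D. ?P C C' * (?I C * q)) \<le>
        (\<Sum>C<?D. \<Sum>C'<?D. ?I C * (q * of_bool (?B C' = y \<and> lab k n C' = lab k n C)))"
      using q(1) by (intro sum_mono) auto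
    also have "\<dots> = (\<Sum>C<?D. ?I C * (q * (\<Sum>C'<?D. of_bool (?B C' = y \<and> lab k n C' = lab k n C))))"
      by (simp only: sum_distrib_left)
    also have "\<dots> \<le> (\<Sum>C<?D. ?I C * 1)" using cnt2 by (intro sum_mono mult_left_mono) auto
    finally show ?thesis using S' by simp
  qed
  have T01: "(\<Sum>C<?D. \<Sum>C'<?D. ?P C C' * (q * ?I C')) \<le> real b"
  proof -
    have "(\<Sum>C<?D. \<Sum>C'<?D. ?P C C' * (q * ?I C')) = (\<Sum>C'<?D. \<Sum>C<?D. ?P C C' * (q * ?I C'))"
      by (rule sum.swap)
    also have "\<dots> \<le> (\<Sum>C'<?D. \<Sum>C<?D. ?I C' * (q * of_bool (?B C = x \<and> lab k n C = lab k n C')))"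
      using q(1) by (intro sum_mono) auto
    also have "\<dots> = (\<Sum>C'<?D. ?I C' * (q * (\<Sum>C<?D. of_bool (?B C = x \<and> lab k n C = lab k n C'))))"
      by (simp only: sum_distrib_left)
    also have "\<dots> \<le> (\<Sum>C<?D. ?I C * 1)" using cnt2 by (intro sum_mono mult_left_mono) auto
    finally show ?thesis using S' by simp
  qed
  have T00: "(\<Sum>C<?D. \<Sum>C'<?D. ?P C C' * (q * q)) \<le> 1"
  proof -
    let ?u = "\<lambda>C C'. q * q * of_bool (?B C' = y \<and> lab k n C' = lab k n C)"
    let ?Z = "(\<Sum>C<?D. \<Sum>C'<?D. ?P C C' * (q * q))"
    let ?e = "real n ^ ?h * real n ^ (?h + ?s)"
    have "?Z \<le> (\<Sum>C<?D. \<Sum>C'<?D. of_bool (?B C = x) * (?u C C'))"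
      using q(1) by (intro sum_mono) auto
    then have "?Z * ?e \<le> (\<Sum>C<?D. \<Sum>C'<?D. of_bool (?B C = x) * (?u C C')) * ?e"
      by (intro mult_right_mono) auto
    also have "\<dots> = (\<Sum>C<?D. (of_bool (?B C = x) * (q * q) * real n ^ ?h) * ((\<Sum>C'<?D. of_bool (?B C' = y \<and> lab k n C' = lab k n C)) * real n ^ (?h + ?s)))"
      by (simp only: sum_distrib_left sum_distrib_right mult_ac)
    also have "\<dots> \<le> (\<Sum>C<?D. (of_bool (?B C = x) * (q * q) * real n ^ ?h) * ?m)"
      using cnt2' q(1) by (intro sum_mono mult_left_mono) auto
    also have "\<dots> = (q * q * ?m) * ((\<Sum>C<?D. of_bool (?B C = x)) * real n ^ ?h)"
      by (simp only: sum_distrib_left sum_distrib_right mult_ac)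
    also have "\<dots> \<le> (q * q * ?m) * ?m" using cnt1 q(1) by (intro mult_left_mono) auto
    also have "\<dots> = (q * ?m)\<^sup>2" by (simp add: power2_eq_square)
    also have "\<dots> \<le> real n ^ (k - 2)" by (rule q(2))
    also have "k - 2 = ?h + (?h + ?s)" using kk by simp
    finally have "?Z * ?e \<le> 1 * ?e" by (simp add: power_add)
    then show ?thesis using n1 by (simp only: mult_le_cancel_right_pos zero_less_power mult_pos_pos)
  qed
  have "(\<Sum>C<?D. \<Sum>C'<?D. ?P C C' * ((?I C + q) * (?I C' + q))) =
      (\<Sum>C<?D. \<Sum>C'<?D. ?P C C' * (?I C * ?I C')) + (\<Sum>C<?D. \<Sum>C'<?D. ?P C C' * (?I C * q)) +
      ((\<Sum>C<?D. \<Sum>C'<?D. ?P C C' * (q * ?I C')) + (\<Sum>C<?D. \<Sum>C'<?D. ?P C C' * (q * q)))"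
    by (simp only: sum.distrib[symmetric] distrib_left distrib_right add.assoc) (simp only: add_ac)
  also have "\<dots> \<le> (real b * real b + real b) + (real b + 1)" using T11 T10 T01 T00 by (intro add_mono)
  also have "\<dots> = (1 + real b)\<^sup>2" by (simp add: power2_eq_square algebra_simps)
  finally show ?thesis .
qed

text \<open>The coefficient vanishes on equal tuples. Otherwise the clauses are distinct, so the
  weight of the pair factors into those of its members.\<close>

lemma coefP_term_le:
  fixes q :: real
  assumes "0 \<le> q"
  shows "\<bar>coefP k n r C C' r'\<bar> * q ^ card ({C, C'} - S) \<le>
    (of_bool (dst k n C C' = r') * of_bool (src k n C C' = r) + of_bool (src k n C C' = r') * of_bool (dst k n C C' = r)) *
    (of_bool (lab k n C = lab k n C') * ((of_bool (C \<in> S) + q) * (of_bool (C' \<in> S) + q)))"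
    (is "_ \<le> ?i * (?l * ?w)")
proof (cases "C mod n ^ k = C' mod n ^ k")
  case True
  have "0 \<le> ?i * (?l * ?w)" using assms by (intro mult_nonneg_nonneg add_nonneg_nonneg) simp_all
  moreover have "coefP k n r C C' r' = 0" using True by (simp add: coefP_def)
  ultimately show ?thesis by simp
next
  case False
  then have "C \<noteq> C'" by auto
  then have "{C, C'} - S = ({C} - S) \<union> ({C'} - S)" "({C} - S) \<inter> ({C'} - S) = {}" by auto
  then have card: "card ({C, C'} - S) = card ({C} - S) + card ({C'} - S)" by (simp add: card_Un_disjoint)
  have w: "q ^ card ({C, C'} - S) \<le> ?w"
    unfolding card power_add using assms
    by (intro mult_mono weight_split add_nonneg_nonneg zero_le_power) simp_all
  have sg: "\<bar>sg k n C\<bar> = 1" for C using sg_cases[of k n C] by auto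
  have il: "0 \<le> ?i * ?l" by (intro mult_nonneg_nonneg add_nonneg_nonneg) simp_all
  have "coefP k n r C C' r' = (sg k n C * sg k n C') * (?l * ?i)"
    using False by (simp only: coefP_def of_bool_conj mult_ac not_False_eq_True of_bool_eq mult_1)
  then have "\<bar>coefP k n r C C' r'\<bar> = ?i * ?l"
    using abs_of_nonneg[OF il] by (simp only: abs_mult sg mult_1 mult.commute)
  then have "\<bar>coefP k n r C C' r'\<bar> * q ^ card ({C, C'} - S) \<le> (?i * ?l) * ?w"
    using mult_left_mono[OF w il] by simp
  then show ?thesis by (simp only: mult.assoc)
qed

lemma row_bound_P:
  fixes q :: real
  assumes n: "n > 0" and k: "k \<ge> 2" and S: "finite S" "card S \<le> b"
    and q: "0 \<le> q" "(q * (2 ^ k * real n ^ k))\<^sup>2 \<le> real n ^ (k - 2)"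
  shows "(\<Sum>r'<n ^ (2 * half k). \<Sum>e\<in>{..<2 ^ k * n ^ k} \<times> {..<2 ^ k * n ^ k}.
     \<bar>coefP k n r (fst e) (snd e) r'\<bar> * q ^ card (set [fst e, snd e] - S)) \<le> 2 * (1 + real b)\<^sup>2"
proof -
  let ?D = "2 ^ k * n ^ k" let ?N = "n ^ (2 * half k)" let ?h = "half k"
  let ?w = "\<lambda>C C'. (of_bool (C \<in> S) + q) * (of_bool (C' \<in> S) + q)"
  let ?l = "\<lambda>C C'. of_bool (lab k n C = lab k n C') * ?w C C'"
  let ?src = "src k n" and ?dst = "dst k n"
  let ?g = "\<lambda>r' C C'. (of_bool (?dst C C' = r') * of_bool (?src C C' = r) + of_bool (?src C C' = r') * of_bool (?dst C C' = r)) * ?l C C'"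
  \<comment> \<open>The two base-n^h digits of the row index r: a pair with source or target r has
    exactly these as its blocks.\<close>
  let ?x = "r mod n ^ ?h" and ?y = "r div n ^ ?h"
  let ?p = "\<lambda>i C C'. of_bool (lab k n C = lab k n C' \<and> blk n i ?h C = ?x \<and> blk n i ?h C' = ?y) * ?w C C'"
  have w0: "0 \<le> ?w C C'" for C C' using q(1) by (intro mult_nonneg_nonneg add_nonneg_nonneg) simp_all
  have sum_r': "(\<Sum>r'<?N. ?g r' C C')
      = of_bool (?src C C' = r) * ?l C C' + of_bool (?dst C C' = r) * ?l C C'" for C C'
    unfolding distrib_right sum.distrib mult.assoc
    by (subst (1 2) sum_of_bool_eq) (simp_all add: src_less dst_less n)
  have "blk n 2 ?h C = ?x \<and> blk n 2 ?h C' = ?y" if "?src C C' = r" for C C'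
    using that[symmetric] blk_less[OF n, of 2 ?h C] n by (simp add: src_def)
  then have p1: "of_bool (?src C C' = r) * ?l C C' \<le> ?p 2 C C'" for C C'
    using w0[of C C'] by auto
  have "blk n (2 + ?h) ?h C = ?x \<and> blk n (2 + ?h) ?h C' = ?y" if "?dst C C' = r" for C C'
    using that[symmetric] blk_less[OF n, of "2 + ?h" ?h C] n by (simp add: dst_def)
  then have p2: "of_bool (?dst C C' = r) * ?l C C' \<le> ?p (2 + ?h) C C'" for C C'
    using w0[of C C'] by auto
  have "(\<Sum>r'<?N. \<Sum>e\<in>{..<?D} \<times> {..<?D}. \<bar>coefP k n r (fst e) (snd e) r'\<bar> * q ^ card (set [fst e, snd e] - S))
      = (\<Sum>r'<?N. \<Sum>C<?D. \<Sum>C'<?D. \<bar>coefP k n r C C' r'\<bar> * q ^ card ({C, C'} - S))"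
    unfolding sum.cartesian_product by (simp add: case_prod_beta)
  also have "\<dots> \<le> (\<Sum>r'<?N. \<Sum>C<?D. \<Sum>C'<?D. ?g r' C C')"
    by (intro sum_mono coefP_term_le[OF q(1)])
  also have "\<dots> = (\<Sum>C<?D. \<Sum>r'<?N. \<Sum>C'<?D. ?g r' C C')"
    by (rule sum.swap)
  also have "\<dots> = (\<Sum>C<?D. \<Sum>C'<?D. \<Sum>r'<?N. ?g r' C C')"
    by (rule sum.cong[OF refl], rule sum.swap)
  also have "\<dots> = (\<Sum>C<?D. \<Sum>C'<?D. of_bool (?src C C' = r) * ?l C C' + of_bool (?dst C C' = r) * ?l C C')"
    unfolding sum_r' ..
  also have "\<dots> \<le> (\<Sum>C<?D. \<Sum>C'<?D. ?p 2 C C' + ?p (2 + ?h) C C')"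
    by (intro sum_mono add_mono p1 p2)
  also have "\<dots> = (\<Sum>C<?D. \<Sum>C'<?D. ?p 2 C C') + (\<Sum>C<?D. \<Sum>C'<?D. ?p (2 + ?h) C C')"
    by (simp only: sum.distrib)
  also have "\<dots> \<le> (1 + real b)\<^sup>2 + (1 + real b)\<^sup>2"
    by (intro add_mono labelled_pairs_bound[OF n k _ S q]) simp_all
  finally show ?thesis by simp
qed

section \<open>Expected traces and the number of clauses\<close>

definition bit_val :: "(nat \<Rightarrow> bool) \<Rightarrow> nat \<Rightarrow> real" where "bit_val \<omega> C = of_bool (\<omega> C)"

text \<open>Here \<theta> n bounds the expected number of clauses, so at density p / \<theta> there
  are at most n clauses on average, a bounded number per variable. For \<open>matP\<close>, the
  corresponding normalisation is \<theta> n^((k-2)/2) clauses.\<close>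

lemma expectation_trace_matG:
  fixes p \<theta> :: real
  assumes n: "n > 0" and k: "k \<ge> 2" and p: "0 \<le> p" "p \<le> 1" and \<theta>: "1 \<le> \<theta>"
    and le: "p * (2 ^ k * real n ^ k) \<le> \<theta> * real n"
  shows "measure_pmf.expectation (bits (2 ^ k * n ^ k) p) (\<lambda>\<omega>. mtrace (matG k n (bit_val \<omega>)) n (2 * t)) \<le>
    real n * (\<theta> ^ t * (4 * (real n)\<^sup>2 * (1 + 2 * real t)) ^ (2 * t))"
proof -
  let ?D = "2 ^ k * n ^ k"
  interpret random_matrix "bits ?D p" "\<lambda>u \<omega>. of_bool (\<omega> u) - p" "{..<?D}" p \<theta>
    "4 * (real n)\<^sup>2 * (1 + real (2 * t))" "{..<?D}" "\<lambda>C. [C]" "coefG n" n 1 t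
  proof unfold_locales
    fix r :: nat and S :: "nat set" assume "r < n" "finite S" "card S \<le> 2 * t"
    moreover have "0 \<le> p / \<theta>" "p / \<theta> * (2 ^ k * real n ^ k) \<le> real n"
      using p \<theta> le by (simp_all add: divide_simps mult.commute)
    ultimately show "(\<Sum>r'<n. \<Sum>C<?D. \<bar>coefG n r C r'\<bar> * (p / \<theta>) ^ card (set [C] - S)) \<le> 4 * (real n)\<^sup>2 * (1 + real (2 * t))"
      by (intro row_bound_G[OF n k])
  next
    fix us :: "nat list" assume "set us \<subseteq> {..<?D}"
    then show "\<bar>measure_pmf.expectation (bits ?D p) (\<lambda>\<omega>. \<Prod>u\<leftarrow>us. of_bool (\<omega> u) - p)\<bar> \<le>
        (if all_repeated us then p ^ card (set us) else 0)"
      by (rule bits_moment[OF p])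
  qed (use p \<theta> in \<open>auto intro: finite_set_bits\<close>)
  have "mtrace (mat \<omega>) n L = mtrace (matG k n (bit_val \<omega>)) n L" for \<omega> L
  proof (rule mtrace_cong)
    fix r s assume "r < n" "s < n"
    then show "mat \<omega> r s = matG k n (bit_val \<omega>) r s"
      using matG_shift[of r n s k "bit_val \<omega>" p] k by (simp add: mat_def matG_def bit_val_def)
  qed
  then show ?thesis using expectation_trace_le[of "2 * t"] by simp
qed

lemma expectation_trace_matP:
  fixes p \<theta> :: real
  assumes n: "n > 0" and k: "k \<ge> 2" and p: "0 \<le> p" "p \<le> 1" and \<theta>: "1 \<le> \<theta>"
    and le: "(p * (2 ^ k * real n ^ k))\<^sup>2 \<le> \<theta>\<^sup>2 * real n ^ (k - 2)"
  shows "measure_pmf.expectation (bits (2 ^ k * n ^ k) p)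
      (\<lambda>\<omega>. mtrace (matP k n (bit_val \<omega>)) (n ^ (2 * half k)) (2 * t)) \<le>
    real n ^ (2 * half k) * (\<theta> ^ (2 * t) * (2 * (1 + 4 * real t)\<^sup>2) ^ (2 * t))"
proof -
  let ?D = "2 ^ k * n ^ k" let ?N = "n ^ (2 * half k)"
  \<comment> \<open>A closed walk of length 2 t meets 4 t clauses, two per step, so a surviving term
    has at most 2 t distinct ones: the last argument \<open>d\<close> is 2 t.\<close>
  interpret random_matrix "bits ?D p" "\<lambda>u \<omega>. of_bool (\<omega> u) - p" "{..<?D}" p \<theta>
    "2 * (1 + real (2 * (2 * t)))\<^sup>2" "{..<?D} \<times> {..<?D}" "\<lambda>e. [fst e, snd e]"
    "\<lambda>r e r'. coefP k n r (fst e) (snd e) r'" ?N 2 "2 * t"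
  proof unfold_locales
    fix r :: nat and S :: "nat set" assume "r < ?N" "finite S" "card S \<le> 2 * (2 * t)"
    moreover have "0 \<le> p / \<theta>" using p \<theta> by simp
    moreover have "(p / \<theta> * (2 ^ k * real n ^ k))\<^sup>2 \<le> real n ^ (k - 2)"
      using \<theta> le by (simp add: power_mult_distrib power_divide divide_simps mult.commute)
    ultimately show "(\<Sum>r'<?N. \<Sum>e\<in>{..<?D} \<times> {..<?D}. \<bar>coefP k n r (fst e) (snd e) r'\<bar> *
        (p / \<theta>) ^ card (set [fst e, snd e] - S)) \<le> 2 * (1 + real (2 * (2 * t)))\<^sup>2"
      by (intro row_bound_P[OF n k])
  next
    fix us :: "nat list" assume "set us \<subseteq> {..<?D}"
    then show "\<bar>measure_pmf.expectation (bits ?D p) (\<lambda>\<omega>. \<Prod>u\<leftarrow>us. of_bool (\<omega> u) - p)\<bar> \<le>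
        (if all_repeated us then p ^ card (set us) else 0)"
      by (rule bits_moment[OF p])
  qed (use p \<theta> in \<open>auto intro: finite_set_bits\<close>)
  have "mat \<omega> r s = matP k n (bit_val \<omega>) r s" for \<omega> r s
  proof -
    have "mat \<omega> r s = matP k n (\<lambda>C. bit_val \<omega> C - p) r s"
      unfolding mat_def matP_def bit_val_def sum.cartesian_product by (simp add: case_prod_beta)
    also have "\<dots> = matP k n (bit_val \<omega>) r s" by (rule matP_shift[OF k n])
    finally show ?thesis .
  qed
  then have "mat \<omega> = matP k n (bit_val \<omega>)" for \<omega> by (simp add: fun_eq_iff)
  then show ?thesis using expectation_trace_le[of "2 * t"] by simp
qed

lemma weight_variance:
  assumes p: "0 \<le> p" "p \<le> 1"
  shows "measure_pmf.expectation (bits (2 ^ k * n ^ k) p)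
      (\<lambda>\<omega>. (weight k n (bit_val \<omega>) - real (2 ^ k * n ^ k) * p)\<^sup>2) \<le> real (2 ^ k * n ^ k) * p"
proof -
  let ?D = "2 ^ k * n ^ k"
  let ?Y = "\<lambda>u \<omega>. of_bool (\<omega> u) - p"
  have int: "integrable (measure_pmf (bits ?D p)) f" for f :: "_ \<Rightarrow> real"
    by (rule integrable_measure_pmf_finite[OF finite_set_bits])
  have W: "weight k n (bit_val \<omega>) - real ?D * p = (\<Sum>i<?D. ?Y i \<omega>)" for \<omega>
    unfolding weight_def bit_val_def sum_subtractf by simp
  have "(\<lambda>\<omega>. (weight k n (bit_val \<omega>) - real ?D * p)\<^sup>2) = (\<lambda>\<omega>. \<Sum>i<?D. \<Sum>j<?D. ?Y i \<omega> * ?Y j \<omega>)"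
    unfolding W power2_eq_square sum_product ..
  then have "measure_pmf.expectation (bits ?D p) (\<lambda>\<omega>. (weight k n (bit_val \<omega>) - real ?D * p)\<^sup>2) =
      (\<Sum>i<?D. \<Sum>j<?D. measure_pmf.expectation (bits ?D p) (\<lambda>\<omega>. ?Y i \<omega> * ?Y j \<omega>))"
    using int by (simp only: Bochner_Integration.integral_sum)
  also have "\<dots> \<le> (\<Sum>i<?D. \<Sum>j<?D. of_bool (i = j) * p)"
  proof (intro sum_mono)
    fix i j assume "i \<in> {..<?D}" "j \<in> {..<?D}"
    then have "\<bar>measure_pmf.expectation (bits ?D p) (\<lambda>\<omega>. \<Prod>u\<leftarrow>[i, j]. ?Y u \<omega>)\<bar> \<le>
        (if all_repeated [i, j] then p ^ card (set [i, j]) else 0)"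
      by (intro bits_moment[OF p]) simp
    also have "\<dots> = of_bool (i = j) * p" by (auto simp: all_repeated_def)
    finally show "measure_pmf.expectation (bits ?D p) (\<lambda>\<omega>. ?Y i \<omega> * ?Y j \<omega>) \<le> of_bool (i = j) * p"
      by simp
  qed
  also have "\<dots> = (\<Sum>i<?D. p)" by (intro sum.cong refl sum_of_bool_eq) auto
  finally show ?thesis by simp
qed

section \<open>The certifying program\<close>

text \<open>The guard matches the memory, which reads 0 past the input, whereas
  \<open>clause_list k n ! C\<close> is unspecified there.\<close>

definition indic :: "nat \<Rightarrow> nat \<Rightarrow> clause set \<Rightarrow> nat \<Rightarrow> real" where
  "indic k n I C = of_bool (C < 2 ^ k * n ^ k \<and> clause_list k n ! C \<in> I)"

lemma length_encode: "length (encode k n r t I) = 3 + 2 ^ k * n ^ k"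
  by (simp add: encode_def length_clause_list)

lemma encode_memory:
  fixes k n I r t
  defines "M \<equiv> snd (initial_state (encode k n r t I))"
  shows "M 0 = n" "M 1 = nat \<lfloor>2 ^ n * r\<rfloor>" "M 2 = nat \<lfloor>2 ^ n * t\<rfloor>"
    "(\<lambda>C. real (M (3 + C))) = indic k n I"
proof -
  have M: "M i = (if i < 3 + 2 ^ k * n ^ k then encode k n r t I ! i else 0)" for i
    unfolding M_def initial_state_def by (simp add: length_encode)
  show "M 0 = n" "M 1 = nat \<lfloor>2 ^ n * r\<rfloor>" "M 2 = nat \<lfloor>2 ^ n * t\<rfloor>"
    unfolding M by (simp_all add: encode_def numeral_2_eq_2)
  show "(\<lambda>C. real (M (3 + C))) = indic k n I"
  proof
    fix C
    have "encode k n r t I ! (3 + C) = (if clause_list k n ! C \<in> I then 1 else 0)" if "C < 2 ^ k * n ^ k"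
      using that by (simp add: encode_def length_clause_list numeral_3_eq_3)
    then show "real (M (3 + C)) = indic k n I C" unfolding M indic_def by auto
  qed
qed

definition certifier :: "nat \<Rightarrow> nat \<Rightarrow> program" where
  "certifier k t = expression_program (accept_exp k t)"

definition accepts :: "nat \<Rightarrow> nat \<Rightarrow> nat \<Rightarrow> real \<Rightarrow> real \<Rightarrow> (nat \<Rightarrow> real) \<Rightarrow> bool" where
  "accepts k t n r T \<xi> \<longleftrightarrow> accept k t n (nat \<lfloor>2 ^ n * r\<rfloor>) (nat \<lfloor>2 ^ n * T\<rfloor>) \<xi>"

lemma certifier_computes:
  assumes "k \<ge> 1"
  shows "\<exists>d. \<forall>n r T I. n \<ge> 1 \<longrightarrow> (\<exists>u. computes (certifier k t) (encode k n r T I) u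
      (of_bool (accepts k t n r T (indic k n I))) \<and> u \<le> d * input_size (encode k n r T I) ^ d + d)"
proof -
  obtain d where d: "\<forall>ws. ws \<noteq> [] \<and> 0 < ws ! 0 \<and> ws ! 0 \<le> length ws \<longrightarrow>
     (\<exists>u. computes (certifier k t) ws u
            (neval (snd (initial_state ws)) (\<lambda>_. length ws) (accept_exp k t)) \<and> u \<le> d * input_size ws ^ d + d)"
    using expression_program_computes unfolding certifier_def by blast
  have "\<exists>u. computes (certifier k t) (encode k n r T I) u
      (of_bool (accepts k t n r T (indic k n I))) \<and> u \<le> d * input_size (encode k n r T I) ^ d + d"
    if n: "n \<ge> 1" for n r T I
  proof -
    let ?ws = "encode k n r T I"
    have "n \<le> n ^ k" using n assms by (simp add: self_le_power)
    also have "\<dots> \<le> 2 ^ k * n ^ k" by simp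
    finally have "?ws ! 0 \<le> length ?ws" unfolding length_encode by (simp add: encode_def)
    moreover have "?ws \<noteq> []" "0 < ?ws ! 0" using n by (simp_all add: encode_def)
    moreover have "neval (snd (initial_state ?ws)) (\<lambda>_. length ?ws) (accept_exp k t) =
        of_bool (accepts k t n r T (indic k n I))"
      unfolding neval_accept_exp encode_memory accepts_def ..
    ultimately show ?thesis using d by metis
  qed
  then show ?thesis by blast
qed

lemma computes_deterministic: "computes P ws t v \<Longrightarrow> computes P ws u v' \<Longrightarrow> v = v'"
  unfolding computes_def using exec_deterministic by blast

lemma sum_over_instance:
  fixes F :: "clause \<Rightarrow> real"
  assumes "I \<subseteq> clauses k n"
  shows "(\<Sum>C<2 ^ k * n ^ k. indic k n I C * F (clause_list k n ! C)) = (\<Sum>cl\<in>I. F cl)"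
proof -
  have bij: "bij_betw (\<lambda>C. clause_list k n ! C) {..<2 ^ k * n ^ k} (clauses k n)"
    using bij_betw_nth[OF distinct_clause_list refl refl, of k n] by (simp add: length_clause_list set_clause_list)
  have fin: "finite (clauses k n)" unfolding set_clause_list[symmetric] by simp
  have "(\<Sum>C<2 ^ k * n ^ k. indic k n I C * F (clause_list k n ! C)) =
      (\<Sum>C<2 ^ k * n ^ k. (\<lambda>cl. of_bool (cl \<in> I) * F cl) (clause_list k n ! C))"
    by (intro sum.cong refl) (simp add: indic_def)
  also have "\<dots> = (\<Sum>cl\<in>clauses k n. of_bool (cl \<in> I) * F cl)"
    by (rule sum.reindex_bij_betw[OF bij])
  also have "\<dots> = (\<Sum>cl\<in>I. F cl)"
    by (rule sum.mono_neutral_cong_right[OF fin assms]) auto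
  finally show ?thesis .
qed

lemma satisfies_iff:
  assumes "signed_instance k n X \<xi>" "C < 2 ^ k * n ^ k"
    and x: "\<And>v. v < n \<Longrightarrow> X v = real_of_int (x (Suc v))"
  shows "satisfies x (clause_list k n ! C) \<longleftrightarrow> signed_instance.value_at k n X C = sg k n C"
proof -
  interpret signed_instance k n X \<xi> by fact
  have "value_at C = real_of_int (\<Prod>j<k. x (Suc (blk n j 1 C)))"
    unfolding value_at_def of_int_prod using blk_less[OF n0, of _ 1 C]
    by (intro prod.cong refl x) simp
  moreover have "sg k n C = real_of_int (\<Prod>j<k. [1, -1] ! (C div n ^ k div 2 ^ j mod 2))"
    unfolding sg_def of_int_prod
  proof (rule prod.cong[OF refl])
    fix j
    have "b mod 2 = 0 \<or> b mod 2 = 1" for b :: nat by auto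
    then show "1 - 2 * real (C div n ^ k div 2 ^ j mod 2) = real_of_int ([1, -1] ! (C div n ^ k div 2 ^ j mod 2))"
      by (metis (no_types, lifting) One_nat_def diff_zero mult.right_neutral mult_zero_right nth_Cons_0 nth_Cons_Suc
          of_int_1 of_int_minus of_nat_0 of_nat_1 one_add_one diff_add_cancel minus_diff_eq add_diff_cancel_left')
  qed
  moreover have "satisfies x (clause_list k n ! C) \<longleftrightarrow>
      (\<Prod>j<k. x (Suc (blk n j 1 C))) = (\<Prod>j<k. [1, -1] ! (C div n ^ k div 2 ^ j mod 2))"
    unfolding satisfies_def clause_list_nth[OF assms(2)] by simp
  ultimately show ?thesis by (simp only: of_int_eq_iff)
qed

lemma less_nat_floor: "m < nat \<lfloor>y\<rfloor> \<Longrightarrow> real m + 1 \<le> y" for y :: real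
  by (simp add: zless_nat_eq_int_zless less_floor_iff)

text \<open>A 2\<rho>-biased assignment can exist only if 2\<rho> \<le> 1. Then \<eta> \<le>
  \<rho>^k / 2 is at most \<rho>^2 / 8, whereas the certificate forces a \<rho>^2 / 2 fraction of
  violated clauses.\<close>

lemma accepts_sound:
  assumes k: "k \<ge> 4" and n: "n \<ge> 1" and \<rho>: "\<rho> > 0" and \<eta>: "\<eta> \<le> \<rho> ^ k / 2"
    and I: "I \<subseteq> clauses k n" and acc: "accepts k (2 ^ i) n \<rho> (1 - \<eta>) (indic k n I)"
  shows "\<not> (\<exists>x\<in>assignments n. biased n (2 * \<rho>) x \<and> frac_satisfying (1 - \<eta>) I x)"
proof
  assume "\<exists>x\<in>assignments n. biased n (2 * \<rho>) x \<and> frac_satisfying (1 - \<eta>) I x"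
  then obtain x where x: "x \<in> assignments n" "biased n (2 * \<rho>) x" "frac_satisfying (1 - \<eta>) I x" by blast
  \<comment> \<open>Variables shift from 1..n to 0..n-1, and the value 1 past n meets the demand of
    the locale for a sign at every index.\<close>
  define X where "X v = (if v < n then real_of_int (x (Suc v)) else 1)" for v
  have X1: "X v = 1 \<or> X v = -1" for v
  proof (cases "v < n")
    case True
    then have "x (Suc v) \<in> {1, -1}"
      using x(1) unfolding assignments_def by (intro PiE_mem[of x "{1..n}"]) auto
    then show ?thesis using True by (auto simp: X_def)
  qed (simp add: X_def)
  interpret signed_instance k n X "indic k n I"
    by unfold_locales (use k n X1 in \<open>auto simp: indic_def\<close>)
  have sumX: "(\<Sum>v<n. X v) = real_of_int (\<Sum>i=1..n. x i)"
    by (simp add: X_def sum.atLeast1_atMost_eq)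
  have bias: "2 * \<rho> * n \<le> \<bar>\<Sum>v<n. X v\<bar>"
    using x(2) n unfolding biased_def sumX by (simp add: divide_simps mult.commute)
  have "\<bar>\<Sum>v<n. X v\<bar> \<le> (\<Sum>v<n. \<bar>X v\<bar>)" by (rule sum_abs)
  also have "\<dots> = (\<Sum>v<n. 1)" using X1 by (intro sum.cong refl) (metis abs_1 abs_minus_cancel)
  finally have "2 * \<rho> * real n \<le> 1 * real n" using bias by simp
  then have \<rho>2: "2 * \<rho> \<le> 1" by (rule mult_right_le_imp_le) (use n in simp)
  have fin: "finite I" using I finite_subset[OF I] set_clause_list[of k n] by (metis List.finite_set)
  have w: "w = real (card I)"
    using sum_over_instance[OF I, of "\<lambda>_. 1"] by (simp add: weight_def)
  have sat: "real (card {C \<in> I. satisfies x C}) \<ge> (1 - \<eta>) * w" using x(3) by (simp add: frac_satisfying_def w)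
  have "real (card {C \<in> I. satisfies x C}) \<le> w" unfolding w using fin by (simp add: card_mono)
  note sat_le = this
  have R: "real (nat \<lfloor>2 ^ n * \<rho>\<rfloor>) \<le> 2 ^ n * \<rho>" using \<rho> by simp
  from acc show False unfolding accepts_def accept_def
  proof (elim disjE conjE)
    assume "2 ^ n < nat \<lfloor>2 ^ n * \<rho>\<rfloor>"
    then have "2 ^ n * 1 < 2 ^ n * \<rho>"
      using less_nat_floor[of "2 ^ n"] unfolding mult_1_right of_nat_power of_nat_numeral
      by (meson less_add_one order_less_le_trans)
    then have "1 < \<rho>" by (simp only: mult_less_cancel_left_pos zero_less_power zero_less_numeral)
    then show False using \<rho>2 by simp
  next
    assume w1: "1 \<le> w" and "2 ^ n < nat \<lfloor>2 ^ n * (1 - \<eta>)\<rfloor>"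
    then have "2 ^ n * 1 < 2 ^ n * (1 - \<eta>)"
      using less_nat_floor[of "2 ^ n"] unfolding mult_1_right of_nat_power of_nat_numeral
      by (meson less_add_one order_less_le_trans)
    then have "1 < 1 - \<eta>" by (simp only: mult_less_cancel_left_pos zero_less_power zero_less_numeral)
    then have "1 * w < (1 - \<eta>) * w" using w1 by (intro mult_strict_right_mono) auto
    then show False using sat sat_le by simp
  next
    assume w1: "1 \<le> w" and cert: "certificate k (2 ^ i) n (real (nat \<lfloor>2 ^ n * \<rho>\<rfloor>)) (indic k n I)"
    let ?U = "\<Sum>C<D. indic k n I C * of_bool (value_at C \<noteq> sg k n C)"
    have le: "\<rho>\<^sup>2 * w \<le> 2 * ?U" by (rule certificate_sound[OF cert _ R \<rho> bias]) simp
    have "?U = (\<Sum>C<D. indic k n I C * of_bool (\<not> satisfies x (clause_list k n ! C)))"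
      using satisfies_iff[OF signed_instance_axioms, of _ x] by (intro sum.cong refl) (simp add: X_def)
    also have "\<dots> = (\<Sum>cl\<in>I. of_bool (\<not> satisfies x cl))" by (rule sum_over_instance[OF I])
    also have "\<dots> = (\<Sum>cl\<in>I. 1 - of_bool (satisfies x cl))" by (intro sum.cong refl) simp
    also have "\<dots> = w - real (card {C \<in> I. satisfies x C})"
      unfolding sum_subtractf sum_of_bool_card[OF fin] w by simp
    finally have "?U \<le> \<eta> * w" using sat by (simp add: algebra_simps)
    \<comment> \<open>Here k \<ge> 4 is used: \<rho> \<le> 1/2 gives \<rho>^(k-2) \<le> 1/4.\<close>
    also have "\<dots> \<le> \<rho>\<^sup>2 / 8 * w"
    proof (rule mult_right_mono)
      have "k = 2 + (k - 2)" using k by simp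
      then have "\<rho> ^ k = \<rho>\<^sup>2 * \<rho> ^ (k - 2)" by (metis power_add)
      also have "\<rho> ^ (k - 2) \<le> (1 / 2) ^ (k - 2)" using \<rho> \<rho>2 by (intro power_mono) auto
      also have "(1 / 2 :: real) ^ (k - 2) \<le> (1 / 2) ^ 2" using k by (intro power_decreasing) auto
      finally have "\<rho> ^ k \<le> \<rho>\<^sup>2 * (1 / 2) ^ 2" by (simp add: mult_left_mono)
      then show "\<eta> \<le> \<rho>\<^sup>2 / 8" using \<eta> by (simp add: power2_eq_square)
    qed (use w1 in simp)
    finally have "\<rho>\<^sup>2 * w \<le> 2 * (\<rho>\<^sup>2 / 8 * w)" using le by linarith
    moreover have "\<rho>\<^sup>2 * w > 0" using \<rho> w1 by simp
    ultimately show False by simp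
  qed
qed

section \<open>The random instance as a vector of independent bits\<close>

lemma random_instance_bits:
  assumes "k \<ge> 1"
  shows "random_instance k m n = map_pmf (\<lambda>\<omega>. {clause_list k n ! i |i. i < 2 ^ k * n ^ k \<and> \<omega> i})
     (bits (2 ^ k * n ^ k) (m / (2 ^ k * real n ^ k)))"
proof -
  let ?D = "2 ^ k * n ^ k" let ?p = "m / (2 ^ k * real n ^ k)"
  \<comment> \<open>The reindexing of a product distribution needs a map that sends positions
    outside the list to non-clauses; \<open>([], [])\<close> is none because k \<ge> 1.\<close>
  define f where "f i = (if i < ?D then clause_list k n ! i else ([], []))" for i
  have "bij_betw (\<lambda>C. clause_list k n ! C) {..<?D} (clauses k n)"
    using bij_betw_nth[OF distinct_clause_list refl refl, of k n] by (simp add: length_clause_list set_clause_list)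
  then have bij: "bij_betw f {..<?D} (clauses k n)"
    by (rule bij_betw_cong[THEN iffD1, rotated]) (simp add: f_def)
  have "bits ?D ?p = map_pmf (\<lambda>g. g \<circ> f) (Pi_pmf (clauses k n) False (\<lambda>_. bernoulli_pmf ?p))"
    unfolding bits_def using assms
    by (intro Pi_pmf_bij_betw bij) (auto simp: f_def clauses_def)
  moreover have "{C \<in> clauses k n. g C} = {clause_list k n ! i |i. i < ?D \<and> (g \<circ> f) i}" for g
  proof -
    have "clauses k n = f ` {..<?D}" using bij by (simp add: bij_betw_def)
    then have "{C \<in> clauses k n. g C} = {f i |i. i < ?D \<and> g (f i)}" by auto
    also have "\<dots> = {clause_list k n ! i |i. i < ?D \<and> (g \<circ> f) i}"
      by (rule Collect_cong) (auto simp: f_def)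
    finally show ?thesis .
  qed
  ultimately show ?thesis by (simp add: random_instance_def map_pmf_comp)
qed

lemma indic_bits:
  assumes "\<omega> \<in> set_pmf (bits (2 ^ k * n ^ k) p)"
  shows "indic k n {clause_list k n ! i |i. i < 2 ^ k * n ^ k \<and> \<omega> i} = bit_val \<omega>"
proof
  fix C
  have "set_pmf (bits (2 ^ k * n ^ k) p) \<subseteq> {f. \<forall>x. x \<notin> {..<2 ^ k * n ^ k} \<longrightarrow> f x = False}"
    unfolding bits_def by (rule set_Pi_pmf_subset) simp
  then have out: "\<not> C < 2 ^ k * n ^ k \<Longrightarrow> \<not> \<omega> C" using assms by auto
  have "clause_list k n ! i = clause_list k n ! j \<longleftrightarrow> i = j" if "i < 2 ^ k * n ^ k" "j < 2 ^ k * n ^ k" for i j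
    using that nth_eq_iff_index_eq[OF distinct_clause_list] by (simp add: length_clause_list)
  then show "indic k n {clause_list k n ! i |i. i < 2 ^ k * n ^ k \<and> \<omega> i} C = bit_val \<omega> C"
    using out by (cases "C < 2 ^ k * n ^ k") (auto simp: indic_def bit_val_def)
qed

section \<open>The certificate exists with high probability\<close>

lemma prob_computes:
  assumes "k \<ge> 1" "n \<ge> 1"
  shows "measure_pmf.prob (random_instance k m n) {I. \<exists>u. computes (certifier k t) (encode k n r T I) u 1} =
    measure_pmf.prob (bits (2 ^ k * n ^ k) (m / (2 ^ k * real n ^ k))) {\<omega>. accepts k t n r T (bit_val \<omega>)}"
proof -
  let ?Q = "bits (2 ^ k * n ^ k) (m / (2 ^ k * real n ^ k))"
  let ?I = "\<lambda>\<omega>. {clause_list k n ! i |i. i < 2 ^ k * n ^ k \<and> \<omega> i}"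
  have iff: "(\<exists>u. computes (certifier k t) (encode k n r T I) u 1) \<longleftrightarrow> accepts k t n r T (indic k n I)" for I
  proof -
    obtain u where "computes (certifier k t) (encode k n r T I) u (of_bool (accepts k t n r T (indic k n I)))"
      using certifier_computes[OF assms(1), of t] assms(2) by blast
    then show ?thesis
      using computes_deterministic by (metis of_bool_eq(1,2) zero_neq_one)
  qed
  have "measure_pmf.prob (random_instance k m n) {I. \<exists>u. computes (certifier k t) (encode k n r T I) u 1} =
      measure_pmf.prob ?Q {\<omega>. accepts k t n r T (indic k n (?I \<omega>))}"
    unfolding iff random_instance_bits[OF assms(1)] measure_map_pmf by (simp add: vimage_def)
  \<comment> \<open>Restricting to the support is needed because \<open>\<omega>\<close> agrees with
    the indicator of its instance only if it is false past the last position.\<close>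
  also have "\<dots> = measure_pmf.prob ?Q ({\<omega>. accepts k t n r T (indic k n (?I \<omega>))} \<inter> set_pmf ?Q)"
    by (rule measure_Int_set_pmf[symmetric])
  also have "{\<omega>. accepts k t n r T (indic k n (?I \<omega>))} \<inter> set_pmf ?Q = {\<omega>. accepts k t n r T (bit_val \<omega>)} \<inter> set_pmf ?Q"
    using indic_bits by auto
  also have "measure_pmf.prob ?Q \<dots> = measure_pmf.prob ?Q {\<omega>. accepts k t n r T (bit_val \<omega>)}"
    by (rule measure_Int_set_pmf)
  finally show ?thesis .
qed

definition boundG :: "nat \<Rightarrow> nat \<Rightarrow> real \<Rightarrow> real" where
  "boundG t n \<theta> = real n * (\<theta> ^ t * (4 * (real n)\<^sup>2 * (1 + 2 * real t)) ^ (2 * t))"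

definition boundP :: "nat \<Rightarrow> nat \<Rightarrow> nat \<Rightarrow> real \<Rightarrow> real" where
  "boundP k t n \<theta> = real n ^ (2 * half k) * (\<theta> ^ (2 * t) * (2 * (1 + 4 * real t)\<^sup>2) ^ (2 * t))"

lemma markov_bits:
  assumes "measure_pmf.expectation (bits D p) f \<le> B" "\<And>\<omega>. 0 \<le> f \<omega>" "c > 0"
  shows "measure_pmf.prob (bits D p) {\<omega>. c \<le> f \<omega>} \<le> B / c"
proof -
  have "measure_pmf.prob (bits D p) {\<omega>. c \<le> f \<omega>} \<le> measure_pmf.expectation (bits D p) f / c"
    using integral_Markov_inequality_measure[of "measure_pmf (bits D p)" f "{}" c] assms(2,3)
    by (simp add: integrable_measure_pmf_finite finite_set_bits)
  also have "\<dots> \<le> B / c" using assms by (intro divide_right_mono) auto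
  finally show ?thesis .
qed

text \<open>Chebyshev at deviation m/2 costs 4/m \<le> 4/n for the number of clauses. Markov with a
  factor n costs 1/n for each trace; such a factor is affordable given the polynomial slack. The
  \<theta> of \<open>matG\<close> is m/n, the mean number of clauses per variable.\<close>

lemma good_probability:
  fixes m \<theta> :: real
  assumes k: "k \<ge> 2" and n: "n \<ge> 1" and p: "m \<le> real n ^ k" and m: "real n \<le> m"
    and \<theta>: "1 \<le> \<theta>" "m\<^sup>2 \<le> \<theta>\<^sup>2 * real n ^ (k - 2)"
  shows "measure_pmf.prob (bits (2 ^ k * n ^ k) (m / (2 ^ k * real n ^ k)))
    {\<omega>. m / 2 \<le> weight k n (bit_val \<omega>) \<and> mtrace (matG k n (bit_val \<omega>)) n (2 * t) \<le> n * boundG t n (m / n) \<and>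
      mtrace (matP k n (bit_val \<omega>)) (n ^ (2 * half k)) (2 * t) \<le> n * boundP k t n \<theta>} \<ge> 1 - 6 / real n"
proof -
  let ?D = "2 ^ k * n ^ k" and ?m = "2 ^ k * real n ^ k"
  let ?p = "m / ?m"
  let ?Q = "bits ?D ?p"
  let ?w = "\<lambda>\<omega>. weight k n (bit_val \<omega>)"
  let ?G = "\<lambda>\<omega>. mtrace (matG k n (bit_val \<omega>)) n (2 * t)"
  let ?P = "\<lambda>\<omega>. mtrace (matP k n (bit_val \<omega>)) (n ^ (2 * half k)) (2 * t)"
  have n0: "n > 0" "real n > 0" using n by simp_all
  have m0: "0 < m" using m n0 by linarith
  have mm: "?m > 0" using n0 by simp
  have "1 * m \<le> 2 ^ k * real n ^ k" using p m0 by (intro mult_mono) auto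
  then have p01: "0 \<le> ?p" "?p \<le> 1" using m0 mm by simp_all
  have pm: "?p * ?m = m" using n0 by simp
  have pD: "real ?D * ?p = m" using n0 by simp
  have \<theta>G: "1 \<le> m / n" using m n0 by simp
  have BG: "boundG t n (m / n) > 0" unfolding boundG_def using n0 m0 by simp
  have BP: "boundP k t n \<theta> > 0" unfolding boundP_def using n0 \<theta> by (auto intro!: mult_pos_pos zero_less_power add_pos_nonneg)
  let ?A = "{\<omega>. m\<^sup>2 / 4 \<le> (?w \<omega> - real ?D * ?p)\<^sup>2}"
  let ?B = "{\<omega>. real n * boundG t n (m / n) \<le> ?G \<omega>}"
  let ?C = "{\<omega>. real n * boundP k t n \<theta> \<le> ?P \<omega>}"
  have A: "measure_pmf.prob ?Q ?A \<le> m / (m\<^sup>2 / 4)"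
    using weight_variance[OF p01, of k n] m0 unfolding pD by (intro markov_bits) auto
  have "m / (m\<^sup>2 / 4) = 4 / m" using m0 by (simp add: power2_eq_square)
  also have "\<dots> \<le> 4 / n" using m n0 m0 by (intro divide_left_mono) auto
  finally have A': "measure_pmf.prob ?Q ?A \<le> 4 / n" using A by linarith
  have "measure_pmf.prob ?Q ?B \<le> boundG t n (m / n) / (real n * boundG t n (m / n))"
  proof (rule markov_bits)
    show "measure_pmf.expectation ?Q ?G \<le> boundG t n (m / n)"
      unfolding boundG_def by (rule expectation_trace_matG[OF n0(1) k p01 \<theta>G]) (use pm n0 in simp)
  qed (use mtrace_nonneg matG_sym BG n0 in auto)
  then have B': "measure_pmf.prob ?Q ?B \<le> 1 / n" using BG by simp
  have "measure_pmf.prob ?Q ?C \<le> boundP k t n \<theta> / (real n * boundP k t n \<theta>)"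
  proof (rule markov_bits)
    show "measure_pmf.expectation ?Q ?P \<le> boundP k t n \<theta>"
      unfolding boundP_def by (rule expectation_trace_matP[OF n0(1) k p01 \<theta>(1)]) (use pm \<theta> in simp)
  qed (use mtrace_nonneg matP_sym BP n0 in auto)
  then have C': "measure_pmf.prob ?Q ?C \<le> 1 / n" using BP by simp
  let ?good = "{\<omega>. m / 2 \<le> ?w \<omega> \<and> ?G \<omega> \<le> n * boundG t n (m / n) \<and> ?P \<omega> \<le> n * boundP k t n \<theta>}"
  have "- ?good \<subseteq> ?A \<union> (?B \<union> ?C)"
  proof
    fix \<omega> assume "\<omega> \<in> - ?good"
    moreover have "m\<^sup>2 / 4 \<le> (?w \<omega> - m)\<^sup>2" if "?w \<omega> < m / 2"
    proof -
      have "(m / 2)\<^sup>2 \<le> (m - ?w \<omega>)\<^sup>2" using that m0 by (intro power_mono) auto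
      then show ?thesis by (simp add: power_divide power2_commute)
    qed
    ultimately show "\<omega> \<in> ?A \<union> (?B \<union> ?C)" unfolding pD by auto
  qed
  then have "measure_pmf.prob ?Q (- ?good) \<le> measure_pmf.prob ?Q (?A \<union> (?B \<union> ?C))"
    by (intro measure_pmf.finite_measure_mono) auto
  also have "\<dots> \<le> measure_pmf.prob ?Q ?A + (measure_pmf.prob ?Q ?B + measure_pmf.prob ?Q ?C)"
    by (intro order_trans[OF measure_Un_le] add_left_mono measure_Un_le) auto
  also have "\<dots> \<le> 4 / n + (1 / n + 1 / n)" using A' B' C' by (intro add_mono)
  finally have "measure_pmf.prob ?Q (- ?good) \<le> 6 / n" by simp
  moreover have "measure_pmf.prob ?Q (- ?good) = 1 - measure_pmf.prob ?Q ?good"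
    using measure_pmf.prob_compl[of ?good ?Q] by (simp add: Compl_eq_Diff_UNIV)
  ultimately show ?thesis by simp
qed

lemma m_facts:
  fixes \<beta> :: real
  assumes k: "k \<ge> 4" and \<beta>: "\<beta> > 0" and n: "n \<ge> 1"
  defines "m \<equiv> real n powr ((real k - 2) / 2 + \<beta>)" and "b \<equiv> real n powr \<beta>"
  shows "m\<^sup>2 = b\<^sup>2 * real n ^ (k - 2)" "b \<le> m / n" "real n ^ par k * b \<le> m" "1 \<le> b" "real n \<le> m" "m > 0"
proof -
  have n1: "1 \<le> real n" using n by simp
  have "m\<^sup>2 = real n powr (real 2 * ((real k - 2) / 2 + \<beta>))"
    unfolding m_def using n1 by (simp add: powr_power mult.commute)
  also have "real 2 * ((real k - 2) / 2 + \<beta>) = (\<beta> + \<beta>) + real (k - 2)" using k by (simp add: of_nat_diff)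
  also have "real n powr ((\<beta> + \<beta>) + real (k - 2)) = (b * b) * real n ^ (k - 2)"
    unfolding b_def using n1 by (simp only: powr_add) (simp add: powr_realpow)
  finally show "m\<^sup>2 = b\<^sup>2 * real n ^ (k - 2)" by (simp only: power2_eq_square)
  have "m / n = real n powr ((real k - 2) / 2 + \<beta> - 1)" unfolding m_def using n1 by (simp add: powr_diff)
  moreover have "b \<le> real n powr ((real k - 2) / 2 + \<beta> - 1)"
    unfolding b_def using n1 k by (intro powr_mono) (auto simp: field_simps)
  ultimately show bm: "b \<le> m / n" by simp
  have "real (par k) \<le> (real k - 2) / 2"
  proof (cases "even k")
    case True then show ?thesis using k by (simp add: par_def)
  next
    case False
    \<comment> \<open>An odd k is at least 5, and then the single label variable satisfies 1 \<le>
      (k - 2)/2.\<close>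
    then have "k \<noteq> 4" by auto
    then have "k \<ge> 5" using k by simp
    then show ?thesis using False by (simp add: par_def odd_iff_mod_2_eq_one)
  qed
  then have "real n powr (real (par k) + \<beta>) \<le> m" unfolding m_def using n1 by (intro powr_mono) auto
  then show "real n ^ par k * b \<le> m" unfolding b_def using n1 by (simp add: powr_add powr_realpow)
  show b1: "1 \<le> b" unfolding b_def using n1 \<beta> by (intro ge_one_powr_ge_zero) auto
  have "1 \<le> m / n" using b1 bm by linarith
  then show "real n \<le> m" using n1 by (simp add: field_simps)
  then show "m > 0" using n1 by linarith
qed

text \<open>The slack is x. Its power x^t \<ge> n^(k + 2) pays for all factors outside the t-th
  powers: the matrix size, the factor n from Markov's inequality, and one more n that absorbs the
  constants depending on t. The constants 64 and 16384 leave room for the factor 2 lost in rounding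
  \<rho> and the factor 2 lost in the number of clauses.\<close>

lemma certificate_holds:
  fixes \<beta> \<rho> R :: real and n t :: nat
  assumes k: "k \<ge> 4" and \<beta>: "\<beta> > 0" and n: "n \<ge> 1" and \<rho>: "\<rho> > 0"
    and x: "x \<ge> 2 ^ (k + 6)" "real n ^ (k + 2) \<le> x ^ t" "x \<le> \<rho> ^ 4 * real n powr \<beta>"
    and c1: "(64 * (1 + 2 * real t)\<^sup>2) ^ t \<le> n" and c3: "(16384 * (1 + 4 * real t) ^ 4) ^ t \<le> n"
    and R: "2 ^ n * \<rho> / 2 \<le> R"
    and m: "m = real n powr ((real k - 2) / 2 + \<beta>)"
    and w: "m / 2 \<le> weight k n \<xi>"
    and G: "mtrace (matG k n \<xi>) n (2 * t) \<le> n * boundG t n (m / n)"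
    and P: "mtrace (matP k n \<xi>) (n ^ (2 * half k)) (2 * t) \<le> n * boundP k t n (real n powr \<beta>)"
  shows "certificate k t n R \<xi>"
proof -
  define b where "b = real n powr \<beta>"
  let ?e = "(2::real) ^ n" let ?w = "weight k n \<xi>"
  note mf = m_facts[OF k \<beta> n, folded m b_def]
  have n1: "1 \<le> real n" using n by simp
  have e: "?e > 0" by simp
  have x1: "1 \<le> x" using x(1) one_le_power[of "2::real" "k + 6"] by linarith
  have \<rho>b: "x \<le> \<rho> ^ 4 * b" using x(3) unfolding b_def .
  have w0: "0 < ?w" using w mf(6) by linarith
  have R0: "0 < ?e * \<rho> / 2" using \<rho> by simp
  have R2: "(?e * \<rho> / 2)\<^sup>2 \<le> R\<^sup>2" and R4: "(?e * \<rho> / 2) ^ 4 \<le> R ^ 4"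
    using R R0 by (intro power_mono; linarith)+
  have hk: "2 * half k \<le> k" using half_par[of k] k by linarith
  show ?thesis unfolding certificate_def
  proof (intro conjI)
    let ?S = "mtrace (matG k n \<xi>) n (2 * t) * ?e ^ (4 * t)"
    \<comment> \<open>Chosen such that \<rho>^4 (m / n) times \<open>?A\<close> is the square of n m
      \<rho>^2 / 2, the right-hand side for weight m/2 and R = 2^n \<rho> / 2 without its power of
      2^n.\<close>
    let ?A = "(m / n) * real n ^ 4 / 4"
    have A0: "0 \<le> ?A" using mf(6) by simp
    have "n * boundG t n (m / n) = (real n)\<^sup>2 * ((m / n) * (4 * (real n)\<^sup>2 * (1 + 2 * real t))\<^sup>2) ^ t"
      unfolding boundG_def power_mult power_mult_distrib[of "m / n"] by (simp only: power2_eq_square mult_ac)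
    also have "(m / n) * (4 * (real n)\<^sup>2 * (1 + 2 * real t))\<^sup>2 = (64 * (1 + 2 * real t)\<^sup>2) * ?A"
      by (simp add: power_mult_distrib power_mult[symmetric])
    also have "(real n)\<^sup>2 * ((64 * (1 + 2 * real t)\<^sup>2) * ?A) ^ t = (real n)\<^sup>2 * (64 * (1 + 2 * real t)\<^sup>2) ^ t * ?A ^ t"
      by (simp only: power_mult_distrib mult.assoc)
    also have "\<dots> \<le> ((real n)\<^sup>2 * real n) * ?A ^ t"
      using c1 A0 by (intro mult_right_mono mult_left_mono) auto
    also have "(real n)\<^sup>2 * real n = real n ^ 3" by (simp add: power2_eq_square power3_eq_cube)
    also have "real n ^ 3 * ?A ^ t \<le> real n ^ (k + 2) * ?A ^ t"
      using n1 A0 k by (intro mult_right_mono power_increasing) auto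
    also have "\<dots> \<le> x ^ t * ?A ^ t" using x(2) A0 by (intro mult_right_mono) auto
    also have "\<dots> \<le> (\<rho> ^ 4 * (m / n)) ^ t * ?A ^ t"
    proof (intro mult_right_mono power_mono)
      have "\<rho> ^ 4 * b \<le> \<rho> ^ 4 * (m / n)" using mf(2) by (intro mult_left_mono) auto
      then show "x \<le> \<rho> ^ 4 * (m / n)" using \<rho>b by linarith
    qed (use x1 A0 in auto)
    also have "\<dots> = ((\<rho> ^ 4 * (m / n)) * ?A) ^ t" by (simp only: power_mult_distrib)
    also have "(\<rho> ^ 4 * (m / n)) * ?A = (n * m * \<rho>\<^sup>2 / 2)\<^sup>2"
      using n1 by (simp add: power_mult_distrib power_divide field_simps flip: power_mult)
        (simp add: power2_eq_square power4_eq_xxxx mult_ac)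
    finally have "?S \<le> ((n * m * \<rho>\<^sup>2 / 2)\<^sup>2) ^ t * ?e ^ (4 * t)"
      using G by (intro mult_right_mono) auto
    also have "\<dots> = (4 * real n * (m / 2) * (?e * \<rho> / 2)\<^sup>2) ^ (2 * t)"
    proof -
      have "4 * real n * (m / 2) * (?e * \<rho> / 2)\<^sup>2 = (n * m * \<rho>\<^sup>2 / 2) * ?e\<^sup>2"
        by (simp add: power_mult_distrib power_divide)
      then show ?thesis by (simp only: power_mult_distrib power_mult[symmetric]) simp
    qed
    also have "\<dots> \<le> (4 * real n * ?w * R\<^sup>2) ^ (2 * t)"
    proof (rule power_mono)
      have "4 * real n * (m / 2) \<le> 4 * real n * ?w" using w by (intro mult_left_mono) auto
      then show "4 * real n * (m / 2) * (?e * \<rho> / 2)\<^sup>2 \<le> 4 * real n * ?w * R\<^sup>2"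
        using w0 by (intro mult_mono[OF _ R2]) auto
    qed (use mf(6) in simp)
    finally show "?S \<le> (4 * real n * ?w * R\<^sup>2) ^ (2 * t)" .
  next
    \<comment> \<open>2^(k + 6) = 2^(k + 1) * 2^4 * 2, where 2^4 is lost in the fourth power of R
      and 2 in the weight.\<close>
    have "real n ^ par k * 2 ^ (k + 6) \<le> real n ^ par k * (\<rho> ^ 4 * b)"
      using x(1) \<rho>b by (intro mult_left_mono) auto
    also have "\<dots> = \<rho> ^ 4 * (real n ^ par k * b)" by simp
    also have "\<dots> \<le> \<rho> ^ 4 * m" using mf(3) by (intro mult_left_mono) auto
    finally have "real n ^ par k * 2 ^ (k + 6) * ?e ^ 4 \<le> \<rho> ^ 4 * m * ?e ^ 4" by (rule mult_right_mono) simp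
    then have "real n ^ par k * 2 ^ (k + 1) * ?e ^ 4 \<le> (?e * \<rho> / 2) ^ 4 * (m / 2)"
      by (simp add: power_add power_mult_distrib power_divide)
    also have "\<dots> \<le> R ^ 4 * ?w" by (rule mult_mono[OF R4 w]) (use mf(6) in auto)
    finally show "real n ^ par k * 2 ^ (k + 1) * ?e ^ 4 \<le> R ^ 4 * ?w" .
  next
    let ?T = "mtrace (matP k n \<xi>) (n ^ (2 * half k)) (2 * t) * real n ^ (2 * t * (k - 2))"
    let ?M = "real n ^ (k - 2)"
    \<comment> \<open>4096 = 64^2, and 64 is what (2^n \<rho> / 2)^4 (m / 2)^2 loses against the
      same product without the halvings.\<close>
    let ?A = "b\<^sup>2 * ?M\<^sup>2 / 4096"
    have A0: "0 \<le> ?A" by simp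
    have Mt: "real n ^ (2 * t * (k - 2)) = (?M\<^sup>2) ^ t"
      by (simp add: power_mult[symmetric] mult_ac)
    have "n * boundP k t n b * real n ^ (2 * t * (k - 2)) =
        real n ^ (2 * half k + 1) * (b\<^sup>2 * (2 * (1 + 4 * real t)\<^sup>2)\<^sup>2 * ?M\<^sup>2) ^ t"
      unfolding boundP_def Mt power_mult[of b] power_mult[of "2 * (1 + 4 * real t)\<^sup>2"]
      by (simp only: power_mult_distrib power_add power_one_right mult_ac)
    also have "b\<^sup>2 * (2 * (1 + 4 * real t)\<^sup>2)\<^sup>2 * ?M\<^sup>2 = (16384 * (1 + 4 * real t) ^ 4) * ?A"
      by (simp add: power_mult_distrib power_mult[symmetric])
    also have "real n ^ (2 * half k + 1) * ((16384 * (1 + 4 * real t) ^ 4) * ?A) ^ t =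
        real n ^ (2 * half k + 1) * (16384 * (1 + 4 * real t) ^ 4) ^ t * ?A ^ t"
      by (simp only: power_mult_distrib mult.assoc)
    also have "\<dots> \<le> (real n ^ (2 * half k + 1) * real n) * ?A ^ t"
      using c3 A0 by (intro mult_right_mono mult_left_mono) auto
    also have "\<dots> = real n ^ (2 * half k + 2) * ?A ^ t" by simp
    also have "\<dots> \<le> real n ^ (k + 2) * ?A ^ t"
      using n1 A0 hk by (intro mult_right_mono power_increasing) auto
    also have "\<dots> \<le> x ^ t * ?A ^ t" using x(2) A0 by (intro mult_right_mono) auto
    also have "\<dots> \<le> ((\<rho> ^ 4 * b)\<^sup>2) ^ t * ?A ^ t"
    proof (intro mult_right_mono power_mono)
      have "x * 1 \<le> (\<rho> ^ 4 * b) * (\<rho> ^ 4 * b)" using \<rho>b x1 by (intro mult_mono) auto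
      then show "x \<le> (\<rho> ^ 4 * b)\<^sup>2" by (simp add: power2_eq_square)
    qed (use x1 A0 in auto)
    also have "\<dots> = ((\<rho> ^ 4 * b)\<^sup>2 * ?A) ^ t" by (simp only: power_mult_distrib)
    also have "(\<rho> ^ 4 * b)\<^sup>2 * ?A = (\<rho> ^ 4 * m\<^sup>2 / 64)\<^sup>2"
      unfolding mf(1) by (simp add: power_mult_distrib power_divide power2_eq_square)
    finally have "?T \<le> ((\<rho> ^ 4 * m\<^sup>2 / 64)\<^sup>2) ^ t"
      using mult_right_mono[OF P, of "real n ^ (2 * t * (k - 2))"] unfolding b_def by simp
    then have "?T * ?e ^ (8 * t) \<le>
        ((\<rho> ^ 4 * m\<^sup>2 / 64)\<^sup>2) ^ t * ?e ^ (8 * t)" by (intro mult_right_mono) auto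
    also have "\<dots> = ((?e * \<rho> / 2) ^ 4 * (m / 2)\<^sup>2) ^ (2 * t)"
    proof -
      have "(?e * \<rho> / 2) ^ 4 * (m / 2)\<^sup>2 = (\<rho> ^ 4 * m\<^sup>2 / 64) * ?e ^ 4"
        by (simp add: power_mult_distrib power_divide)
      then show ?thesis by (simp only: power_mult_distrib power_mult[symmetric]) simp
    qed
    also have "\<dots> \<le> (R ^ 4 * ?w\<^sup>2) ^ (2 * t)"
    proof (rule power_mono)
      have "(m / 2)\<^sup>2 \<le> ?w\<^sup>2" using w mf(6) by (intro power_mono) auto
      then show "(?e * \<rho> / 2) ^ 4 * (m / 2)\<^sup>2 \<le> R ^ 4 * ?w\<^sup>2" by (rule mult_mono[OF R4]) auto
    qed simp
    finally show "?T * ?e ^ (8 * t) \<le>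
        (R ^ 4 * ?w\<^sup>2) ^ (2 * t)" .
  qed
qed

section \<open>The range of the bias and eventual acceptance\<close>

lemma eta_le: "n \<ge> 1 \<Longrightarrow> \<rho> > 0 \<Longrightarrow> k \<ge> 2 \<Longrightarrow> eta k \<beta> 1 \<rho> n \<le> \<rho> ^ k / 2"
proof -
  assume n: "n \<ge> 1" and \<rho>: "\<rho> > 0" and k: "k \<ge> 2"
  have "eta k \<beta> 1 \<rho> n \<le> \<rho> ^ (k - 2) * (\<rho>\<^sup>2 / 2)"
  proof -
    have "0 \<le> 1 / (\<rho> powr ((real k - 2) / 2) * real n powr ((real k - 4) / 4) * real n powr (\<beta> / 2))"
      "0 \<le> 1 / (\<rho> powr ((real k - 2) / 4) * real n powr (\<beta> / 2))" "0 \<le> 2 / real n" by simp_all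
    then show ?thesis unfolding eta_def using \<rho> by (intro mult_left_mono) (linarith, simp)
  qed
  also have "k = k - 2 + 2" using k by simp
  then have "\<rho> ^ (k - 2) * (\<rho>\<^sup>2 / 2) = \<rho> ^ k / 2" by (metis power_add times_divide_eq_right)
  finally show ?thesis .
qed

text \<open>Since the threshold is rounded, the failed test yields only \<eta> > -1/2^n. The
  prefactor \<rho>^(k-2) of \<eta> is at least n^(-\<beta>), so the bracket exceeds -1/n by
  \<open>small\<close>, and its term -2/n makes the rest positive. In particular the second error
  term is below \<rho>^2 / 2, that is, \<rho>^((k+6)/4) n^(\<beta>/2) > 2.\<close>

lemma bias_large:
  fixes \<beta> \<rho> :: real
  assumes k: "k \<ge> 4" and \<beta>: "\<beta> > 0" and n: "n \<ge> 1" and \<rho>: "\<rho> > 0" "real n powr (- \<beta> / (real k - 2)) \<le> \<rho>"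
    and small: "real n * real n powr \<beta> \<le> 2 ^ n"
    and T: "\<not> 2 ^ n < nat \<lfloor>2 ^ n * (1 - eta k \<beta> 1 \<rho> n)\<rfloor>"
  shows "real n powr (\<beta> / 5) \<le> \<rho> ^ 4 * real n powr \<beta>"
proof -
  let ?\<eta> = "eta k \<beta> 1 \<rho> n" let ?N = "real n"
  let ?a = "1 / (\<rho> powr ((real k - 2) / 2) * ?N powr ((real k - 4) / 4) * ?N powr (\<beta> / 2))"
  let ?b = "1 / (\<rho> powr ((real k - 2) / 4) * ?N powr (\<beta> / 2))"
  let ?B = "\<rho>\<^sup>2 / 2 - 1 * ?a - 1 * ?b - 2 / ?N"
  have n1: "1 \<le> ?N" using n by simp
  have "2 ^ n * (1 - ?\<eta>) < 2 ^ n + 1"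
  proof (rule ccontr)
    assume "\<not> 2 ^ n * (1 - ?\<eta>) < 2 ^ n + 1"
    then have "int (2 ^ n) < \<lfloor>2 ^ n * (1 - ?\<eta>)\<rfloor>" by (simp add: less_floor_iff)
    then show False using T by (simp add: zless_nat_eq_int_zless)
  qed
  then have \<eta>: "- 1 < 2 ^ n * ?\<eta>" by (simp add: algebra_simps)
  have rk: "?N powr (- \<beta>) \<le> \<rho> ^ (k - 2)"
  proof -
    have "(?N powr (- \<beta> / (real k - 2))) ^ (k - 2) = ?N powr (real (k - 2) * (- \<beta> / (real k - 2)))"
      using n1 by (simp add: powr_power mult.commute)
    also have "real (k - 2) * (- \<beta> / (real k - 2)) = - \<beta>" using k by (simp add: of_nat_diff)
    finally show ?thesis using power_mono[OF \<rho>(2), of "k - 2"] by simp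
  qed
  have "?B > - 1 / ?N"
  proof (rule ccontr)
    assume "\<not> ?B > - 1 / ?N"
    then have B: "?B \<le> - (1 / ?N)" by simp
    have "?\<eta> = \<rho> ^ (k - 2) * ?B" by (simp add: eta_def)
    also have "\<dots> \<le> \<rho> ^ (k - 2) * (- (1 / ?N))" using B \<rho>(1) by (intro mult_left_mono) auto
    also have "\<dots> = - (\<rho> ^ (k - 2) * (1 / ?N))" by simp
    also have "\<dots> \<le> - (?N powr (- \<beta>) * (1 / ?N))" using rk by (simp add: divide_right_mono)
    finally have "2 ^ n * ?\<eta> \<le> 2 ^ n * - (?N powr (- \<beta>) * (1 / ?N))" by (intro mult_left_mono) auto
    also have "\<dots> = - (2 ^ n / (?N * ?N powr \<beta>))" using n1 by (simp add: powr_minus field_simps)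
    also have "\<dots> \<le> - 1" using small n1 by simp
    finally show False using \<eta> by simp
  qed
  moreover have "- 1 / ?N = - (1 / ?N)" "2 / ?N = 2 * (1 / ?N)" by simp_all
  moreover have "0 \<le> ?a" "0 < 1 / ?N" using n1 by simp_all
  ultimately have "?b < \<rho>\<^sup>2 / 2" by linarith
  moreover have "0 < \<rho> powr ((real k - 2) / 4) * ?N powr (\<beta> / 2)" using \<rho>(1) n1 by simp
  ultimately have "2 < \<rho>\<^sup>2 * (\<rho> powr ((real k - 2) / 4) * ?N powr (\<beta> / 2))"
    by (simp add: field_simps)
  also have "\<rho>\<^sup>2 = \<rho> powr 2" using \<rho>(1) by simp
  also have "\<rho> powr 2 * (\<rho> powr ((real k - 2) / 4) * ?N powr (\<beta> / 2)) = \<rho> powr (2 + (real k - 2) / 4) * ?N powr (\<beta> / 2)"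
    by (simp only: powr_add mult.assoc)
  also have "2 + (real k - 2) / 4 = (real k + 6) / 4" by (simp add: field_simps)
  finally have key: "1 \<le> \<rho> powr ((real k + 6) / 4) * ?N powr (\<beta> / 2)" by simp
  \<comment> \<open>This power makes the exponent of \<rho> equal to 4 and that of n equal to 8
    \<beta> / (k + 6) \<le> 4 \<beta> / 5, with equality at k = 4. This is the origin of
    \<beta>/5.\<close>
  let ?q = "16 / (real k + 6)"
  have "1 \<le> (\<rho> powr ((real k + 6) / 4) * ?N powr (\<beta> / 2)) powr ?q"
    by (rule ge_one_powr_ge_zero[OF key]) simp
  also have "\<dots> = \<rho> powr ((real k + 6) / 4 * ?q) * ?N powr (\<beta> / 2 * ?q)"
    by (simp add: powr_mult powr_powr)
  also have "(real k + 6) / 4 * ?q = 4" by (simp add: field_simps)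
  also have "\<rho> powr 4 = \<rho> ^ 4" using \<rho>(1) by simp
  also have "\<rho> ^ 4 * ?N powr (\<beta> / 2 * ?q) \<le> \<rho> ^ 4 * ?N powr (\<beta> - \<beta> / 5)"
  proof (intro mult_left_mono powr_mono)
    have "1 / 2 * ?q \<le> 4 / 5" using k by (simp add: field_simps)
    then have "\<beta> * (1 / 2 * ?q) \<le> \<beta> * (4 / 5)" using \<beta> by (intro mult_left_mono) auto
    then show "\<beta> / 2 * ?q \<le> \<beta> - \<beta> / 5" by simp
  qed (use n1 \<rho> in auto)
  also have "\<dots> = \<rho> ^ 4 * ?N powr \<beta> / ?N powr (\<beta> / 5)"
    by (simp only: powr_diff times_divide_eq_right)
  finally show ?thesis using n1 by (simp add: pos_le_divide_eq)
qed

lemma accepts_eventually: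
  fixes \<rho> :: "nat \<Rightarrow> real"
  assumes k: "k \<ge> 4" and le: "(real k - 2) / 2 + \<beta> \<le> real k" and \<beta>: "\<beta> > 0"
    and t: "t > 0" "real t * (\<beta> / 5) \<ge> real k + 2" and \<rho>: "\<And>n. \<rho> n > 0"
    and large: "\<forall>\<^sub>F n in sequentially. real n powr (- \<beta> / (real k - 2)) \<le> \<rho> n"
  shows "\<forall>\<^sub>F n in sequentially. 1 - 6 / real n \<le>
    measure_pmf.prob (bits (2 ^ k * n ^ k) (real n powr ((real k - 2) / 2 + \<beta>) / (2 ^ k * real n ^ k)))
      {\<omega>. accepts k t n (\<rho> n) (1 - eta k \<beta> 1 (\<rho> n) n) (bit_val \<omega>)}"
proof -
  have e1: "\<forall>\<^sub>F n in sequentially. (64 * (1 + 2 * real t)\<^sup>2) ^ t \<le> real n"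
    "\<forall>\<^sub>F n in sequentially. (16384 * (1 + 4 * real t) ^ 4) ^ t \<le> real n"
    using filterlim_real_sequentially by (auto simp: filterlim_at_top)
  have "filterlim (\<lambda>n. real n powr (\<beta> / 5)) at_top sequentially" using \<beta> by real_asymp
  then have e2: "\<forall>\<^sub>F n in sequentially. 2 ^ (k + 6) \<le> real n powr (\<beta> / 5)" by (simp add: filterlim_at_top)
  have e3: "\<forall>\<^sub>F n in sequentially. real n * real n powr \<beta> \<le> 2 ^ n" using \<beta> by real_asymp
  have e4: "\<forall>\<^sub>F n in sequentially. 2 * real n powr (\<beta> / 5) \<le> 2 ^ n" using \<beta> by real_asymp
  have e5: "\<forall>\<^sub>F n in sequentially. n \<ge> 2" by (rule eventually_ge_at_top)
  show ?thesis
    using e1 e2 e3 e4 e5 large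
  proof eventually_elim
    case (elim n)
    let ?\<rho> = "\<rho> n"
    let ?\<eta> = "eta k \<beta> 1 ?\<rho> n"
    let ?x = "real n powr (\<beta> / 5)"
    define m where "m = real n powr ((real k - 2) / 2 + \<beta>)"
    let ?Q = "bits (2 ^ k * n ^ k) (m / (2 ^ k * real n ^ k))"
    let ?good = "{\<omega>. m / 2 \<le> weight k n (bit_val \<omega>) \<and>
      mtrace (matG k n (bit_val \<omega>)) n (2 * t) \<le> n * boundG t n (m / n) \<and>
      mtrace (matP k n (bit_val \<omega>)) (n ^ (2 * half k)) (2 * t) \<le> n * boundP k t n (real n powr \<beta>)}"
    have n: "n \<ge> 1" "2 \<le> real n" using elim by simp_all
    note mf = m_facts[OF k \<beta> n(1), folded m_def]
    have "m \<le> real n powr real k" unfolding m_def using n le by (intro powr_mono) auto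
    then have mk: "m \<le> real n ^ k" using n by (simp add: powr_realpow)
    have prob: "1 - 6 / real n \<le> measure_pmf.prob ?Q ?good"
      using k by (intro good_probability mk mf) (use n mf in auto)
    have "?good \<subseteq> {\<omega>. accepts k t n ?\<rho> (1 - ?\<eta>) (bit_val \<omega>)}"
    proof (rule subsetI, rule CollectI)
      fix \<omega> assume good: "\<omega> \<in> ?good"
      then have w: "m / 2 \<le> weight k n (bit_val \<omega>)" by simp
      have w1: "1 \<le> weight k n (bit_val \<omega>)" using w mf(5) n by linarith
      show "accepts k t n ?\<rho> (1 - ?\<eta>) (bit_val \<omega>)"
      proof (cases "2 ^ n < nat \<lfloor>2 ^ n * (1 - ?\<eta>)\<rfloor>")
        case True
        then show ?thesis using w1 by (simp add: accepts_def accept_def)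
      next
        case False
        have key: "?x \<le> ?\<rho> ^ 4 * real n powr \<beta>"
          by (rule bias_large[OF k \<beta> n(1) \<rho> _ _ False]) (use elim in auto)
        have xt: "real n ^ (k + 2) \<le> ?x ^ t"
        proof -
          have "real n ^ (k + 2) = real n powr (real (k + 2))" using n by (simp only: powr_realpow)
          also have "\<dots> \<le> real n powr (real t * (\<beta> / 5))" using n t by (intro powr_mono) auto
          also have "\<dots> = ?x ^ t" using n by (simp add: powr_power mult.commute)
          finally show ?thesis .
        qed
        \<comment> \<open>With n^\<beta> = x^5 the slack reads 1 \<le> (\<rho> x)^4. As x grows more
          slowly than 2^n, this gives 2^n \<rho> \<ge> 2, so that rounding down loses at most a
          factor 2.\<close>
        have \<rho>x: "1 \<le> ?\<rho> * ?x"
        proof -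
          have "real n powr \<beta> = ?x ^ 5" using n by (simp add: powr_power)
          then have "?x * 1 \<le> ?x * (?\<rho> * ?x) ^ 4" using key by (simp add: power_mult_distrib numeral_eq_Suc mult_ac)
          then have "1 ^ 4 \<le> (?\<rho> * ?x) ^ 4" using n by simp
          moreover have "0 \<le> ?\<rho> * ?x" using \<rho>[of n] by simp
          ultimately show ?thesis using power_strict_mono[of "?\<rho> * ?x" 1 4] by linarith
        qed
        have "2 \<le> 2 ^ n * ?\<rho>"
        proof -
          have "2 * 1 \<le> 2 * (?\<rho> * ?x)" using \<rho>x by simp
          also have "\<dots> = ?\<rho> * (2 * ?x)" by simp
          also have "\<dots> \<le> ?\<rho> * 2 ^ n" using elim \<rho>[of n] by (intro mult_left_mono) auto
          finally show ?thesis by (simp add: mult.commute)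
        qed
        then have R: "2 ^ n * ?\<rho> / 2 \<le> real (nat \<lfloor>2 ^ n * ?\<rho>\<rfloor>)" by linarith
        have "certificate k t n (real (nat \<lfloor>2 ^ n * ?\<rho>\<rfloor>)) (bit_val \<omega>)"
          by (rule certificate_holds[OF k \<beta> n(1) \<rho> _ xt key _ _ R m_def w]) (use elim good in auto)
        then show ?thesis using w1 by (simp add: accepts_def accept_def)
      qed
    qed
    then have "measure_pmf.prob ?Q ?good \<le> measure_pmf.prob ?Q {\<omega>. accepts k t n ?\<rho> (1 - ?\<eta>) (bit_val \<omega>)}"
      by (intro measure_pmf.finite_measure_mono) auto
    then show ?case using prob unfolding m_def by linarith
  qed
qed

theorem theorem6p3:
  fixes k :: nat and \<beta> :: real
  assumes "k \<ge> 4"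
    and "(real k - 2) / 2 + \<beta> \<le> real k"
  shows "\<exists>(P :: program) (A :: real) (a :: nat). A > 0 \<and>
    polynomial_time P {encode k n r t I | n r t I. n \<ge> 1 \<and> r > 0 \<and> I \<subseteq> clauses k n} \<and>
    (\<forall>\<rho> :: nat \<Rightarrow> real.
      (\<forall>n. \<rho> n > 0) \<and> (\<lambda>n. ln (real n) ^ 6 / real n powr (\<beta> / (real k - 2))) \<in> o(\<rho>) \<longrightarrow>
      (let m = (\<lambda>n. real n powr ((real k - 2) / 2 + \<beta>));
           \<eta> = (\<lambda>n. eta k \<beta> (A * ln (real n) ^ a) (\<rho> n) n)
       in certifies_whp P
            (\<lambda>n. Pow (clauses k n))
            (\<lambda>n. encode k n (\<rho> n) (1 - \<eta> n))
            (\<lambda>n. random_instance k (m n) n)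
            (\<lambda>n I. \<not> (\<exists>x \<in> assignments n.
               biased n (2 * \<rho> n) x \<and> frac_satisfying (1 - \<eta> n) I x))))"
proof -
  have k1: "k \<ge> 1" using assms(1) by simp
  \<comment> \<open>The exponent t = 2^i is a power of two for \<open>quad_power_le_trace\<close>,
    and large enough that (n^(\<beta>/5))^t \<ge> n^(k + 2).\<close>
  obtain i :: nat where i: "\<beta> > 0 \<Longrightarrow> real (2 ^ i) * (\<beta> / 5) \<ge> real k + 2"
  proof -
    obtain i :: nat where i: "(real k + 2) / (\<beta> / 5) < 2 ^ i"
      using real_arch_pow[of 2 "(real k + 2) / (\<beta> / 5)"] by auto
    have "real (2 ^ i) * (\<beta> / 5) \<ge> real k + 2" if "\<beta> > 0"
      using i that by (simp add: pos_divide_less_eq)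
    then show ?thesis using that by blast
  qed
  define t :: nat where "t = 2 ^ i"
  have t0: "t > 0" by (simp add: t_def)
  obtain d where d: "\<And>n r T I. n \<ge> 1 \<Longrightarrow> \<exists>u. computes (certifier k t) (encode k n r T I) u
      (of_bool (accepts k t n r T (indic k n I))) \<and> u \<le> d * input_size (encode k n r T I) ^ d + d"
    using certifier_computes[OF k1, of t] by blast
  have poly: "polynomial_time (certifier k t) {encode k n r t I | n r t I. n \<ge> 1 \<and> r > 0 \<and> I \<subseteq> clauses k n}"
    unfolding polynomial_time_def using d by blast
  have cert: "certifies_whp (certifier k t) (\<lambda>n. Pow (clauses k n)) (\<lambda>n. encode k n (\<rho> n) (1 - eta k \<beta> 1 (\<rho> n) n))
      (\<lambda>n. random_instance k (real n powr ((real k - 2) / 2 + \<beta>)) n)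
      (\<lambda>n I. \<not> (\<exists>x \<in> assignments n. biased n (2 * \<rho> n) x \<and> frac_satisfying (1 - eta k \<beta> 1 (\<rho> n) n) I x))"
    if \<rho>: "\<And>n. \<rho> n > 0" and o: "(\<lambda>n. ln (real n) ^ 6 / real n powr (\<beta> / (real k - 2))) \<in> o(\<rho>)" for \<rho> :: "nat \<Rightarrow> real"
    unfolding certifies_whp_def
  proof (intro conjI allI impI ballI)
    fix n :: nat and I assume n: "1 \<le> n" and I: "I \<in> Pow (clauses k n)"
    let ?\<eta> = "eta k \<beta> 1 (\<rho> n) n"
    obtain u where u: "computes (certifier k t) (encode k n (\<rho> n) (1 - ?\<eta>) I) u
      (of_bool (accepts k t n (\<rho> n) (1 - ?\<eta>) (indic k n I)))" using d[OF n] by blast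
    have "?\<eta> \<le> \<rho> n ^ k / 2" using n \<rho> assms(1) by (intro eta_le) auto
    then have "accepts k t n (\<rho> n) (1 - ?\<eta>) (indic k n I) \<Longrightarrow>
        \<not> (\<exists>x \<in> assignments n. biased n (2 * \<rho> n) x \<and> frac_satisfying (1 - ?\<eta>) I x)"
      using accepts_sound[OF assms(1) n \<rho>] I unfolding t_def by blast
    then show "\<exists>u v. computes (certifier k t) (encode k n (\<rho> n) (1 - ?\<eta>) I) u v \<and> v \<in> {0, 1} \<and>
        (v = 1 \<longrightarrow> \<not> (\<exists>x \<in> assignments n. biased n (2 * \<rho> n) x \<and> frac_satisfying (1 - ?\<eta>) I x))"
      using u by (intro exI[of _ u] exI[of _ "of_bool (accepts k t n (\<rho> n) (1 - ?\<eta>) (indic k n I)) :: nat"]) auto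
  next
    let ?p = "\<lambda>n. measure_pmf.prob (bits (2 ^ k * n ^ k) (real n powr ((real k - 2) / 2 + \<beta>) / (2 ^ k * real n ^ k)))
      {\<omega>. accepts k t n (\<rho> n) (1 - eta k \<beta> 1 (\<rho> n) n) (bit_val \<omega>)}"
    have ev: "\<forall>\<^sub>F n in sequentially. norm (ln (real n) ^ 6 / real n powr (\<beta> / (real k - 2))) \<le> c * norm (\<rho> n)"
      if "c > 0" for c
      using landau_o.smallD[OF o that] .
    have "\<forall>\<^sub>F n in sequentially. 1 - 6 / real n \<le> ?p n"
    proof (cases "\<beta> > 0")
      case True
      have "\<forall>\<^sub>F n in sequentially. real n powr (- \<beta> / (real k - 2)) \<le> \<rho> n"
        using ev[of 1, OF zero_less_one] eventually_ge_at_top[of 3]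
      proof eventually_elim
        case (elim n)
        have "ln 3 \<le> ln (real n)" using elim by simp
        then have "1 \<le> ln (real n)" using ln3_gt_1 by linarith
        then have "1 \<le> ln (real n) ^ 6" by simp
        then have "1 / real n powr (\<beta> / (real k - 2)) \<le> ln (real n) ^ 6 / real n powr (\<beta> / (real k - 2))"
          by (intro divide_right_mono) auto
        also have "\<dots> \<le> \<rho> n" using elim \<rho>[of n] by simp
        finally show ?case by (simp add: powr_minus_divide)
      qed
      then show ?thesis
        using i[OF True] \<rho> t0 unfolding t_def
        by (intro accepts_eventually[where \<rho> = \<rho>, OF assms True]) auto
    next
      \<comment> \<open>For \<beta> \<le> 0 the denominator n^(\<beta>/(k-2)) is at most 1, so
        \<rho> outgrows a power of the logarithm. The constant 1/2 gives \<rho> \<ge> 2, which keeps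
        the rounded value above 2^n: every instance is accepted by the first disjunct of
        \<open>accept\<close>.\<close>
      case False
      have "\<forall>\<^sub>F n in sequentially. 2 \<le> \<rho> n"
        using ev[of "1 / 2", OF half_gt_zero[OF zero_less_one]] eventually_ge_at_top[of 3]
      proof eventually_elim
        case (elim n)
        have "ln 3 \<le> ln (real n)" using elim by simp
        then have "1 \<le> ln (real n)" using ln3_gt_1 by linarith
        then have "1 \<le> ln (real n) ^ 6" by simp
        moreover have "real n powr (\<beta> / (real k - 2)) \<le> real n powr 0"
          using elim False assms(1) by (intro powr_mono) (auto simp: divide_nonpos_pos)
        then have "real n powr (\<beta> / (real k - 2)) \<le> 1" using elim by simp
        ultimately have "1 \<le> ln (real n) ^ 6 / real n powr (\<beta> / (real k - 2))"
          using elim by (simp add: divide_simps) 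
        also have "\<dots> \<le> \<rho> n / 2" using elim \<rho>[of n] by simp
        finally show ?case by simp
      qed
      then show ?thesis
      proof eventually_elim
        case (elim n)
        have "accepts k t n (\<rho> n) (1 - eta k \<beta> 1 (\<rho> n) n) (bit_val \<omega>)" for \<omega>
        proof -
          have "(2::real) ^ n * 2 \<le> 2 ^ n * \<rho> n" using elim by simp
          then have "(2::real) ^ n + 1 \<le> 2 ^ n * \<rho> n" using one_le_power[of "2::real" n] by linarith
          then have "2 ^ n < nat \<lfloor>2 ^ n * \<rho> n\<rfloor>" by (simp add: zless_nat_eq_int_zless less_floor_iff)
          then show ?thesis by (simp add: accepts_def accept_def)
        qed
        then show ?case by simp
      qed
    qed
    moreover have "(\<lambda>n. 1 - 6 / real n) \<longlonglongrightarrow> 1" by real_asymp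
    moreover have "\<forall>\<^sub>F n in sequentially. ?p n \<le> 1" by simp
    ultimately have "?p \<longlonglongrightarrow> 1"
      by (intro tendsto_sandwich[of "\<lambda>n. 1 - 6 / real n" ?p sequentially "\<lambda>_. 1" 1]) auto
    moreover have "\<forall>\<^sub>F n in sequentially. ?p n =
        measure_pmf.prob (random_instance k (real n powr ((real k - 2) / 2 + \<beta>)) n)
          {I. \<exists>u. computes (certifier k t) (encode k n (\<rho> n) (1 - eta k \<beta> 1 (\<rho> n) n) I) u 1}"
      using eventually_ge_at_top[of 1] by eventually_elim (rule prob_computes[OF k1, symmetric])
    ultimately show "(\<lambda>n. measure_pmf.prob (random_instance k (real n powr ((real k - 2) / 2 + \<beta>)) n)
          {I. \<exists>u. computes (certifier k t) (encode k n (\<rho> n) (1 - eta k \<beta> 1 (\<rho> n) n) I) u 1}) \<longlonglongrightarrow> 1"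
      by (rule Lim_transform_eventually)
  qed
  \<comment> \<open>The slack is polynomial, so the hidden polylogarithmic factor can be taken as
    the constant 1: A = 1 and a = 0.\<close>
  show ?thesis
    unfolding Let_def using poly cert
    by (intro exI[of _ "certifier k t"] exI[of _ "1::real"] exI[of _ "0::nat"]) auto
qed

end
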